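(* Let $d=2$ or $3$ and suppose $V\in L^\infty(\mathbb{R}^d)$ is real-valued and periodic with respect to a lattice on $\mathbb{R}^d$ which contains a rational rank $d-1$ sublattice. Then the spectrum of the self-adjoint operator $-\Delta+V$ on $L^2(\mathbb{R}^d)$ contains no eigenvalues.
   Context: The operator $-\Delta+V$ has domain $H^2(\mathbb{R}^d)$. A lattice on $\mathbb{R}^d$ has full rank $d$; $V$ is periodic with respect to it if $V(x+l)=V(x)$ for every lattice vector $l$ (and a.e. $x$). A lattice $\Lambda$ (here a rank $d-1$ discrete subgroup) is rational if its Gram matrix with respect to a basis is a positive real multiple of a matrix with rational entries; equivalently, there is $\sigma>0$ such that $\sigma\,l\cdot l'\in\mathbb{Q}$ for all $l,l'\in\Lambda$. *)

theory Defs
  imports "HOL-Analysis.Analysis"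
begin

section \<open>Lattices\<close>

definition int_span :: "'a::real_vector set \<Rightarrow> 'a set"
  where "int_span B = {\<Sum>b\<in>B. real_of_int (c b) *\<^sub>R b | c :: 'a \<Rightarrow> int. True}"

definition lattice_basis :: "'a::euclidean_space set \<Rightarrow> 'a set \<Rightarrow> bool"
  where "lattice_basis B L \<longleftrightarrow> finite B \<and> independent B \<and> L = int_span B"

definition lattice_of_rank :: "nat \<Rightarrow> 'a::euclidean_space set \<Rightarrow> bool"
  where "lattice_of_rank k L \<longleftrightarrow> (\<exists>B. lattice_basis B L \<and> card B = k)"

text \<open>The Gram matrix of some basis is a positive multiple of a rational matrix.\<close>

definition rational_lattice :: "'a::euclidean_space set \<Rightarrow> bool"
  where "rational_lattice L \<longleftrightarrow>
    (\<exists>B. lattice_basis B L \<and> (\<exists>\<sigma>>0. \<forall>b\<in>B. \<forall>b'\<in>B. \<sigma> * (b \<bullet> b') \<in> \<rat>))"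

definition periodic_wrt :: "'a::euclidean_space set \<Rightarrow> ('a \<Rightarrow> real) \<Rightarrow> bool"
  where "periodic_wrt L V \<longleftrightarrow> (\<forall>l\<in>L. AE x in lebesgue. V (x + l) = V x)"


section \<open>Function spaces\<close>

text \<open>
  Elements of \<open>L\<^sup>2\<close> and \<open>L\<^sup>\<infinity>\<close> are represented by functions; equality in these spaces
  is equality almost everywhere.
\<close>

definition Linfty :: "('a::euclidean_space \<Rightarrow> real) set"
  where "Linfty = {V \<in> borel_measurable lebesgue. \<exists>C. AE x in lebesgue. \<bar>V x\<bar> \<le> C}"

definition L2 :: "('a::euclidean_space \<Rightarrow> complex) set"
  where "L2 = {u \<in> borel_measurable lebesgue. integrable lebesgue (\<lambda>x. (cmod (u x))\<^sup>2)}"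

definition L2_norm :: "('a::euclidean_space \<Rightarrow> complex) \<Rightarrow> real"
  where "L2_norm u = sqrt (\<integral>x. (cmod (u x))\<^sup>2 \<partial>lebesgue)"

definition pderiv_along :: "'a::euclidean_space \<Rightarrow> ('a \<Rightarrow> complex) \<Rightarrow> 'a \<Rightarrow> complex"
  where "pderiv_along b f = (\<lambda>x. frechet_derivative f (at x) b)"

primrec C_k :: "nat \<Rightarrow> ('a::euclidean_space \<Rightarrow> complex) set"
  where
    "C_k 0 = {f. continuous_on UNIV f}"
  | "C_k (Suc k) = {f. (\<forall>x. f differentiable (at x)) \<and> (\<forall>b\<in>Basis. pderiv_along b f \<in> C_k k)}"

definition test_functions :: "('a::euclidean_space \<Rightarrow> complex) set"
  where "test_functions = {\<phi>. (\<forall>k. \<phi> \<in> C_k k) \<and> compact (closure {x. \<phi> x \<noteq> 0})}"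

definition locally_integrable :: "('a::euclidean_space \<Rightarrow> complex) \<Rightarrow> bool"
  where "locally_integrable u \<longleftrightarrow> (\<forall>K. compact K \<longrightarrow> set_integrable lebesgue K u)"

definition weak_pderiv ::
    "'a::euclidean_space \<Rightarrow> ('a \<Rightarrow> complex) \<Rightarrow> ('a \<Rightarrow> complex) \<Rightarrow> bool"
  where "weak_pderiv b u g \<longleftrightarrow> locally_integrable u \<and> locally_integrable g \<and>
    (\<forall>\<phi>\<in>test_functions.
       (\<integral>x. u x * pderiv_along b \<phi> x \<partial>lebesgue) = - (\<integral>x. g x * \<phi> x \<partial>lebesgue))"

text \<open>\<open>Sobolev k\<close> is \<open>H\<^sup>k = W\<^bsup>k,2\<^esup>\<close> on the whole space.\<close>

primrec Sobolev :: "nat \<Rightarrow> ('a::euclidean_space \<Rightarrow> complex) set"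
  where
    "Sobolev 0 = L2"
  | "Sobolev (Suc k) = {u \<in> L2. \<forall>b\<in>Basis. \<exists>g\<in>Sobolev k. weak_pderiv b u g}"

definition weak_laplacian ::
    "('a::euclidean_space \<Rightarrow> complex) \<Rightarrow> ('a \<Rightarrow> complex) \<Rightarrow> bool"
  where "weak_laplacian u w \<longleftrightarrow>
    (\<exists>g h. (\<forall>b\<in>Basis. weak_pderiv b u (g b) \<and> weak_pderiv b (g b) (h b)) \<and>
           (AE x in lebesgue. w x = (\<Sum>b\<in>Basis. h b x)))"


section \<open>Operators on \<open>L\<^sup>2\<close>\<close>

text \<open>
  An unbounded operator on \<open>L\<^sup>2\<close> is given by its graph, a set of pairs of representatives
  that is closed under almost everywhere equality in both components.
\<close>

type_synonym 'a L2_operator = "(('a \<Rightarrow> complex) \<times> ('a \<Rightarrow> complex)) set"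

definition schroedinger :: "('a::euclidean_space \<Rightarrow> real) \<Rightarrow> 'a L2_operator"
  where "schroedinger V = {(u, f). u \<in> Sobolev 2 \<and> f \<in> L2 \<and>
    (\<exists>w. weak_laplacian u w \<and>
         (AE x in lebesgue. f x = - w x + complex_of_real (V x) * u x))}"

definition eigenvalues :: "'a::euclidean_space L2_operator \<Rightarrow> complex set"
  where "eigenvalues T =
    {z. \<exists>u. (u, \<lambda>x. z * u x) \<in> T \<and> \<not> (AE x in lebesgue. u x = 0)}"

text \<open>
  The three conditions say that \<open>T - z\<close> is injective, that it is onto \<open>L\<^sup>2\<close>, and that its
  inverse is bounded.
\<close>

definition resolvent_set :: "'a::euclidean_space L2_operator \<Rightarrow> complex set"
  where "resolvent_set T = {z.
    (\<forall>u. (u, \<lambda>x. z * u x) \<in> T \<longrightarrow> (AE x in lebesgue. u x = 0)) \<and>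
    (\<forall>f\<in>L2. \<exists>u. (u, \<lambda>x. f x + z * u x) \<in> T) \<and>
    (\<exists>C. \<forall>(u, f)\<in>T. L2_norm u \<le> C * L2_norm (\<lambda>x. f x - z * u x))}"

definition op_spectrum :: "'a::euclidean_space L2_operator \<Rightarrow> complex set"
  where "op_spectrum T = - resolvent_set T"

lemma eigenvalues_subset_op_spectrum: "eigenvalues T \<subseteq> op_spectrum T"
  by (auto simp: eigenvalues_def op_spectrum_def resolvent_set_def)

end

theory Submission
  imports Defs
begin

text \<open>
  The proof follows Thomas. In lattice coordinates the potential commutes with integer translations.
  Cutting off an eigenfunction \<open>u\<close> by slowly varying bumps costs commutator errors that tend to zero
  in \<open>L\<^sup>2\<close>, so the Fourier transforms at \<open>\<theta> + n\<close>, with \<open>n\<close> an integer vector, converge for almost every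
  quasimomentum \<open>\<theta>\<close> to a sequence \<open>c \<theta>\<close> in the kernel of the fibre operator \<open>\<bar>P (\<theta> + n)\<bar>\<^sup>2 + W\<close>.
  On a line of quasimomenta \<open>\<theta> + \<kappa> \<eta>\<close> in the direction of a lattice vector the fibre operators
  form a quadratic pencil in \<open>\<kappa>\<close>. At a suitable \<open>\<kappa>\<close> with large imaginary part the symbol
  dominates \<open>W\<close>; relative to this point the real \<open>\<kappa>\<close> with nontrivial kernel become eigenvalues of a
  single compact operator, and so there are only countably many on each line. By Tonelli's theorem
  \<open>c \<theta> = 0\<close> for almost every \<open>\<theta>\<close>, and Parseval's identity on the torus gives \<open>u = 0\<close>.
\<close>

section \<open>Square-integrable functions\<close>

text \<open>The obstacle is to argue with fibres without ever building operators on them. The action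
  of W is kept only through one inequality on finite linear combinations: multiplication by a
  periodic W acts on functions on the torus in the same way for every quasimomentum, so its norm is
  at most \<omega> even on combinations of kernel vectors taken from different \<theta>. This is
  what makes the kernels along a line comparable. The operator at the complex point is likewise used
  only on their span, and analytic perturbation theory gives way to counting eigenvalues of a
  compact operator. Complex quasimomenta help because at \<rho> + i \<tau> the imaginary part of the
  symbol is 2 \<tau> (m + \<rho> \<beta>), where m runs through a translate of the multiples of 2
  pi; a good \<rho> keeps the bracket uniformly away from zero, and \<tau> scales it up. The
  eigenvalue z is absorbed in W = V - z. The commutators carry factors that grow with the frequency;
  this is harmless, as the equation passes to the limit at one frequency at a time.\<close>

definition square_integrable :: "'a measure \<Rightarrow> ('a \<Rightarrow> complex) \<Rightarrow> bool" where
  "square_integrable M f \<longleftrightarrow> f \<in> borel_measurable M \<and> integrable M (\<lambda>x. (cmod (f x))\<^sup>2)"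

definition ip :: "'a measure \<Rightarrow> ('a \<Rightarrow> complex) \<Rightarrow> ('a \<Rightarrow> complex) \<Rightarrow> complex" where
  "ip M f g = (\<integral>x. f x * cnj (g x) \<partial>M)"

text \<open>Only squared norms occur. The triangle inequality is replaced by
  \<open>sqnorm_add_le\<close> with constant 2 and, where the constant has to stay near 1, by
  \<open>sqnorm_add_le_eps\<close>.\<close>

definition sqnorm :: "'a measure \<Rightarrow> ('a \<Rightarrow> complex) \<Rightarrow> real" where
  "sqnorm M f = (\<integral>x. (cmod (f x))\<^sup>2 \<partial>M)"

lemma square_integrable_measurable [measurable_dest]:
  "square_integrable M f \<Longrightarrow> f \<in> borel_measurable M"
  by (simp add: square_integrable_def)

lemma borel_measurable_cnj [measurable]: "cnj \<in> borel_measurable borel"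
  by (intro borel_measurable_continuous_onI continuous_intros)

lemma cmod_mult_le: "cmod (a * cnj b) \<le> (cmod a)\<^sup>2 + (cmod b)\<^sup>2"
proof -
  have "2 * (cmod a * cmod b) \<le> (cmod a)\<^sup>2 + (cmod b)\<^sup>2"
    using sum_squares_bound[of "cmod a" "cmod b"] by simp
  moreover have "0 \<le> cmod a * cmod b" by simp
  ultimately show ?thesis unfolding norm_mult complex_mod_cnj by linarith
qed

lemma square_integrable_mult:
  assumes "square_integrable M f" "square_integrable M g"
  shows "integrable M (\<lambda>x. f x * cnj (g x))"
proof (rule Bochner_Integration.integrable_bound)
  show "integrable M (\<lambda>x. (cmod (f x))\<^sup>2 + (cmod (g x))\<^sup>2)"
    using assms by (simp add: square_integrable_def)
  have [measurable]: "f \<in> borel_measurable M" "g \<in> borel_measurable M"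
    using assms by (auto simp: square_integrable_def)
  show "(\<lambda>x. f x * cnj (g x)) \<in> borel_measurable M" by measurable
  show "AE x in M. norm (f x * cnj (g x)) \<le> norm ((cmod (f x))\<^sup>2 + (cmod (g x))\<^sup>2)"
    using cmod_mult_le by (auto intro!: AE_I2)
qed

lemma cmod_add_square_le: "(cmod (a + b))\<^sup>2 \<le> 2 * (cmod a)\<^sup>2 + 2 * (cmod b)\<^sup>2"
proof -
  have "(cmod (a + b))\<^sup>2 \<le> (cmod a + cmod b)\<^sup>2"
    by (intro power_mono norm_triangle_ineq) auto
  also have "\<dots> \<le> 2 * (cmod a)\<^sup>2 + 2 * (cmod b)\<^sup>2"
    using sum_squares_bound[of "cmod a" "cmod b"] by (simp add: power2_sum)
  finally show ?thesis .
qed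

lemma square_integrable_add [intro]:
  assumes "square_integrable M f" "square_integrable M g"
  shows "square_integrable M (\<lambda>x. f x + g x)"
proof -
  have [measurable]: "f \<in> borel_measurable M" "g \<in> borel_measurable M"
    using assms by (auto simp: square_integrable_def)
  have "integrable M (\<lambda>x. (cmod (f x + g x))\<^sup>2)"
  proof (rule Bochner_Integration.integrable_bound)
    show "integrable M (\<lambda>x. 2 * (cmod (f x))\<^sup>2 + 2 * (cmod (g x))\<^sup>2)"
      using assms by (simp add: square_integrable_def)
    show "AE x in M. norm ((cmod (f x + g x))\<^sup>2) \<le> norm (2 * (cmod (f x))\<^sup>2 + 2 * (cmod (g x))\<^sup>2)"
      using cmod_add_square_le by (auto intro!: AE_I2)
  qed measurable
  then show ?thesis by (simp add: square_integrable_def)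
qed

lemma square_integrable_scale [intro]:
  assumes "square_integrable M f"
  shows "square_integrable M (\<lambda>x. c * f x)"
  using assms by (auto simp: square_integrable_def norm_mult power_mult_distrib)

lemma square_integrable_diff [intro]:
  assumes "square_integrable M f" "square_integrable M g"
  shows "square_integrable M (\<lambda>x. f x - g x)"
  using square_integrable_add[OF assms(1) square_integrable_scale[OF assms(2), of "-1"]] by simp

lemma square_integrable_zero [simp, intro]: "square_integrable M (\<lambda>x. 0)"
  by (simp add: square_integrable_def)

lemma square_integrable_sum [intro]:
  assumes "\<And>i. i \<in> I \<Longrightarrow> square_integrable M (f i)"
  shows "square_integrable M (\<lambda>x. \<Sum>i\<in>I. f i x)"
  using assms by (induction I rule: infinite_finite_induct) auto

lemma ip_add_left:
  assumes "square_integrable M f" "square_integrable M g" "square_integrable M h"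
  shows "ip M (\<lambda>x. f x + g x) h = ip M f h + ip M g h"
  unfolding ip_def distrib_right
  by (intro Bochner_Integration.integral_add square_integrable_mult assms)

lemma ip_scale_left: "ip M (\<lambda>x. c * f x) h = c * ip M f h"
  unfolding ip_def mult.assoc by (rule integral_mult_right_zero)

lemma ip_diff_left:
  assumes "square_integrable M f" "square_integrable M g" "square_integrable M h"
  shows "ip M (\<lambda>x. f x - g x) h = ip M f h - ip M g h"
  unfolding ip_def left_diff_distrib
  by (intro Bochner_Integration.integral_diff square_integrable_mult assms)

lemma ip_sum_left:
  assumes "\<And>i. i \<in> I \<Longrightarrow> square_integrable M (f i)" "square_integrable M h"
  shows "ip M (\<lambda>x. \<Sum>i\<in>I. f i x) h = (\<Sum>i\<in>I. ip M (f i) h)"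
  unfolding ip_def sum_distrib_right
  by (intro Bochner_Integration.integral_sum square_integrable_mult assms)

lemma ip_cnj: "ip M g f = cnj (ip M f g)"
  unfolding ip_def by (subst Bochner_Integration.integral_cnj [symmetric]) (simp add: mult.commute)

lemma ip_self: "ip M f f = of_real (sqnorm M f)"
  unfolding ip_def sqnorm_def complex_norm_square[symmetric] by (simp flip: of_real_power)

lemma sqnorm_nonneg [simp]: "0 \<le> sqnorm M f"
  unfolding sqnorm_def by (rule integral_nonneg_AE) simp

lemma ip_diff_right:
  assumes "square_integrable M f" "square_integrable M g" "square_integrable M h"
  shows "ip M h (\<lambda>x. f x - g x) = ip M h f - ip M h g"
  using ip_diff_left[OF assms] by (metis complex_cnj_diff ip_cnj)

lemma ip_add_right:
  assumes "square_integrable M f" "square_integrable M g" "square_integrable M h"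
  shows "ip M h (\<lambda>x. f x + g x) = ip M h f + ip M h g"
  using ip_add_left[OF assms] by (metis complex_cnj_add ip_cnj)

lemma ip_scale_right: "ip M h (\<lambda>x. c * f x) = cnj c * ip M h f"
  by (metis complex_cnj_mult ip_cnj ip_scale_left)

lemma ip_sum_right:
  assumes "\<And>i. i \<in> I \<Longrightarrow> square_integrable M (f i)" "square_integrable M h"
  shows "ip M h (\<lambda>x. \<Sum>i\<in>I. f i x) = (\<Sum>i\<in>I. ip M h (f i))"
  by (subst ip_cnj, subst ip_sum_left) (auto simp: assms ip_cnj[of M h])

text \<open>Completing the square. With \<open>a i\<close> the Fourier coefficients this is Bessel's
  identity; with arbitrary \<open>a\<close> it says that the Fourier partial sum is the best
  approximation, which gives Parseval; with \<open>f = 0\<close> it gives the norm of a finite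
  orthonormal sum.\<close>

lemma sqnorm_diff_orthonormal:
  assumes "finite I" and f: "square_integrable M f"
    and e: "\<And>i. i \<in> I \<Longrightarrow> square_integrable M (e i)"
    and on: "\<And>i j. i \<in> I \<Longrightarrow> j \<in> I \<Longrightarrow> ip M (e i) (e j) = (if i = j then 1 else 0)"
  shows "sqnorm M (\<lambda>x. f x - (\<Sum>i\<in>I. a i * e i x)) =
    sqnorm M f - (\<Sum>i\<in>I. (cmod (ip M f (e i)))\<^sup>2) + (\<Sum>i\<in>I. (cmod (a i - ip M f (e i)))\<^sup>2)"
proof -
  define p where "p = (\<lambda>x. \<Sum>i\<in>I. a i * e i x)"
  have p: "square_integrable M p" unfolding p_def by (intro square_integrable_sum square_integrable_scale e)
  have fp: "ip M f p = (\<Sum>i\<in>I. cnj (a i) * ip M f (e i))"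
    unfolding p_def by (subst ip_sum_right) (auto simp: f e ip_scale_right)
  have ep: "ip M (e j) p = cnj (a j)" if "j \<in> I" for j
  proof -
    have "ip M (e j) p = (\<Sum>i\<in>I. cnj (a i) * ip M (e j) (e i))"
      unfolding p_def using that by (subst ip_sum_right) (auto simp: f e ip_scale_right)
    also have "\<dots> = (\<Sum>i\<in>I. if i = j then cnj (a j) else 0)"
      using on that by (intro sum.cong) auto
    also have "\<dots> = cnj (a j)" using that \<open>finite I\<close> by simp
    finally show ?thesis .
  qed
  have pp: "ip M p p = (\<Sum>i\<in>I. a i * cnj (a i))"
  proof -
    have "ip M p p = (\<Sum>i\<in>I. ip M (\<lambda>x. a i * e i x) p)"
      using ip_sum_left[of I M "\<lambda>i x. a i * e i x" p] square_integrable_scale[OF e] p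
      by (simp add: p_def)
    also have "\<dots> = (\<Sum>i\<in>I. a i * cnj (a i))"
      using ep by (intro sum.cong) (auto simp: ip_scale_left)
    finally show ?thesis .
  qed
  have "of_real (sqnorm M (\<lambda>x. f x - p x)) = ip M f f - ip M f p - (cnj (ip M f p) - ip M p p)"
    unfolding ip_self[symmetric]
    by (simp add: ip_diff_left ip_diff_right f p square_integrable_diff ip_cnj[of M p f])
  also have "\<dots> = of_real (sqnorm M f) - (\<Sum>i\<in>I. ip M f (e i) * cnj (ip M f (e i)))
      + (\<Sum>i\<in>I. (a i - ip M f (e i)) * cnj (a i - ip M f (e i)))"
    unfolding fp pp by (simp add: ip_self sum.distrib sum_subtractf algebra_simps)
  also have "\<dots> = of_real (sqnorm M f - (\<Sum>i\<in>I. (cmod (ip M f (e i)))\<^sup>2) +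
      (\<Sum>i\<in>I. (cmod (a i - ip M f (e i)))\<^sup>2))"
    unfolding of_real_add of_real_diff of_real_sum complex_norm_square ..
  finally show ?thesis unfolding p_def of_real_eq_iff .
qed

lemma bessel:
  assumes "finite I" and f: "square_integrable M f"
    and e: "\<And>i. i \<in> I \<Longrightarrow> square_integrable M (e i)"
    and on: "\<And>i j. i \<in> I \<Longrightarrow> j \<in> I \<Longrightarrow> ip M (e i) (e j) = (if i = j then 1 else 0)"
  shows "(\<Sum>i\<in>I. (cmod (ip M f (e i)))\<^sup>2) \<le> sqnorm M f"
  using sqnorm_diff_orthonormal[of I M f e "\<lambda>i. ip M f (e i)"] assms
    sqnorm_nonneg[of M "\<lambda>x. f x - (\<Sum>i\<in>I. ip M f (e i) * e i x)"] by simp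

text \<open>Gram-Schmidt in one induction: project on the first n vectors, then along the part
  \<open>g\<close> of \<open>x n\<close> orthogonal to them. Explicit coefficients are produced
  because the operator of \<open>no_infinite_spectrum\<close> is known only on combinations of the
  \<open>x j\<close>.\<close>

lemma exists_projection:
  fixes x :: "nat \<Rightarrow> 'a \<Rightarrow> complex"
  assumes x: "\<And>j. square_integrable M (x j)"
    and indep: "\<And>n. \<forall>\<gamma>. sqnorm M (\<lambda>i. \<Sum>j<n. \<gamma> j * x j i) = 0 \<longrightarrow> (\<forall>j<n. \<gamma> j = 0)"
  shows "square_integrable M f \<Longrightarrow>
    \<exists>\<gamma>. \<forall>m<n. ip M (\<lambda>i. f i - (\<Sum>j<n. \<gamma> j * x j i)) (x m) = 0"
proof (induction n arbitrary: f)
  case 0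
  then show ?case by simp
next
  case (Suc n)
  obtain \<gamma> where \<gamma>: "\<And>m. m < n \<Longrightarrow> ip M (\<lambda>i. f i - (\<Sum>j<n. \<gamma> j * x j i)) (x m) = 0"
    using Suc by blast
  obtain \<delta> where \<delta>: "\<And>m. m < n \<Longrightarrow> ip M (\<lambda>i. x n i - (\<Sum>j<n. \<delta> j * x j i)) (x m) = 0"
    using Suc.IH[OF x] by blast
  define f' where "f' = (\<lambda>i. f i - (\<Sum>j<n. \<gamma> j * x j i))"
  define g where "g = (\<lambda>i. x n i - (\<Sum>j<n. \<delta> j * x j i))"
  have f': "square_integrable M f'" and g: "square_integrable M g"
    unfolding f'_def g_def by (intro square_integrable_diff square_integrable_sum square_integrable_scale x Suc.prems)+
  have g_eq: "g = (\<lambda>i. \<Sum>j<Suc n. (if j = n then 1 else - \<delta> j) * x j i)"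
    unfolding g_def by (auto simp: sum_negf intro!: sum.cong)
  \<comment> \<open>The coefficient of \<open>x n\<close> in \<open>g\<close> is 1, so independence
    keeps \<open>g\<close> from being null.\<close>
  have gg: "sqnorm M g \<noteq> 0"
    using indep[THEN spec[of _ "\<lambda>j. if j = n then 1 else - \<delta> j"], of "Suc n"] unfolding g_eq by auto
  have g_orth: "ip M h g = ip M h (x n)"
    if h: "square_integrable M h" "\<And>m. m < n \<Longrightarrow> ip M h (x m) = 0" for h
    unfolding g_def
    by (subst ip_diff_right, use x h in force, use x h in force, use h in force,
        subst ip_sum_right) (auto simp: x h ip_scale_right)
  define c where "c = ip M f' g / ip M g g"
  have *: "ip M (\<lambda>i. f' i - c * g i) (x m) = 0" if "m < Suc n" for m
  proof (cases "m = n")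
    case True
    have "ip M (\<lambda>i. f' i - c * g i) (x n) = ip M f' (x n) - c * ip M g (x n)"
      by (subst ip_diff_left) (auto simp: f' g x ip_scale_left)
    also have "\<dots> = ip M f' g - c * ip M g g"
      using g_orth[OF f'] g_orth[OF g] \<gamma> \<delta> by (simp add: f'_def g_def)
    also have "\<dots> = 0" using gg by (simp add: c_def ip_self)
    finally show ?thesis using True by simp
  next
    case False
    then show ?thesis using that \<gamma>[of m] \<delta>[of m]
      by (subst ip_diff_left) (auto simp: f' g x ip_scale_left, simp add: f'_def g_def)
  qed
  have "(\<lambda>i. f' i - c * g i) =
      (\<lambda>i. f i - (\<Sum>j<Suc n. (if j = n then c else \<gamma> j - c * \<delta> j) * x j i))"
    unfolding f'_def g_def
    by (auto simp: algebra_simps sum_subtractf sum_distrib_left sum.distrib)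
  then show ?case using * by (intro exI[of _ "\<lambda>j. if j = n then c else \<gamma> j - c * \<delta> j"]) auto
qed


section \<open>Square-summable families and compact operators on them\<close>

lemma integrable_count_space_point:
  "integrable (count_space UNIV) (\<lambda>i. indicator {k} i * (c :: real))"
  by (intro integrable_mult_left integrable_real_indicator) auto

lemma sqnorm_count_space_ge_point:
  assumes "square_integrable (count_space UNIV) f"
  shows "(cmod (f k))\<^sup>2 \<le> sqnorm (count_space UNIV) f"
proof -
  have "(cmod (f k))\<^sup>2 = (\<integral>i. indicator {k} i * (cmod (f k))\<^sup>2 \<partial>count_space UNIV)"
    by simp
  also have "\<dots> \<le> sqnorm (count_space UNIV) f"
    unfolding sqnorm_def
    using assms by (intro integral_mono integrable_count_space_point)
      (auto simp: square_integrable_def indicator_def)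
  finally show ?thesis .
qed

lemma sqnorm_count_space_eq_0D:
  assumes "square_integrable (count_space UNIV) f" "sqnorm (count_space UNIV) f = 0"
  shows "f k = 0"
  using sqnorm_count_space_ge_point[OF assms(1), of k] assms(2) by simp

lemma ip_point:
  "ip (count_space UNIV) (\<lambda>i. if i = k then 1 else 0) f = cnj (f k)"
proof -
  have "ip (count_space UNIV) (\<lambda>i. if i = k then 1 else 0) f =
      (\<integral>i. indicator {k} i *\<^sub>R cnj (f k) \<partial>count_space UNIV)"
    unfolding ip_def by (intro Bochner_Integration.integral_cong) auto
  then show ?thesis by simp
qed

text \<open>
  A compact operator has only finitely many eigenvalues \<open>1 / s\<^sub>j\<close> of modulus at least \<open>1 / S\<close>:
  orthonormalising the eigenvectors gives \<open>y\<^sub>n\<close> with \<open>\<langle>y\<^sub>n, K y\<^sub>n\<rangle> = cnj (1 / s\<^sub>n)\<close>, whereas the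
  coordinates of \<open>y\<^sub>n\<close> tend to zero by Bessel's inequality. Here \<open>K\<close> is only defined on the span
  of its eigenvectors, and compactness is boundedness into a weighted space.
\<close>

lemma no_infinite_spectrum:
  fixes x :: "nat \<Rightarrow> 'i \<Rightarrow> complex" and s :: "nat \<Rightarrow> complex" and \<Lambda> :: "'i \<Rightarrow> real"
  defines "M \<equiv> count_space (UNIV :: 'i set)"
  assumes x: "\<And>j. square_integrable M (x j)" and nz: "\<And>j. \<exists>i. x j i \<noteq> 0"
    and s: "inj s" "\<And>j. s j \<noteq> 0" "\<And>j. cmod (s j) \<le> S"
    and \<Lambda>: "\<And>i. 1 \<le> \<Lambda> i" "\<And>R. finite {i. \<Lambda> i \<le> R}"
    and C: "0 < C"
    and bound: "\<And>\<gamma> n. square_integrable M (\<lambda>i. of_real (\<Lambda> i) * (\<Sum>j<n. \<gamma> j / s j * x j i))"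
      "\<And>\<gamma> n. sqnorm M (\<lambda>i. of_real (\<Lambda> i) * (\<Sum>j<n. \<gamma> j / s j * x j i))
        \<le> C * sqnorm M (\<lambda>i. \<Sum>j<n. \<gamma> j * x j i)"
  shows False
proof -
  have sqi: "square_integrable M (\<lambda>i. \<Sum>j\<in>I. \<gamma> j * x j i)" for \<gamma> and I :: "nat set"
    by (intro square_integrable_sum square_integrable_scale x)
  have zero: "f k = 0" if "square_integrable M f" "sqnorm M f = 0" for f k
    using that unfolding M_def by (rule sqnorm_count_space_eq_0D)
  have S: "0 < S" using s(2,3)[of 0] by (meson less_le_trans zero_less_norm_iff)
  \<comment> \<open>Eigenvectors for distinct eigenvalues are independent: apply K to a relation and
    subtract 1 / \<open>s n\<close> times the relation, which removes the last term.\<close>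
  have indep: "\<forall>\<gamma>. sqnorm M (\<lambda>i. \<Sum>j<n. \<gamma> j * x j i) = 0 \<longrightarrow> (\<forall>j<n. \<gamma> j = 0)" for n
  proof (induction n)
    case 0
    then show ?case by simp
  next
    case (Suc n)
    show ?case
    proof (intro allI impI)
      fix \<gamma> j assume 0: "sqnorm M (\<lambda>i. \<Sum>j<Suc n. \<gamma> j * x j i) = 0" and j: "j < Suc n"
      have a: "(\<Sum>j<Suc n. \<gamma> j * x j i) = 0" for i
        using zero[OF sqi 0] .
      \<comment> \<open>The norm bound makes K well defined on the span: a combination that vanishes
        is sent to zero.\<close>
      have "sqnorm M (\<lambda>i. of_real (\<Lambda> i) * (\<Sum>j<Suc n. \<gamma> j / s j * x j i)) = 0"
        using bound(2)[where n="Suc n" and \<gamma>=\<gamma>, unfolded 0] by (intro antisym) simp_all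
      note K0 = zero[OF bound(1) this]
      have b: "(\<Sum>j<Suc n. \<gamma> j / s j * x j i) = 0" for i
        using K0[of i] \<Lambda>(1)[of i] by (auto simp del: sum.lessThan_Suc)
      have "(\<Sum>j<n. (\<gamma> j / s j - \<gamma> j / s n) * x j i) = 0" for i
      proof -
        have "(\<Sum>j<n. (\<gamma> j / s j - \<gamma> j / s n) * x j i) =
            (\<Sum>j<Suc n. \<gamma> j / s j * x j i) - (1 / s n) * (\<Sum>j<Suc n. \<gamma> j * x j i)"
          by (simp add: algebra_simps sum_distrib_left sum_subtractf)
        then show ?thesis using a[of i] b[of i] by simp
      qed
      then have "sqnorm M (\<lambda>i. \<Sum>j<n. (\<gamma> j / s j - \<gamma> j / s n) * x j i) = 0"
        by (simp add: sqnorm_def)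
      then have "\<forall>j<n. \<gamma> j / s j - \<gamma> j / s n = 0"
        by (rule Suc.IH[THEN spec[of _ "\<lambda>j. \<gamma> j / s j - \<gamma> j / s n"], THEN mp])
      then have c: "\<gamma> j = 0" if "j < n" for j
        using that s(1) s(2)[of j] s(2)[of n] inj_eq[OF s(1), of j n] by (auto simp: field_simps)
      then have "\<gamma> n * x n i = 0" for i using a[of i] by simp
      then have "\<gamma> n = 0" using nz[of n] by auto
      with c j show "\<gamma> j = 0" by (cases "j = n") auto
    qed
  qed
  define P where "P n \<gamma> \<longleftrightarrow> (\<forall>m<n. ip M (\<lambda>i. \<Sum>j<Suc n. \<gamma> j * x j i) (x m) = 0) \<and>
      sqnorm M (\<lambda>i. \<Sum>j<Suc n. \<gamma> j * x j i) = 1" for n \<gamma>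
  have "\<exists>\<gamma>. P n \<gamma>" for n
  proof -
    obtain \<delta> where \<delta>: "\<And>m. m < n \<Longrightarrow> ip M (\<lambda>i. x n i - (\<Sum>j<n. \<delta> j * x j i)) (x m) = 0"
      using exists_projection[where x=x and M=M and f="x n" and n=n, OF x indep x] by blast
    define \<gamma> where "\<gamma> j = (if j = n then 1 else - \<delta> j)" for j
    have eq: "(\<lambda>i. x n i - (\<Sum>j<n. \<delta> j * x j i)) = (\<lambda>i. \<Sum>j<Suc n. \<gamma> j * x j i)"
      by (auto simp: \<gamma>_def sum_negf intro!: sum.cong)
    define N where "N = sqnorm M (\<lambda>i. \<Sum>j<Suc n. \<gamma> j * x j i)"
    have "N \<noteq> 0"
    proof
      assume "N = 0"
      then have "\<gamma> n = 0"
        using indep[THEN spec[of _ \<gamma>], of "Suc n"] unfolding N_def by blast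
      then show False by (simp add: \<gamma>_def)
    qed
    moreover have "0 \<le> N" unfolding N_def by (rule sqnorm_nonneg)
    ultimately have N: "0 < N" by simp
    define r :: complex where "r = of_real (1 / sqrt N)"
    have sc: "(\<lambda>i. \<Sum>j<Suc n. (r * \<gamma> j) * x j i) = (\<lambda>i. r * (\<Sum>j<Suc n. \<gamma> j * x j i))"
      by (simp add: sum_distrib_left mult.assoc distrib_left)
    have "sqnorm M (\<lambda>i. r * (\<Sum>j<Suc n. \<gamma> j * x j i)) = (cmod r)\<^sup>2 * N"
      unfolding N_def sqnorm_def by (simp add: norm_mult power_mult_distrib)
    also have "\<dots> = 1" using N by (simp add: r_def norm_divide power_divide)
    finally have 1: "sqnorm M (\<lambda>i. \<Sum>j<Suc n. (r * \<gamma> j) * x j i) = 1" unfolding sc .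
    have "ip M (\<lambda>i. \<Sum>j<Suc n. (r * \<gamma> j) * x j i) (x m) = 0" if "m < n" for m
      unfolding sc ip_scale_left using \<delta>[OF that] unfolding eq by (rule ssubst) simp
    then have "P n (\<lambda>j. r * \<gamma> j)" unfolding P_def using 1 by (intro conjI allI impI)
    then show ?thesis by (rule exI[where P="P n" and x="\<lambda>j. r * \<gamma> j"])
  qed
  then obtain G where P: "\<And>n. P n (G n)" by metis
  have G: "\<And>n m. m < n \<Longrightarrow> ip M (\<lambda>i. \<Sum>j<Suc n. G n j * x j i) (x m) = 0"
      "\<And>n. sqnorm M (\<lambda>i. \<Sum>j<Suc n. G n j * x j i) = 1"
    using P unfolding P_def by (blast, blast)
  define y where "y n = (\<lambda>i. \<Sum>j<Suc n. G n j * x j i)" for n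
  define z where "z n = (\<lambda>i. \<Sum>j<Suc n. G n j / s j * x j i)" for n
  have y: "square_integrable M (y n)" for n unfolding y_def by (rule sqi)
  have z: "square_integrable M (z n)" for n unfolding z_def by (rule sqi)
  have yx: "ip M (y n) (\<lambda>i. \<Sum>j\<in>J. a j * x j i) = 0" if "J \<subseteq> {..<n}" for n a J
    using that G(1)[of _ n, folded y_def]
    by (subst ip_sum_right) (auto simp: y x ip_scale_right square_integrable_scale intro!: sum.neutral)
  have on: "ip M (y n) (y m) = (if n = m then 1 else 0)" for n m
  proof -
    have *: "ip M (y n) (y m) = 0" if "m < n" for m n
      using yx[of "{..<Suc m}" n "G m"] that by (auto simp: y_def[of m])
    show ?thesis using *[of m n] *[of n m] G(2)[of n] ip_cnj[of M "y n" "y m"]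
      by (cases n m rule: linorder_cases) (auto simp: ip_self y_def)
  qed
  \<comment> \<open>\<open>z n\<close> is K applied to \<open>y n\<close>. On the span of
    \<open>x 0\<close>, ..., \<open>x n\<close> the operator K - 1 / \<open>s n\<close> annihilates
    \<open>x n\<close>, so \<open>z n\<close> differs from \<open>y n\<close> / \<open>s n\<close>
    by a combination of earlier vectors, to which \<open>y n\<close> is orthogonal.\<close>
  have yz: "ip M (y n) (z n) = cnj (1 / s n)" for n
  proof -
    have "z n = (\<lambda>i. (\<Sum>j<n. (G n j / s j - G n j / s n) * x j i) + (1 / s n) * y n i)"
      unfolding z_def y_def by (auto simp: algebra_simps sum_distrib_left sum_subtractf sum_negf fun_eq_iff)
    moreover have "ip M (y n) (\<lambda>i. (\<Sum>j<n. (G n j / s j - G n j / s n) * x j i) + (1 / s n) * y n i) = cnj (1 / s n)"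
      using yx[of "{..<n}" n "\<lambda>j. G n j / s j - G n j / s n"] on[of n n]
      by (subst ip_add_right[OF sqi square_integrable_scale[OF y] y])
        (simp add: ip_scale_right del: times_divide_eq_left)
    ultimately show ?thesis by simp
  qed
  have Lz: "square_integrable M (\<lambda>i. of_real (\<Lambda> i) * z n i)"
    "sqnorm M (\<lambda>i. of_real (\<Lambda> i) * z n i) \<le> C" for n
    using bound(1)[where n="Suc n" and \<gamma>="G n"] bound(2)[where n="Suc n" and \<gamma>="G n"] G(2)[of n] unfolding z_def by auto
  \<comment> \<open>Chosen so that (1 + C) / (2 R) = 1 / (2 S): the indices with \<Lambda> above
    \<open>R\<close> account for at most half of the lower bound 1 / S for the inner
    product.\<close>
  define R where "R = (1 + C) * S"
  have R: "0 < R" using C S by (simp add: R_def)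
  define F where "F = {i. \<Lambda> i \<le> R}"
  have F: "finite F" unfolding F_def by (rule \<Lambda>(2))
  \<comment> \<open>On the finite set \<open>F\<close> the factor \<open>z n\<close> is bounded by
    sqrt C; outside it, \<Lambda> > \<open>R\<close> is traded for smallness by the
    arithmetic-geometric mean inequality.\<close>
  have pw: "cmod (y n i) * cmod (z n i) \<le> (\<Sum>k\<in>F. indicator {k} i * (sqrt C * cmod (y n k)))
      + ((cmod (y n i))\<^sup>2 + (cmod (of_real (\<Lambda> i) * z n i))\<^sup>2) / (2 * R)" for n i
  proof (cases "i \<in> F")
    case True
    have "cmod (z n i) \<le> cmod (of_real (\<Lambda> i) * z n i)"
      using \<Lambda>(1)[of i] mult_right_mono[of 1 "\<Lambda> i" "cmod (z n i)"] by (simp add: norm_mult)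
    also have "\<dots> \<le> sqrt C"
      using sqnorm_count_space_ge_point[of "\<lambda>i. of_real (\<Lambda> i) * z n i" i] Lz[of n]
      unfolding M_def by (meson order_trans real_le_rsqrt)
    finally have "cmod (y n i) * cmod (z n i) \<le> sqrt C * cmod (y n i)"
      by (metis mult.commute mult_left_mono norm_ge_zero)
    also have "\<dots> = (\<Sum>k\<in>F. indicator {k} i * (sqrt C * cmod (y n k)))"
      using True F by (simp add: indicator_def if_distrib cong: if_cong)
    finally show ?thesis using R by (smt (verit) divide_nonneg_pos zero_le_power2)
  next
    case False
    then have "R * (2 * (cmod (y n i) * cmod (z n i))) \<le> \<Lambda> i * (2 * (cmod (y n i) * cmod (z n i)))"
      unfolding F_def by (intro mult_right_mono) auto
    also have "\<dots> \<le> (cmod (y n i))\<^sup>2 + (cmod (of_real (\<Lambda> i) * z n i))\<^sup>2"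
      using sum_squares_bound[of "cmod (y n i)" "cmod (of_real (\<Lambda> i) * z n i)"] \<Lambda>(1)[of i]
      by (simp add: norm_mult algebra_simps)
    finally have "cmod (y n i) * cmod (z n i) \<le>
        ((cmod (y n i))\<^sup>2 + (cmod (of_real (\<Lambda> i) * z n i))\<^sup>2) / (2 * R)"
      using R by (simp add: field_simps)
    moreover have "0 \<le> (\<Sum>k\<in>F. indicator {k} i * (sqrt C * cmod (y n k)))"
      using C by (intro sum_nonneg) auto
    ultimately show ?thesis by linarith
  qed
  have lower: "1 / (2 * S) \<le> sqrt C * (\<Sum>k\<in>F. cmod (y n k))" for n
  proof -
    have int: "integrable M (\<lambda>i. indicator {k} i * c)" for k and c :: real
      unfolding M_def by (rule integrable_count_space_point)
    have "1 / S \<le> cmod (ip M (y n) (z n))"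
      using s(2,3)[of n] S by (simp add: yz norm_divide frac_le)
    also have "\<dots> \<le> (\<integral>i. cmod (y n i) * cmod (z n i) \<partial>M)"
      unfolding ip_def
      using integral_norm_bound[of M "\<lambda>i. y n i * cnj (z n i)"] by (simp add: norm_mult)
    also have "\<dots> \<le> (\<integral>i. (\<Sum>k\<in>F. indicator {k} i * (sqrt C * cmod (y n k)))
      + ((cmod (y n i))\<^sup>2 + (cmod (of_real (\<Lambda> i) * z n i))\<^sup>2) / (2 * R) \<partial>M)"
      apply (intro integral_mono pw)
      subgoal using integrable_norm[OF square_integrable_mult[OF y z]] by (simp add: norm_mult)
      subgoal using y[of n] Lz(1)[of n]
        by (intro Bochner_Integration.integrable_add Bochner_Integration.integrable_sum int integrable_divide)
           (auto simp: square_integrable_def)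
      done
    also have "\<dots> = (\<integral>i. (\<Sum>k\<in>F. indicator {k} i * (sqrt C * cmod (y n k))) \<partial>M)
      + (sqnorm M (y n) + sqnorm M (\<lambda>i. of_real (\<Lambda> i) * z n i)) / (2 * R)"
      using y[of n] Lz(1)[of n] int unfolding sqnorm_def square_integrable_def
      by (subst Bochner_Integration.integral_add)
        (intro Bochner_Integration.integrable_sum int, auto)
    also have "(\<integral>i. (\<Sum>k\<in>F. indicator {k} i * (sqrt C * cmod (y n k))) \<partial>M) =
        sqrt C * (\<Sum>k\<in>F. cmod (y n k))"
      using int by (subst Bochner_Integration.integral_sum) (auto simp: M_def sum_distrib_left)
    also have "(sqnorm M (y n) + sqnorm M (\<lambda>i. of_real (\<Lambda> i) * z n i)) / (2 * R) \<le> (1 + C) / (2 * R)"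
      using Lz(2)[of n] G(2)[of n] R by (intro divide_right_mono) (auto simp: y_def)
    also have "(1 + C) / (2 * R) = 1 / S / 2"
    proof -
      have "1 + C \<noteq> 0" using C by linarith
      then show ?thesis unfolding R_def by simp
    qed
    finally show ?thesis using S by (simp add: field_simps)
  qed
  \<comment> \<open>Bessel's inequality for the point mass at \<open>k\<close> with respect to the
    orthonormal \<open>y n\<close>: its coefficients are the conjugates of \<open>y n k\<close>,
    hence square-summable in n.\<close>
  have lim: "(\<lambda>n. cmod (y n k)) \<longlonglongrightarrow> 0" for k
  proof -
    have "(\<Sum>n<N. (cmod (y n k))\<^sup>2) \<le> 1" for N
    proof -
      have p: "square_integrable M (\<lambda>i. if i = k then 1 else 0)"
      proof -
        have "(\<lambda>i. (cmod (if i = k then 1 else 0))\<^sup>2) = (indicator {k} :: 'i \<Rightarrow> real)"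
          by (auto simp: indicator_def)
        then show ?thesis unfolding square_integrable_def M_def
          using integrable_count_space_point[of k 1] by simp
      qed
      have "(\<Sum>n<N. (cmod (y n k))\<^sup>2) \<le> sqnorm M (\<lambda>i. if i = k then 1 else 0)"
        using bessel[of "{..<N}" M "\<lambda>i. if i = k then 1 else 0" y] p y on ip_point[of k]
        unfolding M_def by simp
      also have "\<dots> = (\<integral>i. indicator {k} i \<partial>M)"
        unfolding sqnorm_def by (intro Bochner_Integration.integral_cong) (auto simp: indicator_def)
      also have "\<dots> = 1" by (simp add: M_def)
      finally show ?thesis .
    qed
    then have "summable (\<lambda>n. (cmod (y n k))\<^sup>2)"
      by (intro summableI_nonneg_bounded[of _ 1]) auto
    from tendsto_real_sqrt[OF summable_LIMSEQ_zero[OF this]] show ?thesis by simp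
  qed
  have "(\<lambda>n. sqrt C * (\<Sum>k\<in>F. cmod (y n k))) \<longlonglongrightarrow> sqrt C * (\<Sum>k\<in>F. 0)"
    by (intro tendsto_intros lim)
  from LIMSEQ_le_const[OF this, of "1 / (2 * S)"] lower S show False by auto
qed

section \<open>Quadratic pencils\<close>

text \<open>The doubled index set carries the two components of a linearised quadratic pencil; the
  lemma splits norms into the two components.\<close>

lemma integral_count_space_Times_bool:
  fixes g :: "'n \<times> bool \<Rightarrow> real"
  assumes g: "\<And>p. 0 \<le> g p"
  shows "integrable (count_space UNIV) g \<longleftrightarrow>
      integrable (count_space UNIV) (\<lambda>n. g (n, False) + g (n, True))"
    and "(\<integral>p. g p \<partial>count_space UNIV) = (\<integral>n. g (n, False) + g (n, True) \<partial>count_space UNIV)"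
proof -
  have *: "(\<integral>\<^sup>+p. ennreal (g p) \<partial>count_space UNIV) =
      (\<integral>\<^sup>+n. ennreal (g (n, False) + g (n, True)) \<partial>count_space UNIV)"
    by (subst nn_integral_fst_count_space[symmetric])
       (simp add: nn_integral_count_space_finite UNIV_bool g ennreal_plus)
  show "integrable (count_space UNIV) g \<longleftrightarrow>
      integrable (count_space UNIV) (\<lambda>n. g (n, False) + g (n, True))"
    using * by (simp add: integrable_iff_bounded g)
  show "(\<integral>p. g p \<partial>count_space UNIV) = (\<integral>n. g (n, False) + g (n, True) \<partial>count_space UNIV)"
    using * by (simp add: integral_eq_nn_integral g)
qed

text \<open>
  Writing \<open>\<kappa> = \<zeta> + s\<close>, the equation \<open>h \<kappa> c + w = 0\<close> says that \<open>(c, s c / \<Lambda>)\<close> is an eigenvector with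
  eigenvalue \<open>1 / s\<close> of one operator, independent of \<open>\<kappa>\<close>; the weight \<open>\<Lambda>\<close> makes both of its components
  compact. The bound \<open>le\<close> encodes that \<open>w\<close> arises from \<open>c\<close> by a linear operator of norm at most \<open>\<omega>\<close>.
\<close>

lemma countable_pencil_spectrum:
  fixes r m :: "'n \<Rightarrow> real" and c w :: "real \<Rightarrow> 'n \<Rightarrow> complex" and \<Lambda> :: "'n \<Rightarrow> real"
    and \<beta> :: real
  defines "M \<equiv> count_space (UNIV :: 'n set)"
    and "h \<equiv> (\<lambda>\<kappa> n. of_real (r n) + 2 * \<kappa> * of_real (m n) + \<kappa>\<^sup>2 * of_real \<beta> :: complex)"
  assumes \<zeta>: "Im \<zeta> \<noteq> 0"
    and \<Lambda>: "\<And>n. 1 \<le> \<Lambda> n" "\<And>R. finite {n. \<Lambda> n \<le> R}"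
    and \<omega>: "0 < \<omega>" "\<And>n. 2 * \<omega> \<le> cmod (h \<zeta> n)"
    and \<delta>: "0 < \<delta>" "\<And>n. \<delta> * (\<Lambda> n)\<^sup>2 \<le> cmod (h \<zeta> n)"
    and m: "\<And>n. \<bar>m n\<bar> \<le> B * \<Lambda> n"
    and c: "\<And>\<kappa>. \<kappa> \<in> K \<Longrightarrow> square_integrable M (c \<kappa>)" "\<And>\<kappa>. \<kappa> \<in> K \<Longrightarrow> \<exists>n. c \<kappa> n \<noteq> 0"
    and w: "\<And>\<kappa>. \<kappa> \<in> K \<Longrightarrow> square_integrable M (w \<kappa>)"
    and eq: "\<And>\<kappa> n. \<kappa> \<in> K \<Longrightarrow> h (of_real \<kappa>) n * c \<kappa> n + w \<kappa> n = 0"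
    and le: "\<And>F \<gamma>. finite F \<Longrightarrow> F \<subseteq> K \<Longrightarrow> sqnorm M (\<lambda>n. \<Sum>\<kappa>\<in>F. \<gamma> \<kappa> * w \<kappa> n)
        \<le> \<omega>\<^sup>2 * sqnorm M (\<lambda>n. \<Sum>\<kappa>\<in>F. \<gamma> \<kappa> * c \<kappa> n)"
  shows "countable K"
proof (rule ccontr)
  assume "uncountable K"
  \<comment> \<open>A bound on s = \<kappa> - \<zeta> keeps the eigenvalues 1 / s away from 0, the
    only point where those of a compact operator can accumulate.\<close>
  have "\<exists>N::nat. uncountable {\<kappa>\<in>K. cmod (of_real \<kappa> - \<zeta>) \<le> real N}"
  proof (rule ccontr)
    assume "\<not> ?thesis"
    then have "countable (\<Union>N::nat. {\<kappa>\<in>K. cmod (of_real \<kappa> - \<zeta>) \<le> real N})" by auto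
    moreover have "K \<subseteq> (\<Union>N::nat. {\<kappa>\<in>K. cmod (of_real \<kappa> - \<zeta>) \<le> real N})"
      using real_arch_simple by blast
    ultimately show False using \<open>uncountable K\<close> countable_subset by blast
  qed
  then obtain N :: nat where N: "uncountable {\<kappa>\<in>K. cmod (of_real \<kappa> - \<zeta>) \<le> real N}" ..
  then have "infinite {\<kappa>\<in>K. cmod (of_real \<kappa> - \<zeta>) \<le> real N}"
    using countable_finite by blast
  then obtain k :: "nat \<Rightarrow> real" where k: "inj k" "range k \<subseteq> {\<kappa>\<in>K. cmod (of_real \<kappa> - \<zeta>) \<le> real N}"
    using infinite_countable_subset by blast
  have kK: "k j \<in> K" for j using k(2) by auto
  define s where "s j = of_real (k j) - \<zeta>" for j
  have s0: "s j \<noteq> 0" for j using \<zeta> by (auto simp: s_def complex_eq_iff)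
  define x where "x j = (\<lambda>(n, b). if b then s j / of_real (\<Lambda> n) * c (k j) n else c (k j) n)" for j
  \<comment> \<open>\<open>b\<close> \<Lambda> bounds the coefficient 2 m + 2 \<beta> \<zeta>,
    \<open>q\<close> is the resulting constant for the squares, and \<open>C\<close> adds the
    contribution of the potential; its final 1 pays for the second component.\<close>
  define b where "b = 2 * B + 2 * \<bar>\<beta>\<bar> * cmod \<zeta>"
  define q where "q = 2 * (b\<^sup>2 + \<beta>\<^sup>2) / \<delta>\<^sup>2"
  define C where "C = 2 * q + 8 * q * \<omega>\<^sup>2 / \<delta>\<^sup>2 + 1"
  have q0: "0 \<le> q" by (simp add: q_def)
  have \<Lambda>0: "0 < \<Lambda> n" for n using \<Lambda>(1)[of n] by simp
  have sqi_iff: "square_integrable (count_space UNIV) f \<longleftrightarrow> square_integrable M (\<lambda>n. f (n, False)) \<and>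
      square_integrable M (\<lambda>n. f (n, True))" for f
  proof -
    have "integrable M (\<lambda>n. (cmod (f (n, False)))\<^sup>2 + (cmod (f (n, True)))\<^sup>2) \<longleftrightarrow>
        integrable M (\<lambda>n. (cmod (f (n, False)))\<^sup>2) \<and> integrable M (\<lambda>n. (cmod (f (n, True)))\<^sup>2)"
      unfolding M_def
      by (auto intro: Bochner_Integration.integrable_bound[of _ "\<lambda>n. (cmod (f (n, False)))\<^sup>2 + (cmod (f (n, True)))\<^sup>2"])
    then show ?thesis unfolding square_integrable_def M_def
      by (subst integral_count_space_Times_bool(1)) auto
  qed
  have sqn: "sqnorm (count_space UNIV) f = sqnorm M (\<lambda>n. f (n, False)) + sqnorm M (\<lambda>n. f (n, True))"
    if "square_integrable (count_space UNIV) f" for f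
  proof -
    have i: "integrable M (\<lambda>n. (cmod (f (n, False)))\<^sup>2)" "integrable M (\<lambda>n. (cmod (f (n, True)))\<^sup>2)"
      using that[unfolded sqi_iff] by (auto simp: square_integrable_def)
    have "sqnorm (count_space UNIV) f = (\<integral>n. (cmod (f (n, False)))\<^sup>2 + (cmod (f (n, True)))\<^sup>2 \<partial>M)"
      unfolding sqnorm_def M_def by (rule integral_count_space_Times_bool(2)) simp
    also have "\<dots> = sqnorm M (\<lambda>n. f (n, False)) + sqnorm M (\<lambda>n. f (n, True))"
      unfolding sqnorm_def using i by (rule Bochner_Integration.integral_add)
    finally show ?thesis .
  qed
  have x: "square_integrable (count_space UNIV) (x j)" for j
  proof -
    have "square_integrable M (\<lambda>n. s j / of_real (\<Lambda> n) * c (k j) n)"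
      unfolding square_integrable_def
    proof (intro conjI)
      show "integrable M (\<lambda>n. (cmod (s j / of_real (\<Lambda> n) * c (k j) n))\<^sup>2)"
      proof (rule Bochner_Integration.integrable_bound)
        show "integrable M (\<lambda>n. (cmod (s j))\<^sup>2 * (cmod (c (k j) n))\<^sup>2)"
          using c(1)[OF kK] by (simp add: square_integrable_def)
        have "cmod (s j / of_real (\<Lambda> n) * c (k j) n) \<le> cmod (s j) * cmod (c (k j) n)" for n
          using \<Lambda>(1)[of n] \<Lambda>0[of n] unfolding norm_mult norm_divide
          by (intro mult_right_mono) (auto simp: divide_le_eq mult_le_cancel_left1)
        then show "AE n in M. norm ((cmod (s j / of_real (\<Lambda> n) * c (k j) n))\<^sup>2)
            \<le> norm ((cmod (s j))\<^sup>2 * (cmod (c (k j) n))\<^sup>2)"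
          unfolding power_mult_distrib[symmetric] by (auto intro!: AE_I2 power_mono)
      qed (simp add: M_def)
    qed (simp add: M_def)
    then show ?thesis unfolding sqi_iff x_def using c(1)[OF kK] by simp
  qed
  have bound: "square_integrable (count_space UNIV) (\<lambda>i. of_real (\<Lambda> (fst i)) * (\<Sum>j<n. \<gamma> j / s j * x j i)) \<and>
     sqnorm (count_space UNIV) (\<lambda>i. of_real (\<Lambda> (fst i)) * (\<Sum>j<n. \<gamma> j / s j * x j i))
        \<le> C * sqnorm (count_space UNIV) (\<lambda>i. \<Sum>j<n. \<gamma> j * x j i)" for \<gamma> n
  proof -
    \<comment> \<open>\<open>cc\<close> and \<open>dd\<close> are the two components of the vector
      \<open>X\<close>. \<open>ee\<close> is the first component of its image, and \<open>W\<close>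
      is the potential applied to \<open>ee\<close>.\<close>
    define cc where "cc i = (\<Sum>j<n. \<gamma> j * c (k j) i)" for i
    define dd where "dd i = (\<Sum>j<n. \<gamma> j * (s j / of_real (\<Lambda> i) * c (k j) i))" for i
    define ee where "ee i = (\<Sum>j<n. \<gamma> j / s j * c (k j) i)" for i
    define W where "W i = (\<Sum>j<n. \<gamma> j / s j * w (k j) i)" for i
    define X where "X = (\<lambda>i. \<Sum>j<n. \<gamma> j * x j i)"
    have Xs: "square_integrable (count_space UNIV) X" unfolding X_def
      by (intro square_integrable_sum square_integrable_scale x)
    have X1: "(\<lambda>i. X (i, False)) = cc" "(\<lambda>i. X (i, True)) = dd"
      by (auto simp: X_def x_def cc_def dd_def)
    have ccs: "square_integrable M cc" and dds: "square_integrable M dd"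
      using Xs unfolding sqi_iff X1 by auto
    have Xn: "sqnorm (count_space UNIV) X = sqnorm M cc + sqnorm M dd"
      by (subst sqn[OF Xs]) (simp add: X1)
    have ees: "square_integrable M ee" and Ws: "square_integrable M W"
      unfolding ee_def W_def by (intro square_integrable_sum square_integrable_scale c(1) w kK)+
    have WE: "sqnorm M W \<le> \<omega>\<^sup>2 * sqnorm M ee"
    proof -
      have re: "(\<Sum>j<n. \<gamma> j / s j * f (k j)) =
          (\<Sum>\<kappa>\<in>k ` {..<n}. (\<gamma> (the_inv k \<kappa>) / s (the_inv k \<kappa>)) * f \<kappa>)" for f :: "real \<Rightarrow> complex"
        by (subst sum.reindex) (use k(1) in \<open>auto simp: the_inv_f_f inj_on_def\<close>)
      have "sqnorm M (\<lambda>i. \<Sum>\<kappa>\<in>k ` {..<n}. (\<gamma> (the_inv k \<kappa>) / s (the_inv k \<kappa>)) * w \<kappa> i)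
        \<le> \<omega>\<^sup>2 * sqnorm M (\<lambda>i. \<Sum>\<kappa>\<in>k ` {..<n}. (\<gamma> (the_inv k \<kappa>) / s (the_inv k \<kappa>)) * c \<kappa> i)"
        using kK by (intro le) auto
      then show ?thesis unfolding W_def ee_def by (simp only: re[of "\<lambda>\<kappa>. w \<kappa> _"] re[of "\<lambda>\<kappa>. c \<kappa> _"])
    qed
    \<comment> \<open>Since h (\<zeta> + s) - h \<zeta> = s (2 m + 2 \<beta> \<zeta> + \<beta> s),
      dividing the equation at \<kappa> = \<zeta> + s by s expresses h \<zeta> c / s through c, s c
      and w / s. Here s c is \<Lambda> times the second component, so s no longer appears as a
      coefficient.\<close>
    have key: "h \<zeta> i * ee i = - ((2 * of_real (m i) + 2 * of_real \<beta> * \<zeta>) * cc i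
        + of_real \<beta> * of_real (\<Lambda> i) * dd i + W i)" for i
    proof -
      have "h \<zeta> i * (\<gamma> j / s j * c (k j) i) = - ((2 * of_real (m i) + 2 * of_real \<beta> * \<zeta>) * (\<gamma> j * c (k j) i)
        + of_real \<beta> * of_real (\<Lambda> i) * (\<gamma> j * (s j / of_real (\<Lambda> i) * c (k j) i)) + \<gamma> j / s j * w (k j) i)" for j
      proof -
        have w': "w (k j) i = - (h (of_real (k j)) i * c (k j) i)"
          using eq[OF kK, of j i] by (metis add_eq_0_iff)
        have ks: "of_real (k j) = \<zeta> + s j" by (simp add: s_def)
        show ?thesis unfolding w' h_def ks using s0[of j] \<Lambda>0[of i]
          by (simp add: field_simps power2_eq_square)
      qed
      then show ?thesis unfolding ee_def cc_def dd_def W_def sum_distrib_left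
        by (simp only: sum_negf sum.distrib)
    qed
    define a where "a i = (b * cmod (cc i) + \<bar>\<beta>\<bar> * cmod (dd i)) / \<delta>" for i
    have h0: "0 < cmod (h \<zeta> i)" for i using \<omega>(1) \<omega>(2)[of i] by linarith
    have pt: "cmod (h \<zeta> i) * cmod (ee i) \<le> \<Lambda> i * (\<delta> * a i) + cmod (W i)" for i
    proof -
      have "cmod (2 * of_real (m i) + 2 * of_real \<beta> * \<zeta>) \<le> 2 * \<bar>m i\<bar> + 2 * \<bar>\<beta>\<bar> * cmod \<zeta>"
        by (rule order_trans[OF norm_triangle_ineq]) (simp add: norm_mult)
      also have "\<dots> \<le> 2 * (B * \<Lambda> i) + 2 * \<bar>\<beta>\<bar> * cmod \<zeta> * \<Lambda> i"
        using m[of i] \<Lambda>(1)[of i] mult_left_mono[of 1 "\<Lambda> i" "2 * \<bar>\<beta>\<bar> * cmod \<zeta>"] by simp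
      also have "\<dots> = b * \<Lambda> i" by (simp add: b_def algebra_simps)
      finally have 1: "cmod ((2 * of_real (m i) + 2 * of_real \<beta> * \<zeta>) * cc i) \<le> b * \<Lambda> i * cmod (cc i)"
        unfolding norm_mult by (rule mult_right_mono) simp
      have 2: "cmod (of_real \<beta> * of_real (\<Lambda> i) * dd i) = \<bar>\<beta>\<bar> * \<Lambda> i * cmod (dd i)"
        using \<Lambda>0[of i] by (simp add: norm_mult)
      have "cmod (h \<zeta> i * ee i) \<le> b * \<Lambda> i * cmod (cc i) + \<bar>\<beta>\<bar> * \<Lambda> i * cmod (dd i) + cmod (W i)"
        unfolding key norm_minus_cancel using 1 2
        by (smt (verit) norm_triangle_ineq)
      moreover have "\<delta> * a i = b * cmod (cc i) + \<bar>\<beta>\<bar> * cmod (dd i)" using \<delta>(1) by (simp add: a_def)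
      ultimately show ?thesis by (simp add: norm_mult algebra_simps)
    qed
    have a0: "0 \<le> \<delta> * a i" for i
    proof -
      have "0 \<le> b" using m[of i] \<Lambda>0[of i] unfolding b_def
        by (smt (verit, best) abs_ge_zero mult_nonneg_nonneg norm_ge_zero zero_le_mult_iff)
      then show ?thesis using \<delta>(1) by (simp add: a_def)
    qed
    have p2: "\<Lambda> i * cmod (ee i) \<le> a i + cmod (W i) / \<delta>" for i
    proof -
      have "\<Lambda> i * (\<delta> * \<Lambda> i * cmod (ee i)) = \<delta> * (\<Lambda> i)\<^sup>2 * cmod (ee i)"
        by (simp add: power2_eq_square)
      also have "\<dots> \<le> cmod (h \<zeta> i) * cmod (ee i)" by (intro mult_right_mono \<delta>(2)) simp
      also have "\<dots> \<le> \<Lambda> i * (\<delta> * a i) + cmod (W i)" by (rule pt)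
      also have "\<dots> \<le> \<Lambda> i * (\<delta> * a i + cmod (W i))"
        using mult_right_mono[OF \<Lambda>(1), of "cmod (W i)" i] by (simp add: algebra_simps)
      finally have "\<delta> * \<Lambda> i * cmod (ee i) \<le> \<delta> * a i + cmod (W i)"
        using \<Lambda>0[of i] by (simp del: mult.assoc)
      then show ?thesis using \<delta>(1) by (simp add: field_simps)
    qed
    have p1: "cmod (ee i) \<le> a i + cmod (W i) / (2 * \<omega>)" for i
    proof -
      have "\<Lambda> i * (\<delta> * a i) \<le> (\<Lambda> i)\<^sup>2 * (\<delta> * a i)"
        using \<Lambda>(1)[of i] by (intro mult_right_mono a0) (simp add: power2_eq_square)
      also have "\<dots> \<le> cmod (h \<zeta> i) * a i"
        using mult_right_mono[OF \<delta>(2)[of i], of "a i"] a0[of i] \<delta>(1)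
        by (simp add: algebra_simps zero_le_mult_iff)
      finally have "cmod (h \<zeta> i) * cmod (ee i) \<le> cmod (h \<zeta> i) * a i + cmod (W i)"
        using pt[of i] by linarith
      also have "cmod (W i) \<le> cmod (h \<zeta> i) * (cmod (W i) / (2 * \<omega>))"
        using mult_right_mono[OF \<omega>(2)[of i], of "cmod (W i)"] \<omega>(1) by (simp add: field_simps)
      finally have "cmod (h \<zeta> i) * cmod (ee i) \<le> cmod (h \<zeta> i) * (a i + cmod (W i) / (2 * \<omega>))"
        by (simp add: distrib_left)
      then show ?thesis using h0[of i] by simp
    qed
    have sq: "(u + v)\<^sup>2 \<le> 2 * u\<^sup>2 + 2 * v\<^sup>2" for u v :: real
      using sum_squares_bound[of u v] by (simp add: power2_sum)
    have aq: "(a i)\<^sup>2 \<le> q * ((cmod (cc i))\<^sup>2 + (cmod (dd i))\<^sup>2)" for i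
    proof -
      have "(b * cmod (cc i) + \<bar>\<beta>\<bar> * cmod (dd i))\<^sup>2 \<le>
          2 * (b\<^sup>2 + \<beta>\<^sup>2) * ((cmod (cc i))\<^sup>2 + (cmod (dd i))\<^sup>2)"
        by (rule order_trans[OF sq]) (simp add: power_mult_distrib algebra_simps)
      then show ?thesis using \<delta>(1) by (simp add: a_def q_def power_divide divide_right_mono)
    qed
    have i_cc: "integrable M (\<lambda>i. (cmod (cc i))\<^sup>2)" and i_dd: "integrable M (\<lambda>i. (cmod (dd i))\<^sup>2)"
      and i_ee: "integrable M (\<lambda>i. (cmod (ee i))\<^sup>2)" and i_W: "integrable M (\<lambda>i. (cmod (W i))\<^sup>2)"
      using ccs dds ees Ws by (auto simp: square_integrable_def)
    have q1: "(cmod (ee i))\<^sup>2 \<le> 2 * (q * ((cmod (cc i))\<^sup>2 + (cmod (dd i))\<^sup>2)) + (cmod (W i))\<^sup>2 / (2 * \<omega>\<^sup>2)" for i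
    proof -
      have "(cmod (ee i))\<^sup>2 \<le> (a i + cmod (W i) / (2 * \<omega>))\<^sup>2" by (intro power_mono p1) simp
      also have "\<dots> \<le> 2 * (a i)\<^sup>2 + 2 * (cmod (W i) / (2 * \<omega>))\<^sup>2" by (rule sq)
      finally show ?thesis using aq[of i] by (simp add: power_divide power_mult_distrib)
    qed
    have q2: "(cmod (of_real (\<Lambda> i) * ee i))\<^sup>2 \<le>
        2 * (q * ((cmod (cc i))\<^sup>2 + (cmod (dd i))\<^sup>2)) + 2 / \<delta>\<^sup>2 * (cmod (W i))\<^sup>2" for i
    proof -
      have "(cmod (of_real (\<Lambda> i) * ee i))\<^sup>2 \<le> (a i + cmod (W i) / \<delta>)\<^sup>2"
        using p2[of i] \<Lambda>0[of i] by (intro power_mono) (auto simp: norm_mult)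
      also have "\<dots> \<le> 2 * (a i)\<^sup>2 + 2 * (cmod (W i) / \<delta>)\<^sup>2" by (rule sq)
      finally show ?thesis using aq[of i] by (simp add: power_divide)
    qed
    define Y where "Y = sqnorm M cc + sqnorm M dd"
    have Y0: "0 \<le> Y" "sqnorm M cc \<le> Y" by (simp_all add: Y_def)
    \<comment> \<open>\<open>W\<close> is itself controlled by \<open>ee\<close>. The factor 2 in
      the hypothesis 2 \<omega> \<le> |h \<zeta>| leaves only half of \<open>sqnorm M ee\<close> on
      the right, which is absorbed.\<close>
    have "sqnorm M ee \<le> (\<integral>i. 2 * (q * ((cmod (cc i))\<^sup>2 + (cmod (dd i))\<^sup>2)) + (cmod (W i))\<^sup>2 / (2 * \<omega>\<^sup>2) \<partial>M)"
      unfolding sqnorm_def using i_cc i_dd i_ee i_W by (intro integral_mono q1) auto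
    also have "\<dots> = 2 * (q * Y) + sqnorm M W / (2 * \<omega>\<^sup>2)"
      using i_cc i_dd i_W by (simp add: sqnorm_def Y_def)
    also have "\<dots> \<le> 2 * (q * Y) + \<omega>\<^sup>2 * sqnorm M ee / (2 * \<omega>\<^sup>2)"
      using WE by (intro add_left_mono divide_right_mono) auto
    also have "\<dots> = 2 * (q * Y) + sqnorm M ee / 2" using \<omega>(1) by simp
    finally have E: "sqnorm M ee \<le> 4 * (q * Y)" by simp
    have i_R: "integrable M (\<lambda>i. 2 * (q * ((cmod (cc i))\<^sup>2 + (cmod (dd i))\<^sup>2)) + 2 / \<delta>\<^sup>2 * (cmod (W i))\<^sup>2)"
      using i_cc i_dd i_W by simp
    have i_L: "integrable M (\<lambda>i. (cmod (of_real (\<Lambda> i) * ee i))\<^sup>2)"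
      by (rule Bochner_Integration.integrable_bound[OF i_R]) (auto simp: M_def intro!: AE_I2 order_trans[OF q2])
    have "sqnorm M (\<lambda>i. of_real (\<Lambda> i) * ee i) \<le> 2 * (q * Y) + 2 / \<delta>\<^sup>2 * sqnorm M W"
    proof -
      have "sqnorm M (\<lambda>i. of_real (\<Lambda> i) * ee i) \<le>
        (\<integral>i. 2 * (q * ((cmod (cc i))\<^sup>2 + (cmod (dd i))\<^sup>2)) + 2 / \<delta>\<^sup>2 * (cmod (W i))\<^sup>2 \<partial>M)"
        unfolding sqnorm_def by (intro integral_mono q2 i_L i_R)
      also have "\<dots> = 2 * (q * Y) + 2 / \<delta>\<^sup>2 * sqnorm M W"
        using i_cc i_dd i_W by (simp add: sqnorm_def Y_def)
      finally show ?thesis .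
    qed
    also have "\<dots> \<le> 2 * (q * Y) + 2 / \<delta>\<^sup>2 * (\<omega>\<^sup>2 * (4 * (q * Y)))"
      using WE E by (intro add_left_mono mult_left_mono order_trans[OF WE] mult_left_mono) auto
    also have "\<dots> = (C - 1) * Y" by (simp add: C_def algebra_simps)
    finally have fin: "sqnorm M (\<lambda>i. of_real (\<Lambda> i) * ee i) \<le> (C - 1) * Y" .
    \<comment> \<open>In the second component the weight \<Lambda> cancels the 1 / \<Lambda> built
      into \<open>x\<close>, and 1 / s cancels s, so what remains is \<open>cc\<close>.\<close>
    define Z where "Z = (\<lambda>i. of_real (\<Lambda> (fst i)) * (\<Sum>j<n. \<gamma> j / s j * x j i))"
    have Z1: "(\<lambda>i. Z (i, False)) = (\<lambda>i. of_real (\<Lambda> i) * ee i)" "(\<lambda>i. Z (i, True)) = cc"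
      using s0 \<Lambda>0 by (auto simp: Z_def x_def ee_def cc_def sum_distrib_left less_imp_neq[symmetric] intro!: sum.cong ext)
    have Zs: "square_integrable (count_space UNIV) Z"
      unfolding sqi_iff Z1 using ccs i_L by (auto simp: square_integrable_def M_def)
    have "sqnorm (count_space UNIV) Z = sqnorm M (\<lambda>i. of_real (\<Lambda> i) * ee i) + sqnorm M cc"
      by (subst sqn[OF Zs]) (simp add: Z1)
    also have "\<dots> \<le> C * Y" using fin Y0(2) by (simp add: algebra_simps)
    finally show ?thesis using Zs Xn unfolding Z_def[symmetric] X_def[symmetric] Y_def by simp
  qed
  have "finite {i :: 'n \<times> bool. \<Lambda> (fst i) \<le> R}" for R
  proof -
    have "{i :: 'n \<times> bool. \<Lambda> (fst i) \<le> R} = {n. \<Lambda> n \<le> R} \<times> UNIV" by auto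
    moreover have "finite ({n. \<Lambda> n \<le> R} \<times> (UNIV :: bool set))"
      by (rule finite_cartesian_product) (rule \<Lambda>(2), rule finite_class.finite_UNIV)
    ultimately show ?thesis by (simp only:)
  qed
  moreover have "\<exists>i. x j i \<noteq> 0" for j
  proof -
    obtain n where "c (k j) n \<noteq> 0" using c(2)[OF kK] by blast
    then show ?thesis by (intro exI[of _ "(n, False)"]) (simp add: x_def)
  qed
  moreover have "inj s" using k(1) by (auto simp: inj_def s_def)
  moreover have "cmod (s j) \<le> real N" for j using k(2) by (auto simp: s_def)
  moreover have "0 < C" using q0 \<omega>(1) \<delta>(1) unfolding C_def by (simp add: add_nonneg_pos)
  ultimately show False
    using no_infinite_spectrum[of x s "real N" "\<lambda>i. \<Lambda> (fst i)" C] x s0 \<Lambda>(1) bound by blast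
qed

section \<open>Fourier series on the torus\<close>

lemma sum_le_sqnorm_count_space:
  assumes "square_integrable (count_space UNIV) g" "finite F"
  shows "(\<Sum>i\<in>F. (cmod (g i))\<^sup>2) \<le> sqnorm (count_space UNIV) g"
proof -
  have "(\<Sum>i\<in>F. (cmod (g i))\<^sup>2) = (\<Sum>k\<in>F. \<integral>i. indicator {k} i * (cmod (g k))\<^sup>2 \<partial>count_space UNIV)"
    by simp
  also have "\<dots> = (\<integral>i. (\<Sum>k\<in>F. indicator {k} i * (cmod (g k))\<^sup>2) \<partial>count_space UNIV)"
    by (rule Bochner_Integration.integral_sum[symmetric]) (rule integrable_count_space_point)
  also have "\<dots> \<le> sqnorm (count_space UNIV) g"
    unfolding sqnorm_def
  proof (intro integral_mono Bochner_Integration.integrable_sum integrable_count_space_point)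
    show "integrable (count_space UNIV) (\<lambda>x. (cmod (g x))\<^sup>2)"
      using assms by (simp add: square_integrable_def)
    fix i
    have "(\<Sum>k\<in>F. indicator {k} i * (cmod (g k))\<^sup>2) = (\<Sum>k\<in>F. if k = i then (cmod (g k))\<^sup>2 else 0)"
      by (intro sum.cong) (auto simp: indicator_def)
    then show "(\<Sum>k\<in>F. indicator {k} i * (cmod (g k))\<^sup>2) \<le> (cmod (g i))\<^sup>2"
      using assms(2) by simp
  qed
  finally show ?thesis .
qed

text \<open>Monotone convergence along the finite initial segments of an enumeration. It turns
  uniform bounds on finite sums into square-summability, so limits need only be taken at finitely
  many frequencies at once.\<close>

lemma nn_integral_count_space_le:
  fixes g :: "'i::countable \<Rightarrow> ennreal"
  assumes "\<And>F. finite F \<Longrightarrow> (\<Sum>i\<in>F. g i) \<le> B"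
  shows "(\<integral>\<^sup>+i. g i \<partial>count_space UNIV) \<le> B"
proof -
  define A :: "nat \<Rightarrow> 'i set" where "A k = {i. to_nat i < k}" for k
  have fin: "finite (A k)" for k
    unfolding A_def by (rule finite_imageD[of to_nat]) (auto intro: inj_on_subset[OF inj_to_nat] finite_subset[of _ "{..<k}"])
  have "(SUP k. g i * indicator (A k) i) = g i" for i
  proof (rule antisym)
    show "(SUP k. g i * indicator (A k) i) \<le> g i" by (intro SUP_least) (auto simp: indicator_def)
    show "g i \<le> (SUP k. g i * indicator (A k) i)"
      by (rule SUP_upper2[of "Suc (to_nat i)"]) (auto simp: A_def)
  qed
  then have "(\<integral>\<^sup>+i. g i \<partial>count_space UNIV) = (\<integral>\<^sup>+i. (SUP k. g i * indicator (A k) i) \<partial>count_space UNIV)"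
    by simp
  also have "\<dots> = (SUP k. \<integral>\<^sup>+i. g i * indicator (A k) i \<partial>count_space UNIV)"
    by (rule nn_integral_monotone_convergence_SUP) (auto simp: incseq_def le_fun_def A_def indicator_def)
  also have "\<dots> \<le> B"
  proof (rule SUP_least)
    fix k
    have "(\<integral>\<^sup>+i. g i * indicator (A k) i \<partial>count_space UNIV) = (\<Sum>i\<in>A k. g i)"
      by (simp add: nn_integral_count_space_indicator[symmetric] nn_integral_count_space_finite[OF fin])
    then show "(\<integral>\<^sup>+i. g i * indicator (A k) i \<partial>count_space UNIV) \<le> B" using assms[OF fin] by simp
  qed
  finally show ?thesis .
qed

lemma square_integrable_count_spaceI:
  fixes g :: "'i::countable \<Rightarrow> complex"
  assumes "\<And>F. finite F \<Longrightarrow> (\<Sum>i\<in>F. (cmod (g i))\<^sup>2) \<le> B"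
  shows "square_integrable (count_space UNIV) g" "sqnorm (count_space UNIV) g \<le> B"
proof -
  have B: "0 \<le> B" using assms[of "{}"] by simp
  have *: "(\<integral>\<^sup>+i. ennreal ((cmod (g i))\<^sup>2) \<partial>count_space UNIV) \<le> ennreal B"
    by (rule nn_integral_count_space_le) (simp add: assms sum_ennreal ennreal_leI)
  show "square_integrable (count_space UNIV) g"
    using * unfolding square_integrable_def integrable_iff_bounded
    by (auto intro: le_less_trans ennreal_less_top)
  show "sqnorm (count_space UNIV) g \<le> B"
    unfolding sqnorm_def using enn2real_mono[OF *] B by (subst integral_eq_nn_integral) auto
qed

section \<open>Integer translations, the unit cube and characters\<close>

definition real_vec :: "int ^ 'd \<Rightarrow> real ^ 'd" where
  "real_vec l = (\<chi> i. of_int (l $ i))"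

definition floor_vec :: "real ^ 'd \<Rightarrow> int ^ 'd" where
  "floor_vec t = (\<chi> i. \<lfloor>t $ i\<rfloor>)"

text \<open>The cube is half-open so that its integer translates partition space and
  \<open>floor_vec\<close> names the cell of each point. The torus is this cube with Lebesgue
  measure; functions on it need not be periodic.\<close>

definition unit_cube :: "(real ^ 'd) set" where
  "unit_cube = {t. \<forall>i. 0 \<le> t $ i \<and> t $ i < 1}"

definition torus :: "(real ^ 'd) measure" where
  "torus = restrict_space lborel unit_cube"

text \<open>Symmetric in its two arguments, which is used to read the Gelfand transform as a
  trigonometric sum in the quasimomentum as well as a function of position.\<close>

definition echar :: "real ^ 'd \<Rightarrow> real ^ 'd \<Rightarrow> complex" where
  "echar \<theta> t = cis (2 * pi * (\<theta> \<bullet> t))"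

lemma real_vec_nth [simp]: "real_vec l $ i = of_int (l $ i)"
  by (simp add: real_vec_def)

lemma real_vec_add: "real_vec (l + m) = real_vec l + real_vec m"
  by (simp add: vec_eq_iff)

lemma real_vec_uminus: "real_vec (- l) = - real_vec l"
  by (simp add: vec_eq_iff)

lemma real_vec_diff: "real_vec (l - m) = real_vec l - real_vec m"
  by (simp add: vec_eq_iff)

lemma real_vec_zero [simp]: "real_vec 0 = 0"
  by (simp add: vec_eq_iff)

lemma echar_add_left: "echar (\<theta> + \<theta>') t = echar \<theta> t * echar \<theta>' t"
  by (simp add: echar_def cis_mult inner_add_left algebra_simps)

lemma echar_add_right: "echar \<theta> (s + t) = echar \<theta> s * echar \<theta> t"
  by (simp add: echar_def cis_mult inner_add_right algebra_simps)

lemma cnj_echar: "cnj (echar \<theta> t) = echar (- \<theta>) t"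
  by (simp add: echar_def cis_cnj)

lemma echar_commute: "echar \<theta> t = echar t \<theta>"
  by (simp add: echar_def inner_commute)

lemma norm_echar [simp]: "cmod (echar \<theta> t) = 1"
  by (simp add: echar_def)

lemma echar_zero [simp]: "echar 0 t = 1"
  by (simp add: echar_def)

lemma echar_int [simp]: "echar (real_vec n) (real_vec l) = 1"
proof -
  have "real_vec n \<bullet> real_vec l = of_int (\<Sum>i\<in>UNIV. n $ i * l $ i)"
    by (simp add: inner_vec_def)
  then show ?thesis unfolding echar_def by (simp only: cis_multiple_2pi Ints_of_int)
qed

lemma continuous_on_echar [continuous_intros]: "continuous_on S (echar \<theta>)"
  unfolding echar_def cis_conv_exp by (intro continuous_intros)

lemma echar_measurable [measurable]: "echar \<theta> \<in> borel_measurable borel"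
  by (rule borel_measurable_continuous_onI[OF continuous_on_echar])

lemma unit_cube_measurable [measurable]: "unit_cube \<in> sets borel"
  unfolding unit_cube_def by measurable

lemma space_torus: "space torus = unit_cube"
  by (simp add: torus_def space_restrict_space)

lemma unit_cube_iff_floor_vec: "t - real_vec l \<in> unit_cube \<longleftrightarrow> l = floor_vec t"
proof -
  have "0 \<le> x - of_int k \<and> x - of_int k < 1 \<longleftrightarrow> k = \<lfloor>x\<rfloor>" for x :: real and k
    by linarith
  then show ?thesis by (auto simp: unit_cube_def floor_vec_def vec_eq_iff)
qed

lemma measurable_torusI: "f \<in> borel_measurable borel \<Longrightarrow> f \<in> borel_measurable torus"
  unfolding torus_def by (intro measurable_restrict_space1) simp

lemma emeasure_unit_cube: "emeasure lborel (unit_cube :: (real ^ 'd) set) = 1"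
proof (rule antisym)
  have "(One :: real ^ 'd) $ i = 1" for i
    by (simp add: cart_eq_inner_axis axis_in_Basis_iff)
  note One = this[unfolded sum_component]
  have "unit_cube \<subseteq> cbox 0 (One :: real ^ 'd)"
    by (auto simp: unit_cube_def mem_box_cart One less_imp_le)
  then have "emeasure lborel (unit_cube :: (real ^ 'd) set) \<le> emeasure lborel (cbox 0 (One :: real ^ 'd))"
    by (intro emeasure_mono) auto
  then show "emeasure lborel (unit_cube :: (real ^ 'd) set) \<le> 1"
    by (simp add: emeasure_lborel_cbox_eq)
  have "box 0 (One :: real ^ 'd) \<subseteq> unit_cube"
    by (auto simp: unit_cube_def mem_box_cart One less_imp_le)
  then have "emeasure lborel (box 0 (One :: real ^ 'd)) \<le> emeasure lborel (unit_cube :: (real ^ 'd) set)"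
    by (intro emeasure_mono) auto
  then show "1 \<le> emeasure lborel (unit_cube :: (real ^ 'd) set)"
    by (simp add: emeasure_lborel_box_eq)
qed

lemma emeasure_space_torus: "emeasure torus (space torus) = 1"
  unfolding space_torus torus_def by (simp add: emeasure_restrict_space emeasure_unit_cube)

interpretation torus: finite_measure torus
  by (rule finite_measureI) (simp add: emeasure_space_torus)

lemma lborel_integral_shift:
  fixes f :: "'a::euclidean_space \<Rightarrow> 'b::{banach, second_countable_topology}"
  assumes [measurable]: "f \<in> borel_measurable borel"
  shows "(\<integral>t. f (t + c) \<partial>lborel) = (\<integral>t. f t \<partial>lborel)"
  by (subst (2) lborel_distr_plus[of c, symmetric], subst integral_distr) (auto simp: add.commute)

lemma lborel_integrable_shift:
  fixes f :: "'a::euclidean_space \<Rightarrow> 'b::{banach, second_countable_topology}"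
  assumes [measurable]: "f \<in> borel_measurable borel" and "integrable lborel f"
  shows "integrable lborel (\<lambda>t. f (t + c))"
proof -
  have "integrable (distr lborel borel ((+) c)) f" using assms by (simp add: lborel_distr_plus)
  then show ?thesis by (subst (asm) integrable_distr_eq) (auto simp: add.commute)
qed

text \<open>Folding space into one cell. The support meets only the finitely many cells in
  \<open>F\<close>, so sum and integral commute without a convergence argument.\<close>

lemma integral_tiling:
  fixes g :: "real ^ 'd \<Rightarrow> 'b::{banach, second_countable_topology}"
  assumes [measurable]: "g \<in> borel_measurable borel" and g: "integrable lborel g"
    and F: "finite F" "\<And>t. g t \<noteq> 0 \<Longrightarrow> floor_vec t \<in> F"
  shows "(\<integral>t. g t \<partial>lborel) = (\<integral>t. (\<Sum>l\<in>F. g (t + real_vec l)) \<partial>torus)"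
    and "\<And>l. integrable torus (\<lambda>t. g (t + real_vec l))"
proof -
  have sub[measurable]: "(\<lambda>t. t - c) \<in> borel_measurable borel" for c :: "real ^ 'd" by simp
  have int: "integrable lborel (\<lambda>t. indicator unit_cube (t - real_vec l) *\<^sub>R g t)" for l
    by (rule Bochner_Integration.integrable_bound[OF g]) (measurable, auto simp: indicator_def)
  have int': "integrable lborel (\<lambda>t. indicator unit_cube t *\<^sub>R g (t + real_vec l))" for l
    using lborel_integrable_shift[OF _ int[of l], of "real_vec l"] by simp
  then show tor: "integrable torus (\<lambda>t. g (t + real_vec l))" for l
    unfolding torus_def by (subst integrable_restrict_space) auto
  have "g t = (\<Sum>l\<in>F. indicator unit_cube (t - real_vec l) *\<^sub>R g t)" for t
  proof -
    have "(\<Sum>l\<in>F. indicator unit_cube (t - real_vec l) *\<^sub>R g t) =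
        (\<Sum>l\<in>F. if l = floor_vec t then g t else 0)"
      by (intro sum.cong) (auto simp: indicator_def unit_cube_iff_floor_vec)
    then show ?thesis using F by (cases "g t = 0") auto
  qed
  then have "(\<integral>t. g t \<partial>lborel) = (\<integral>t. (\<Sum>l\<in>F. indicator unit_cube (t - real_vec l) *\<^sub>R g t) \<partial>lborel)"
    by (intro Bochner_Integration.integral_cong) auto
  also have "\<dots> = (\<Sum>l\<in>F. \<integral>t. indicator unit_cube (t - real_vec l) *\<^sub>R g t \<partial>lborel)"
    by (intro Bochner_Integration.integral_sum int)
  also have "\<dots> = (\<Sum>l\<in>F. \<integral>t. indicator unit_cube t *\<^sub>R g (t + real_vec l) \<partial>lborel)"
  proof (intro sum.cong refl)
    fix l
    show "(\<integral>t. indicator unit_cube (t - real_vec l) *\<^sub>R g t \<partial>lborel) =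
        (\<integral>t. indicator unit_cube t *\<^sub>R g (t + real_vec l) \<partial>lborel)"
      by (subst lborel_integral_shift[of _ "real_vec l", symmetric]) auto
  qed
  also have "\<dots> = (\<Sum>l\<in>F. \<integral>t. g (t + real_vec l) \<partial>torus)"
    unfolding torus_def by (subst integral_restrict_space) auto
  also have "\<dots> = (\<integral>t. (\<Sum>l\<in>F. g (t + real_vec l)) \<partial>torus)"
    by (rule Bochner_Integration.integral_sum[symmetric]) (rule tor)
  finally show "(\<integral>t. g t \<partial>lborel) = (\<integral>t. (\<Sum>l\<in>F. g (t + real_vec l)) \<partial>torus)" .
qed

lemma finite_bounded_int_vec: "finite {l :: int ^ 'd. \<forall>i. \<bar>l $ i\<bar> \<le> N}"
proof -
  have "{l :: int ^ 'd. \<forall>i. \<bar>l $ i\<bar> \<le> N} \<subseteq> vec_lambda ` (PiE UNIV (\<lambda>_. {-N..N}))"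
  proof
    fix l :: "int ^ 'd" assume "l \<in> {l. \<forall>i. \<bar>l $ i\<bar> \<le> N}"
    then have "vec_nth l \<in> PiE UNIV (\<lambda>_. {-N..N})" by (auto simp: abs_le_iff) (metis minus_le_iff)
    moreover have "l = vec_lambda (vec_nth l)" by simp
    ultimately show "l \<in> vec_lambda ` (PiE UNIV (\<lambda>_. {-N..N}))"
      by (intro image_eqI[where x="vec_nth l"])
  qed
  then show ?thesis by (rule finite_subset) (intro finite_imageI finite_PiE; simp)
qed

text \<open>Cut \<open>f\<close> off to the cube translated by \<open>s\<close> and fold back: each
  point of the torus has exactly one integer translate in that cube, and \<open>f\<close> does not
  see the integer translation.\<close>

lemma torus_integral_shift:
  fixes f :: "real ^ 'd \<Rightarrow> complex"
  assumes [measurable]: "f \<in> borel_measurable borel"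
    and per: "\<And>t l. f (t + real_vec l) = f t" and bd: "\<And>t. cmod (f t) \<le> B"
  shows "(\<integral>t. f (t + s) \<partial>torus) = (\<integral>t. f t \<partial>torus)"
proof -
  define g where "g t = indicator unit_cube (t - s) *\<^sub>R f t" for t
  \<comment> \<open>The sum dominates every coordinate of \<open>s\<close>; the 2 leaves room for
    the width of the cube and for rounding down.\<close>
  define N where "N = (\<Sum>i\<in>UNIV. \<lceil>\<bar>s $ i\<bar>\<rceil>) + 2"
  define F where "F = {l :: int ^ 'd. \<forall>i. \<bar>l $ i\<bar> \<le> N}"
  have sub[measurable]: "(\<lambda>t. t - c) \<in> borel_measurable borel" for c :: "real ^ 'd" by simp
  have gm[measurable]: "g \<in> borel_measurable borel" unfolding g_def by measurable
  have i1: "integrable lborel (\<lambda>t. indicator unit_cube t *\<^sub>R f (t + s))"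
  proof (rule Bochner_Integration.integrable_bound)
    show "integrable lborel (\<lambda>t. B * indicator unit_cube (t :: real ^ 'd))"
      by (intro integrable_mult_right integrable_real_indicator) (auto simp: emeasure_unit_cube)
    have "0 \<le> B" using bd[of 0] norm_ge_zero order_trans by blast
    then show "AE t in lborel. norm (indicator unit_cube t *\<^sub>R f (t + s)) \<le> norm (B * indicator unit_cube t)"
      using bd by (auto simp: indicator_def)
  qed measurable
  have gi: "integrable lborel g"
    using lborel_integrable_shift[OF _ i1, of "-s"] by (simp add: g_def[abs_def])
  have s_le: "\<bar>s $ i\<bar> \<le> of_int (N - 2)" for i
  proof -
    have "\<bar>s $ i\<bar> \<le> of_int \<lceil>\<bar>s $ i\<bar>\<rceil>" by simp
    also have "\<lceil>\<bar>s $ i\<bar>\<rceil> \<le> (\<Sum>i\<in>UNIV. \<lceil>\<bar>s $ i\<bar>\<rceil>)" by (rule member_le_sum) auto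
    finally show ?thesis by (simp add: N_def)
  qed
  have FF: "floor_vec t \<in> F" if "t - s \<in> unit_cube" for t
    unfolding F_def
  proof safe
    fix i
    have "0 \<le> t $ i - s $ i" "t $ i - s $ i < 1" using that by (auto simp: unit_cube_def)
    then have "- N \<le> \<lfloor>t $ i\<rfloor>" "\<lfloor>t $ i\<rfloor> \<le> N" using s_le[of i] by linarith+
    then show "\<bar>floor_vec t $ i\<bar> \<le> N" by (simp add: floor_vec_def abs_le_iff)
  qed
  have "(\<integral>t. f (t + s) \<partial>torus) = (\<integral>t. indicator unit_cube t *\<^sub>R f (t + s) \<partial>lborel)"
    unfolding torus_def by (subst integral_restrict_space) auto
  also have "\<dots> = (\<integral>t. g t \<partial>lborel)"
    by (subst lborel_integral_shift[of g s, symmetric]) (auto simp: g_def)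
  also have "\<dots> = (\<integral>t. (\<Sum>l\<in>F. g (t + real_vec l)) \<partial>torus)"
  proof (rule integral_tiling[OF gm gi])
    show "finite F" unfolding F_def by (rule finite_bounded_int_vec)
    show "floor_vec t \<in> F" if "g t \<noteq> 0" for t
      using that by (intro FF) (auto simp: g_def indicator_def split: if_splits)
  qed
  also have "\<dots> = (\<integral>t. f t \<partial>torus)"
  proof (intro Bochner_Integration.integral_cong refl)
    fix t :: "real ^ 'd" assume t: "t \<in> space torus"
    have iff: "t + real_vec l - s \<in> unit_cube \<longleftrightarrow> l = - floor_vec (t - s)" for l
    proof -
      have "t + real_vec l - s = (t - s) - real_vec (- l)" by (simp add: real_vec_uminus)
      have "t + real_vec l - s \<in> unit_cube \<longleftrightarrow> - l = floor_vec (t - s)"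
        unfolding \<open>t + real_vec l - s = (t - s) - real_vec (- l)\<close> by (rule unit_cube_iff_floor_vec)
      then show ?thesis using minus_equation_iff[of l "floor_vec (t - s)"] by auto
    qed
    have "- floor_vec (t - s) \<in> F"
      unfolding F_def
    proof safe
      fix i
      have "0 \<le> t $ i" "t $ i < 1" using t by (auto simp: unit_cube_def space_torus)
      then have "- N \<le> \<lfloor>t $ i - s $ i\<rfloor>" "\<lfloor>t $ i - s $ i\<rfloor> \<le> N" using s_le[of i] by linarith+
      then show "\<bar>(- floor_vec (t - s)) $ i\<bar> \<le> N" by (simp add: floor_vec_def abs_le_iff)
    qed
    moreover have "(\<Sum>l\<in>F. g (t + real_vec l)) = (\<Sum>l\<in>F. if l = - floor_vec (t - s) then f t else 0)"
      by (intro sum.cong) (auto simp: g_def indicator_def iff per)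
    ultimately show "(\<Sum>l\<in>F. g (t + real_vec l)) = f t"
      by (simp add: F_def finite_bounded_int_vec)
  qed
  finally show ?thesis .
qed

lemma echar_periodic: "echar (real_vec n) (t + real_vec l) = echar (real_vec n) t"
  by (simp add: echar_add_right)

lemma integral_torus_echar:
  "(\<integral>t. echar (real_vec n) t \<partial>torus) = (if n = 0 then 1 else 0)"
proof (cases "n = 0")
  case True
  then show ?thesis by (simp add: measure_def emeasure_space_torus)
next
  case False
  then obtain i where i: "n $ i \<noteq> 0" by (auto simp: vec_eq_iff)
  \<comment> \<open>Half a period in a coordinate with \<open>n $ i\<close> nonzero: the shift
    multiplies the character by -1 but preserves the integral.\<close>
  define s where "s = (axis i (1 / (2 * of_int (n $ i))) :: real ^ 'a)"
  have "real_vec n \<bullet> s = 1 / 2" using i by (simp add: s_def inner_axis)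
  then have "echar (real_vec n) s = cis (2 * pi * (1 / 2))" unfolding echar_def by (simp only:)
  then have "echar (real_vec n) s = -1" by simp
  then have "(\<integral>t. echar (real_vec n) t \<partial>torus) = (\<integral>t. - echar (real_vec n) t \<partial>torus)"
    using torus_integral_shift[of "echar (real_vec n)" 1 s] by (simp add: echar_periodic echar_add_right)
  then show ?thesis using False by simp
qed

lemma square_integrable_torus_bounded:
  assumes "f \<in> borel_measurable torus" "\<And>t. t \<in> unit_cube \<Longrightarrow> cmod (f t) \<le> B"
  shows "square_integrable torus f"
  unfolding square_integrable_def
proof
  have "(cmod (f t))\<^sup>2 \<le> B\<^sup>2" if "t \<in> unit_cube" for t
    using assms(2)[OF that] by (intro power_mono) auto
  then show "integrable torus (\<lambda>x. (cmod (f x))\<^sup>2)"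
    using assms by (intro torus.integrable_const_bound[of _ "B\<^sup>2"]) (auto simp: space_torus)
qed (rule assms)

lemma square_integrable_echar [simp]: "square_integrable torus (echar \<theta>)"
  by (rule square_integrable_torus_bounded[of _ 1]) (auto intro!: measurable_torusI)

lemma ip_torus_echar:
  "ip torus (echar (real_vec n)) (echar (real_vec m)) = (if n = m then 1 else 0)"
proof -
  have "ip torus (echar (real_vec n)) (echar (real_vec m)) = (\<integral>t. echar (real_vec (n - m)) t \<partial>torus)"
    unfolding ip_def cnj_echar by (simp add: real_vec_diff echar_add_left[symmetric])
  then show ?thesis by (simp add: integral_torus_echar)
qed

section \<open>Trigonometric polynomials\<close>

inductive_set trig :: "(real ^ 'd \<Rightarrow> complex) set" where
  char: "echar (real_vec n) \<in> trig"
| add: "p \<in> trig \<Longrightarrow> q \<in> trig \<Longrightarrow> (\<lambda>t. p t + q t) \<in> trig"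
| scale: "p \<in> trig \<Longrightarrow> (\<lambda>t. c * p t) \<in> trig"

lemma trig_const: "(\<lambda>t. c) \<in> trig"
  using trig.scale[OF trig.char[of 0], of c] by simp

lemma trig_mult:
  assumes "p \<in> trig" "q \<in> trig"
  shows "(\<lambda>t. p t * q t) \<in> trig"
  using assms
proof (induction p)
  case (char n)
  from char show ?case
  proof (induction q)
    case (char m)
    then show ?case using trig.char[of "n + m"] by (simp add: real_vec_add echar_add_left[abs_def])
  next
    case (add p q)
    then show ?case using trig.add[OF add.IH] by (simp add: distrib_left)
  next
    case (scale p c)
    then show ?case using trig.scale[OF scale.IH, of c] by (simp add: mult.left_commute)
  qed
next
  case (add p p')
  then show ?case using trig.add[OF add.IH] by (simp add: distrib_right)
next
  case (scale p c)
  then show ?case using trig.scale[of "\<lambda>t. p t * q t" c] by (simp add: mult.assoc)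
qed

lemma trig_sum:
  "(\<And>i. i \<in> I \<Longrightarrow> p i \<in> trig) \<Longrightarrow> (\<lambda>t. \<Sum>i\<in>I. p i t) \<in> trig"
  by (induction I rule: infinite_finite_induct) (auto intro: trig_const trig.add)

lemma trig_expand:
  "p \<in> trig \<Longrightarrow> \<exists>F a. finite F \<and> p = (\<lambda>t. \<Sum>n\<in>F. a n * echar (real_vec n) t)"
proof (induction p rule: trig.induct)
  case (char n)
  show ?case by (rule exI[of _ "{n}"], rule exI[of _ "\<lambda>_. 1"]) auto
next
  case (add p q)
  then obtain F a G b where *: "finite F" "p = (\<lambda>t. \<Sum>n\<in>F. a n * echar (real_vec n) t)"
    "finite G" "q = (\<lambda>t. \<Sum>n\<in>G. b n * echar (real_vec n) t)" by blast
  have "p t = (\<Sum>n\<in>F \<union> G. (if n \<in> F then a n else 0) * echar (real_vec n) t)" for t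
    unfolding *(2) using * by (intro sum.mono_neutral_cong_left) auto
  moreover have "q t = (\<Sum>n\<in>F \<union> G. (if n \<in> G then b n else 0) * echar (real_vec n) t)" for t
    unfolding *(4) using * by (intro sum.mono_neutral_cong_left) auto
  ultimately have "(\<lambda>t. p t + q t) = (\<lambda>t. \<Sum>n\<in>F \<union> G.
      ((if n \<in> F then a n else 0) + (if n \<in> G then b n else 0)) * echar (real_vec n) t)"
    by (simp add: sum.distrib distrib_right)
  then show ?case using * by (intro exI[of _ "F \<union> G"] exI conjI) (auto simp del: distrib_right)
next
  case (scale p c)
  then obtain F a where "finite F" "p = (\<lambda>t. \<Sum>n\<in>F. a n * echar (real_vec n) t)" by blast
  then show ?case by (intro exI[of _ F] exI[of _ "\<lambda>n. c * a n"]) (auto simp: sum_distrib_left mult.assoc)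
qed

lemma trig_square_integrable: "p \<in> trig \<Longrightarrow> square_integrable torus p"
  by (induction p rule: trig.induct) auto

section \<open>Density of the trigonometric polynomials in the square-integrable functions on the
  torus\<close>

definition approximable :: "(real ^ 'd \<Rightarrow> complex) \<Rightarrow> bool" where
  "approximable f \<longleftrightarrow> square_integrable torus f \<and>
     (\<forall>\<epsilon>>0. \<exists>p\<in>trig. sqnorm torus (\<lambda>t. f t - p t) < \<epsilon>)"

lemma sqnorm_add_le:
  assumes "square_integrable M f" "square_integrable M g"
  shows "sqnorm M (\<lambda>x. f x + g x) \<le> 2 * sqnorm M f + 2 * sqnorm M g"
proof -
  have "sqnorm M (\<lambda>x. f x + g x) \<le> (\<integral>x. 2 * (cmod (f x))\<^sup>2 + 2 * (cmod (g x))\<^sup>2 \<partial>M)"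
    unfolding sqnorm_def using assms square_integrable_add[OF assms]
    by (intro integral_mono cmod_add_square_le) (auto simp: square_integrable_def)
  then show ?thesis using assms by (simp add: sqnorm_def square_integrable_def)
qed

lemma sqnorm_scale: "sqnorm M (\<lambda>x. c * f x) = (cmod c)\<^sup>2 * sqnorm M f"
  by (simp add: sqnorm_def norm_mult power_mult_distrib)

text \<open>The closure is closed. Two errors of \<epsilon> / 4, each doubled by
  \<open>sqnorm_add_le\<close>, stay below \<epsilon>.\<close>

lemma approximableI:
  assumes "square_integrable torus f"
    and "\<And>\<epsilon>. 0 < \<epsilon> \<Longrightarrow> \<exists>g. approximable g \<and> sqnorm torus (\<lambda>t. f t - g t) < \<epsilon>"
  shows "approximable f"
  unfolding approximable_def
proof (intro conjI allI impI)
  fix \<epsilon> :: real assume "0 < \<epsilon>"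
  then obtain g where g: "approximable g" "sqnorm torus (\<lambda>t. f t - g t) < \<epsilon> / 4"
    using assms(2)[of "\<epsilon> / 4"] by auto
  then obtain p where p: "p \<in> trig" "sqnorm torus (\<lambda>t. g t - p t) < \<epsilon> / 4"
    using \<open>0 < \<epsilon>\<close> unfolding approximable_def by (meson divide_pos_pos zero_less_numeral)
  have "sqnorm torus (\<lambda>t. (f t - g t) + (g t - p t)) \<le>
      2 * sqnorm torus (\<lambda>t. f t - g t) + 2 * sqnorm torus (\<lambda>t. g t - p t)"
    using assms(1) g(1) trig_square_integrable[OF p(1)]
    by (intro sqnorm_add_le) (auto simp: approximable_def)
  then show "\<exists>p\<in>trig. sqnorm torus (\<lambda>t. f t - p t) < \<epsilon>"
    using g p by (intro bexI[of _ p]) auto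
qed (rule assms)

lemma approximable_trig: "p \<in> trig \<Longrightarrow> approximable p"
  unfolding approximable_def by (auto intro: trig_square_integrable bexI[of _ p] simp: sqnorm_def)

lemma approximable_add:
  assumes "approximable f" "approximable g"
  shows "approximable (\<lambda>t. f t + g t)"
  unfolding approximable_def
proof (intro conjI allI impI)
  show "square_integrable torus (\<lambda>t. f t + g t)" using assms by (auto simp: approximable_def)
  fix \<epsilon> :: real assume "0 < \<epsilon>"
  then obtain p q where pq: "p \<in> trig" "sqnorm torus (\<lambda>t. f t - p t) < \<epsilon> / 4"
      "q \<in> trig" "sqnorm torus (\<lambda>t. g t - q t) < \<epsilon> / 4"
    using assms unfolding approximable_def by (meson divide_pos_pos zero_less_numeral)
  have "sqnorm torus (\<lambda>t. (f t - p t) + (g t - q t)) \<le>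
      2 * sqnorm torus (\<lambda>t. f t - p t) + 2 * sqnorm torus (\<lambda>t. g t - q t)"
    using assms trig_square_integrable[OF pq(1)] trig_square_integrable[OF pq(3)]
    by (intro sqnorm_add_le) (auto simp: approximable_def)
  then show "\<exists>p\<in>trig. sqnorm torus (\<lambda>t. f t + g t - p t) < \<epsilon>"
    using pq by (intro bexI[of _ "\<lambda>t. p t + q t"] trig.add) (auto simp: algebra_simps)
qed

lemma approximable_scale:
  assumes "approximable f"
  shows "approximable (\<lambda>t. c * f t)"
  unfolding approximable_def
proof (intro conjI allI impI)
  show "square_integrable torus (\<lambda>t. c * f t)" using assms by (auto simp: approximable_def)
  fix \<epsilon> :: real assume \<epsilon>: "0 < \<epsilon>"
  define \<eta> where "\<eta> = \<epsilon> / ((cmod c)\<^sup>2 + 1)"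
  have c1: "0 < (cmod c)\<^sup>2 + 1" by (simp add: add_nonneg_pos)
  obtain p where p: "p \<in> trig" "sqnorm torus (\<lambda>t. f t - p t) < \<eta>"
    using assms \<epsilon> c1 unfolding approximable_def \<eta>_def by (meson divide_pos_pos)
  have "sqnorm torus (\<lambda>t. c * (f t - p t)) \<le> (cmod c)\<^sup>2 * \<eta>"
    unfolding sqnorm_scale using p by (intro mult_left_mono) auto
  also have "\<dots> < ((cmod c)\<^sup>2 + 1) * \<eta>" using \<epsilon> c1 by (intro mult_strict_right_mono) (auto simp: \<eta>_def)
  also have "\<dots> = \<epsilon>" using c1 by (simp add: \<eta>_def)
  finally show "\<exists>p\<in>trig. sqnorm torus (\<lambda>t. c * f t - p t) < \<epsilon>"
    using p by (intro bexI[of _ "\<lambda>t. c * p t"] trig.scale) (auto simp: algebra_simps)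
qed

lemma approximable_sum:
  "(\<And>i. i \<in> I \<Longrightarrow> approximable (f i)) \<Longrightarrow> approximable (\<lambda>t. \<Sum>i\<in>I. f i t)"
  by (induction I rule: infinite_finite_induct)
     (auto intro: approximable_trig[OF trig_const] approximable_add)

text \<open>Dominated convergence with majorant 4 b^2. Convergence is asked for on the cube only, so
  a constant sequence also transfers the property between functions that agree there.\<close>

lemma approximable_limit:
  assumes f: "f \<in> borel_measurable torus" and b: "integrable torus (\<lambda>t. (b t)\<^sup>2)"
    and g: "\<And>j::nat. approximable (g j)"
    and bd: "\<And>j t. t \<in> unit_cube \<Longrightarrow> cmod (g j t) \<le> b t"
    and lim: "\<And>t. t \<in> unit_cube \<Longrightarrow> (\<lambda>j. g j t) \<longlonglongrightarrow> f t"
  shows "approximable f"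
proof (rule approximableI)
  have gm[measurable]: "g j \<in> borel_measurable torus" for j
    using g[of j] by (auto simp: approximable_def square_integrable_def)
  note f[measurable]
  have fb: "cmod (f t) \<le> b t" if "t \<in> unit_cube" for t
    using tendsto_norm[OF lim[OF that]] bd[OF that] by (intro LIMSEQ_le_const2) auto
  have "(cmod (f t))\<^sup>2 \<le> (b t)\<^sup>2" if "t \<in> unit_cube" for t
    using fb[OF that] by (intro power_mono) auto
  then show sf: "square_integrable torus f"
    unfolding square_integrable_def
    by (intro conjI Bochner_Integration.integrable_bound[OF b] f AE_I2) (auto simp: space_torus)
  have "(\<lambda>j. sqnorm torus (\<lambda>t. f t - g j t)) \<longlonglongrightarrow> (\<integral>t. 0 \<partial>(torus :: (real ^ 'a) measure))"
    unfolding sqnorm_def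
  proof (rule integral_dominated_convergence[where w="\<lambda>t. 4 * (b t)\<^sup>2"])
    show "integrable torus (\<lambda>t. 4 * (b t)\<^sup>2)" using b by simp
    show "AE t in torus. (\<lambda>j. (cmod (f t - g j t))\<^sup>2) \<longlonglongrightarrow> 0"
    proof (rule AE_I2)
      fix t :: "real ^ 'a" assume "t \<in> space torus"
      then have "(\<lambda>j. (cmod (f t - g j t))\<^sup>2) \<longlonglongrightarrow> (cmod (f t - f t))\<^sup>2"
        by (intro tendsto_intros lim) (simp add: space_torus)
      then show "(\<lambda>j. (cmod (f t - g j t))\<^sup>2) \<longlonglongrightarrow> 0" by simp
    qed
    show "AE t in torus. norm ((cmod (f t - g j t))\<^sup>2) \<le> 4 * (b t)\<^sup>2" for j
    proof (rule AE_I2)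
      fix t :: "real ^ 'a" assume t: "t \<in> space torus"
      have "cmod (f t - g j t) \<le> 2 * b t"
        using norm_triangle_ineq4[of "f t" "g j t"] fb[of t] bd[of t j] t by (simp add: space_torus)
      then have "(cmod (f t - g j t))\<^sup>2 \<le> (2 * b t)\<^sup>2" by (intro power_mono) auto
      then show "norm ((cmod (f t - g j t))\<^sup>2) \<le> 4 * (b t)\<^sup>2" by (simp add: power_mult_distrib)
    qed
  qed measurable
  then have lim0: "(\<lambda>j. sqnorm torus (\<lambda>t. f t - g j t)) \<longlonglongrightarrow> 0" by simp
  fix \<epsilon> :: real assume "0 < \<epsilon>"
  then obtain j where "sqnorm torus (\<lambda>t. f t - g j t) < \<epsilon>"
    using order_tendstoD(2)[OF lim0] eventually_sequentially by (metis (no_types, lifting) order_refl)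
  then show "\<exists>g. approximable g \<and> sqnorm torus (\<lambda>t. f t - g t) < \<epsilon>" using g by blast
qed

text \<open>Realises the torus as a subset of a Euclidean space, where Stone-Weierstrass for
  polynomials on compact sets applies; polynomials composed with this map are trigonometric.\<close>

definition circle_map :: "real ^ 'd \<Rightarrow> complex ^ 'd" where
  "circle_map t = (\<chi> i. cis (2 * pi * (t $ i)))"

lemma continuous_on_circle_map: "continuous_on S circle_map"
  unfolding circle_map_def cis_conv_exp by (intro continuous_intros)

lemma circle_map_inj:
  assumes "s \<in> unit_cube" "t \<in> unit_cube" "circle_map s = circle_map t"
  shows "s = t"
proof -
  have "s $ i = t $ i" for i
  proof -
    have "cis (2 * pi * (s $ i)) = cis (2 * pi * (t $ i))"
      using assms(3) by (simp add: circle_map_def vec_eq_iff)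
    then have "sin (2 * pi * (s $ i)) = sin (2 * pi * (t $ i)) \<and> cos (2 * pi * (s $ i)) = cos (2 * pi * (t $ i))"
      by (simp add: cis.ctr)
    then obtain n :: int where "2 * pi * (s $ i) = 2 * pi * (t $ i) + 2 * pi * of_int n"
      unfolding sin_cos_eq_iff by auto
    then have "2 * pi * (s $ i) = 2 * pi * (t $ i + of_int n)" by (simp add: distrib_left)
    then have "s $ i = t $ i + of_int n" by simp
    moreover have "0 \<le> s $ i" "s $ i < 1" "0 \<le> t $ i" "t $ i < 1"
      using assms(1,2) by (auto simp: unit_cube_def)
    ultimately have "real_of_int n < 1" "- 1 < real_of_int n" by linarith+
    then have "n = 0" by linarith
    then show ?thesis using \<open>s $ i = t $ i + of_int n\<close> by simp
  qed
  then show ?thesis by (simp add: vec_eq_iff)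
qed

text \<open>The real coordinates of \<open>circle_map\<close> are cosines and sines, that is,
  combinations of a character and its inverse, and \<open>trig\<close> is closed under
  products.\<close>

lemma trig_polynomial:
  "real_polynomial_function p \<Longrightarrow> (\<lambda>t. of_real (p (circle_map t))) \<in> trig"
proof (induction p rule: real_polynomial_function.induct)
  case (linear f)
  have coord: "(\<lambda>t. of_real (circle_map t \<bullet> b)) \<in> trig" if b: "b \<in> (Basis :: (complex ^ 'a) set)" for b
  proof -
    obtain i u where iu: "b = axis i u" "u \<in> Basis" using b by (auto simp: Basis_vec_def)
    define e :: "int ^ 'a" where "e = axis i 1"
    have "real_vec e = axis i 1" by (auto simp: e_def vec_eq_iff axis_def)
    then have ech: "echar (real_vec e) t = cis (2 * pi * (t $ i))" "echar (real_vec (- e)) t = cis (- (2 * pi * (t $ i)))" for t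
      by (simp_all add: echar_def real_vec_uminus inner_axis' )
    have "u = 1 \<or> u = \<i>" using iu(2) by (simp add: Basis_complex_def)
    then show ?thesis
    proof
      assume "u = 1"
      then have "of_real (circle_map t \<bullet> b) = 1 / 2 * echar (real_vec e) t + 1 / 2 * echar (real_vec (- e)) t" for t
        by (simp add: iu inner_axis circle_map_def ech complex_eq_iff inner_complex_def)
      then show ?thesis by (simp only:) (intro trig.add trig.scale trig.char)
    next
      assume "u = \<i>"
      then have "of_real (circle_map t \<bullet> b) = (- \<i> / 2) * echar (real_vec e) t + (\<i> / 2) * echar (real_vec (- e)) t" for t
        by (simp add: iu inner_axis circle_map_def ech complex_eq_iff inner_complex_def)
      then show ?thesis by (simp only:) (intro trig.add trig.scale trig.char)
    qed
  qed
  interpret bounded_linear f by fact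
  have "complex_of_real (f (circle_map t)) = (\<Sum>b\<in>Basis. of_real (f b) * of_real (circle_map t \<bullet> b))" for t
    by (subst (1) euclidean_representation[symmetric, of "circle_map t"]) (simp add: sum scale mult.commute)
  then show ?case by (simp only:) (intro trig_sum trig.scale coord)
next
  case (const c)
  then show ?case by (rule trig_const)
next
  case (add f g)
  then show ?case using trig.add[OF add.IH] by simp
next
  case (mult f g)
  then show ?case using trig_mult[OF mult.IH] by simp
qed

text \<open>Stone-Weierstrass gives a uniform error \<eta> on a ball containing the image; as the
  torus has mass 1, the squared norm of the error is at most \<eta>^2.\<close>

lemma approximable_continuous:
  fixes H :: "complex ^ 'd \<Rightarrow> real"
  assumes "continuous_on UNIV H"
  shows "approximable (\<lambda>t. of_real (H (circle_map t)))"
proof (rule approximableI)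
  define K where "K = cball (0 :: complex ^ 'd) (real CARD('d))"
  have K: "circle_map t \<in> K" for t :: "real ^ 'd"
  proof -
    have "norm (circle_map t) \<le> (\<Sum>i\<in>UNIV. norm (circle_map t $ i))"
      unfolding norm_vec_def by (rule L2_set_le_sum) simp
    then show ?thesis by (simp add: K_def circle_map_def)
  qed
  have contH: "continuous_on K H" using assms continuous_on_subset by blast
  have cK: "compact K" by (simp add: K_def)
  obtain B where B: "\<And>z. z \<in> K \<Longrightarrow> \<bar>H z\<bar> \<le> B"
    using compact_imp_bounded[OF compact_continuous_image[OF contH cK]] by (auto simp: bounded_iff)
  have [measurable]: "(\<lambda>t. H (circle_map t)) \<in> borel_measurable borel"
    by (intro borel_measurable_continuous_onI continuous_on_compose2[OF assms continuous_on_circle_map]) auto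
  show sH: "square_integrable torus (\<lambda>t. complex_of_real (H (circle_map t)))"
    by (rule square_integrable_torus_bounded[of _ B]) (auto intro!: measurable_torusI simp: B K)
  fix \<epsilon> :: real assume "0 < \<epsilon>"
  define \<eta> where "\<eta> = sqrt (\<epsilon> / 2)"
  have \<eta>: "0 < \<eta>" "\<eta>\<^sup>2 < \<epsilon>" using \<open>0 < \<epsilon>\<close> by (auto simp: \<eta>_def)
  obtain p where p: "real_polynomial_function p" "\<And>z. z \<in> K \<Longrightarrow> \<bar>H z - p z\<bar> < \<eta>"
    using Stone_Weierstrass_real_polynomial_function[OF cK contH \<eta>(1)] by blast
  have pt: "(\<lambda>t. complex_of_real (p (circle_map t))) \<in> trig" by (rule trig_polynomial[OF p(1)])
  have "sqnorm torus (\<lambda>t. of_real (H (circle_map t)) - of_real (p (circle_map t))) \<le> (\<integral>t. \<eta>\<^sup>2 \<partial>(torus :: (real ^ 'd) measure))"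
    unfolding sqnorm_def
  proof (rule integral_mono)
    show "integrable torus (\<lambda>t. (cmod (of_real (H (circle_map t)) - of_real (p (circle_map t))))\<^sup>2)"
      using square_integrable_diff[OF sH trig_square_integrable[OF pt]] by (simp add: square_integrable_def)
    show "(cmod (of_real (H (circle_map t)) - of_real (p (circle_map t))))\<^sup>2 \<le> \<eta>\<^sup>2" for t :: "real ^ 'd"
      using p(2)[OF K[of t]] by (intro power_mono) (auto simp flip: of_real_diff)
  qed simp
  also have "\<dots> = \<eta>\<^sup>2" by (simp add: measure_def emeasure_space_torus)
  finally show "\<exists>g. approximable g \<and> sqnorm torus (\<lambda>t. of_real (H (circle_map t)) - g t) < \<epsilon>"
    using approximable_trig[OF pt] \<eta>(2) by (intro exI[of _ "\<lambda>t. of_real (p (circle_map t))"]) auto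
qed

text \<open>The indicator is the limit of \<open>max 0 (1 - j * dist)\<close>, the distance being
  taken to the compact image of \<open>A\<close> under \<open>circle_map\<close>. Injectivity on the
  cube gives points outside \<open>A\<close> a positive distance.\<close>

lemma approximable_compact:
  assumes A: "compact A" "A \<subseteq> unit_cube"
  shows "approximable (indicator A)"
proof (cases "A = {}")
  case True
  then have "(indicator A :: real ^ 'a \<Rightarrow> complex) = (\<lambda>_. 0)" by auto
  then show ?thesis using approximable_trig[OF trig_const[of 0]] by simp
next
  case False
  define C where "C = circle_map ` A"
  have C: "compact C" "C \<noteq> {}"
    unfolding C_def using A False by (auto intro: compact_continuous_image continuous_on_circle_map)
  define H where "H j z = max 0 (1 - real j * infdist z C)" for j :: nat and z
  have contH: "continuous_on UNIV (H j)" for j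
    unfolding H_def by (intro continuous_intros continuous_on_infdist)
  show ?thesis
  proof (rule approximable_limit[where b="\<lambda>_. 1" and g="\<lambda>j t. of_real (H j (circle_map t))"])
    show "(indicator A :: _ \<Rightarrow> complex) \<in> borel_measurable torus"
      using A(1) by (intro measurable_torusI borel_measurable_indicator) (auto intro: borel_closed compact_imp_closed)
    show "approximable (\<lambda>t. of_real (H j (circle_map t)))" for j
      by (rule approximable_continuous[OF contH])
    fix t :: "real ^ 'a" assume t: "t \<in> unit_cube"
    show "cmod (of_real (H j (circle_map t))) \<le> 1" for j
      by (simp add: H_def infdist_nonneg)
    show "(\<lambda>j. complex_of_real (H j (circle_map t))) \<longlonglongrightarrow> indicator A t"
    proof (cases "t \<in> A")
      case True
      then have "infdist (circle_map t) C = 0" by (simp add: C_def)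
      then show ?thesis using True by (simp add: H_def)
    next
      case False
      then have "circle_map t \<notin> C" using circle_map_inj t A(2) by (auto simp: C_def)
      then have d: "0 < infdist (circle_map t) C"
        using C by (metis compact_imp_closed in_closed_iff_infdist_zero infdist_nonneg less_eq_real_def)
      have "\<forall>\<^sub>F j in sequentially. H j (circle_map t) = 0"
      proof -
        obtain N :: nat where N: "1 / infdist (circle_map t) C < real N" using reals_Archimedean2 by blast
        have "H j (circle_map t) = 0" if "N \<le> j" for j
        proof -
          have "1 / infdist (circle_map t) C < real j" using N that by linarith
          then have "1 < real j * infdist (circle_map t) C" using d by (simp add: pos_divide_less_eq)
          then show ?thesis by (simp add: H_def)
        qed
        then show ?thesis unfolding eventually_sequentially by blast
      qed
      then have "(\<lambda>j. complex_of_real (H j (circle_map t))) \<longlonglongrightarrow> 0"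
        by (intro tendsto_eventually) (auto elim: eventually_mono)
      then show ?thesis using False by simp
    qed
  qed auto
qed

text \<open>Dynkin's argument: closed sets are stable under intersection and generate the Borel
  sets, and the sets with approximable indicator are closed under complements and countable disjoint
  unions.\<close>

lemma approximable_indicator:
  assumes "A \<in> sets borel"
  shows "approximable (indicator A)"
proof -
  have ind: "(indicator A :: real ^ 'a \<Rightarrow> complex) \<in> borel_measurable torus" if "A \<in> sets borel" for A
    using that by (intro measurable_torusI) simp
  have "Int_stable (Collect closed :: (real ^ 'a) set set)" by (auto simp: Int_stable_def)
  moreover have "Collect closed \<subseteq> Pow (UNIV :: (real ^ 'a) set)" by simp
  moreover have "A \<in> sigma_sets UNIV (Collect closed)"
    using assms by (simp add: borel_eq_closed)
  ultimately show ?thesis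
  proof (induction rule: sigma_sets_induct_disjoint)
    case (basic A)
    \<comment> \<open>These closed boxes exhaust the half-open cube from inside, which makes the
      intersections with a closed set compact.\<close>
    define S :: "nat \<Rightarrow> (real ^ 'a) set" where "S j = A \<inter> cbox 0 (\<chi> i. 1 - 1 / real (Suc j))" for j
    show ?case
    proof (rule approximable_limit[where b="\<lambda>_. 1" and g="\<lambda>j. indicator (S j)"])
      show "(indicator A :: _ \<Rightarrow> complex) \<in> borel_measurable torus" using basic by (intro ind) auto
      show "approximable (indicator (S j))" for j
      proof (rule approximable_compact)
        show "compact (S j)" unfolding S_def using basic by (intro closed_Int_compact) auto
        show "S j \<subseteq> unit_cube"
        proof
          fix x assume x: "x \<in> S j"
          have "0 \<le> x $ i \<and> x $ i < 1" for i
          proof -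
            have "0 \<le> x $ i" "x $ i \<le> 1 - 1 / real (Suc j)" using x by (auto simp: S_def mem_box_cart)
            moreover have "0 < 1 / real (Suc j)" by simp
            ultimately show ?thesis by linarith
          qed
          then show "x \<in> unit_cube" by (simp add: unit_cube_def)
        qed
      qed
      fix t :: "real ^ 'a" assume t: "t \<in> unit_cube"
      show "cmod (indicator (S j) t) \<le> 1" for j by (simp add: indicator_def)
      have "\<forall>\<^sub>F j in sequentially. t $ i \<le> 1 - 1 / real (Suc j)" for i
      proof -
        have "(\<lambda>j. 1 - 1 / real (Suc j)) \<longlonglongrightarrow> 1 - 0"
          by (intro tendsto_intros LIMSEQ_Suc lim_1_over_n)
        then have "\<forall>\<^sub>F j in sequentially. t $ i < 1 - 1 / real (Suc j)"
          by (rule order_tendstoD) (use t in \<open>auto simp: unit_cube_def\<close>)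
        then show ?thesis by (rule eventually_mono) simp
      qed
      then have "\<forall>\<^sub>F j in sequentially. \<forall>i\<in>UNIV. t $ i \<le> 1 - 1 / real (Suc j)"
        by (subst eventually_ball_finite_distrib) auto
      then have "\<forall>\<^sub>F j in sequentially. (indicator (S j) t :: complex) = indicator A t"
        by (rule eventually_mono) (use t in \<open>auto simp: S_def unit_cube_def mem_box_cart indicator_def\<close>)
      then show "(\<lambda>j. indicator (S j) t :: complex) \<longlonglongrightarrow> indicator A t"
        by (rule tendsto_eventually)
    qed auto
  next
    case empty
    have "(indicator {} :: real ^ 'a \<Rightarrow> complex) = (\<lambda>_. 0)" by auto
    then show ?case using approximable_trig[OF trig_const[of 0]] by simp
  next
    case (compl A)
    have "approximable (\<lambda>t. 1 + (-1) * indicator A t)"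
      by (intro approximable_add approximable_scale approximable_trig trig_const compl)
    moreover have "(\<lambda>t. 1 + (-1) * indicator A t) = (indicator (UNIV - A) :: real ^ 'a \<Rightarrow> complex)"
      by (auto simp: indicator_def)
    ultimately show ?case by simp
  next
    case (union A)
    have Am: "A i \<in> sets borel" for i using union(2) by (auto simp: borel_eq_closed image_subset_iff)
    show ?case
    proof (rule approximable_limit[where b="\<lambda>_. 1" and g="\<lambda>j t. \<Sum>i<j. indicator (A i) t"])
      show "(indicator (\<Union>i. A i) :: _ \<Rightarrow> complex) \<in> borel_measurable torus" using Am by (intro ind) auto
      show "approximable (\<lambda>t. \<Sum>i<j. indicator (A i) t)" for j using union by (intro approximable_sum) auto
      fix t :: "real ^ 'a" assume t: "t \<in> unit_cube"
      have eq: "(\<Sum>i<j. indicator (A i) t :: complex) = indicator (\<Union>i<j. A i) t" for j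
        using union(1) by (subst indicator_UN_disjoint) (auto intro: disjoint_family_on_mono)
      show "cmod (\<Sum>i<j. indicator (A i) t) \<le> 1" for j unfolding eq by (simp add: indicator_def)
      show "(\<lambda>j. \<Sum>i<j. indicator (A i) t :: complex) \<longlonglongrightarrow> indicator (\<Union>i. A i) t"
        unfolding eq by (rule LIMSEQ_indicator_UN)
    qed auto
  qed
qed

lemma approximable_square_integrable:
  assumes "square_integrable torus f"
  shows "approximable f"
proof -
  have f: "f \<in> borel_measurable torus" using assms by (rule square_integrable_measurable)
  obtain F where F: "\<And>i. simple_function torus (F i)" "\<And>x. x \<in> space torus \<Longrightarrow> (\<lambda>i. F i x) \<longlonglongrightarrow> f x"
    "\<And>i x. x \<in> space torus \<Longrightarrow> dist (F i x) 0 \<le> 2 * dist (f x) 0"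
    using borel_measurable_implies_sequence_metric[OF f, of 0] by blast
  show ?thesis
  proof (rule approximable_limit[where b="\<lambda>t. 2 * cmod (f t)" and g=F, OF f])
    show "integrable torus (\<lambda>t. (2 * cmod (f t))\<^sup>2)"
      using assms by (simp add: square_integrable_def power_mult_distrib)
    show "approximable (F j)" for j
    proof -
      define G where "G y = F j -` {y} \<inter> unit_cube" for y
      have "approximable (indicator (G y))" for y
      proof (rule approximable_indicator)
        have "F j -` {y} \<inter> space torus \<in> sets torus"
          using F(1)[of j] simple_functionD(2) by blast
        then show "G y \<in> sets borel" unfolding G_def space_torus
          by (simp add: torus_def sets_restrict_space_iff)
      qed
      note ind = this
      have ap: "approximable (\<lambda>t. \<Sum>y\<in>F j ` unit_cube. y * indicator (G y) t)"
        by (intro approximable_sum approximable_scale ind)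
      have fin: "finite (F j ` unit_cube)" using F(1)[of j] by (simp add: simple_function_def space_torus)
      have eq: "(\<Sum>y\<in>F j ` unit_cube. y * indicator (G y) t) = F j t" if "t \<in> unit_cube" for t
      proof -
        have "(\<Sum>y\<in>F j ` unit_cube. y * indicator (G y) t) = (\<Sum>y\<in>F j ` unit_cube. if y = F j t then F j t else 0)"
          using that by (intro sum.cong) (auto simp: G_def indicator_def)
        then show ?thesis using fin that by simp
      qed
      \<comment> \<open>The sum over level sets agrees with \<open>F j\<close> on the cube only, so
        a constant sequence is fed to \<open>approximable_limit\<close>.\<close>
      show ?thesis
      proof (rule approximable_limit[where b="\<lambda>t. cmod (F j t)" and g="\<lambda>_ t. \<Sum>y\<in>F j ` unit_cube. y * indicator (G y) t"])
        show "F j \<in> borel_measurable torus" by (rule borel_measurable_simple_function[OF F(1)])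
        show "integrable torus (\<lambda>t. (cmod (F j t))\<^sup>2)"
        proof (rule Bochner_Integration.integrable_bound)
          show "integrable torus (\<lambda>t. (2 * cmod (f t))\<^sup>2)" by fact
          show "(\<lambda>t. (cmod (F j t))\<^sup>2) \<in> borel_measurable torus"
            using borel_measurable_simple_function[OF F(1)[of j]] by measurable
          show "AE t in torus. norm ((cmod (F j t))\<^sup>2) \<le> norm ((2 * cmod (f t))\<^sup>2)"
          proof (rule AE_I2)
            fix t :: "real ^ 'a" assume "t \<in> space torus"
            then have "(cmod (F j t))\<^sup>2 \<le> (2 * cmod (f t))\<^sup>2"
              using F(3)[of t j] by (intro power_mono) auto
            then show "norm ((cmod (F j t))\<^sup>2) \<le> norm ((2 * cmod (f t))\<^sup>2)" by simp
          qed
        qed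
      qed (use ap in \<open>auto simp: eq\<close>)
    qed
    show "cmod (F j t) \<le> 2 * cmod (f t)" if "t \<in> unit_cube" for j t
      using F(3)[of t j] that by (simp add: space_torus)
    show "(\<lambda>j. F j t) \<longlonglongrightarrow> f t" if "t \<in> unit_cube" for t
      using F(2)[of t] that by (simp add: space_torus)
  qed
qed

text \<open>One inequality is Bessel's. For the other, a trigonometric polynomial within \<epsilon>
  of \<open>f\<close> uses finitely many frequencies, and on these the Fourier partial sum of
  \<open>f\<close> approximates at least as well.\<close>

lemma parseval_torus:
  assumes f: "square_integrable torus f"
  defines "c \<equiv> \<lambda>n. ip torus f (echar (real_vec n))"
  shows "square_integrable (count_space UNIV) c" "sqnorm (count_space UNIV) c = sqnorm torus f"
proof -
  have bes: "(\<Sum>n\<in>F. (cmod (c n))\<^sup>2) \<le> sqnorm torus f" if "finite F" for F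
    unfolding c_def using that f by (intro bessel) (auto simp: ip_torus_echar)
  note sq = square_integrable_count_spaceI[of c, OF bes]
  show s: "square_integrable (count_space UNIV) c" by (rule sq)
  show "sqnorm (count_space UNIV) c = sqnorm torus f"
  proof (rule antisym)
    show "sqnorm (count_space UNIV) c \<le> sqnorm torus f" by (rule sq)
    show "sqnorm torus f \<le> sqnorm (count_space UNIV) c"
    proof (rule field_le_epsilon)
      fix \<epsilon> :: real assume "0 < \<epsilon>"
      then obtain p where p: "p \<in> trig" "sqnorm torus (\<lambda>t. f t - p t) < \<epsilon>"
        using approximable_square_integrable[OF f] unfolding approximable_def by blast
      obtain F a where F: "finite F" "p = (\<lambda>t. \<Sum>n\<in>F. a n * echar (real_vec n) t)"
        using trig_expand[OF p(1)] by blast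
      have "sqnorm torus f - (\<Sum>n\<in>F. (cmod (c n))\<^sup>2) \<le> sqnorm torus (\<lambda>t. f t - p t)"
        unfolding F(2)
        by (subst sqnorm_diff_orthonormal) (auto simp: F(1) f ip_torus_echar c_def intro!: sum_nonneg)
      then show "sqnorm torus f \<le> sqnorm (count_space UNIV) c + \<epsilon>"
        using p(2) sum_le_sqnorm_count_space[OF s F(1)] by linarith
    qed
  qed
qed

section \<open>The Gelfand transform\<close>

definition fourier :: "(real ^ 'd \<Rightarrow> complex) \<Rightarrow> real ^ 'd \<Rightarrow> complex" where
  "fourier v \<theta> = (\<integral>t. v t * echar (- \<theta>) t \<partial>lborel)"

definition int_cube :: "int \<Rightarrow> (int ^ 'd) set" where
  "int_cube N = {l. \<forall>i. \<bar>l $ i\<bar> \<le> N}"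

text \<open>The Bloch-Floquet (Zak) sum over lattice translates with the phase of the quasimomentum,
  truncated to a finite cube of translates; on functions supported there it is the full sum.\<close>

definition gelfand :: "int \<Rightarrow> (real ^ 'd \<Rightarrow> complex) \<Rightarrow> real ^ 'd \<Rightarrow> real ^ 'd \<Rightarrow> complex" where
  "gelfand N v \<theta> t = (\<Sum>l\<in>int_cube N. v (t + real_vec l) * echar (- \<theta>) (t + real_vec l))"

text \<open>Support is measured by cells: for \<open>t\<close> in the unit cube the cell of
  \<open>t + real_vec l\<close> is \<open>l\<close>, so this is exactly the condition under which
  \<open>gelfand N\<close> misses no translate.\<close>

definition supported_in :: "int \<Rightarrow> (real ^ 'd \<Rightarrow> complex) \<Rightarrow> bool" where
  "supported_in N v \<longleftrightarrow> (\<forall>t. v t \<noteq> 0 \<longrightarrow> floor_vec t \<in> int_cube N)"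

lemma finite_int_cube [simp]: "finite (int_cube N)"
  unfolding int_cube_def by (rule finite_bounded_int_vec)

lemma square_integrable_supported_integrable:
  fixes v :: "real ^ 'd \<Rightarrow> complex"
  assumes v: "square_integrable lborel v" and N: "supported_in N v"
  shows "integrable lborel v"
proof (rule Bochner_Integration.integrable_bound)
  define B :: "(real ^ 'd) set" where "B = cbox (\<chi> i. - of_int N) (\<chi> i. of_int N + 1)"
  have B: "emeasure lborel (B :: (real ^ 'd) set) < \<infinity>" unfolding B_def by (rule emeasure_lborel_cbox_finite)
  show "integrable lborel (\<lambda>t. indicator B t + (cmod (v t))\<^sup>2 :: real)"
    using v B by (intro Bochner_Integration.integrable_add integrable_real_indicator)
      (auto simp: square_integrable_def B_def)
  show "v \<in> borel_measurable lborel" using v by (simp add: square_integrable_def)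
  show "AE t in lborel. norm (v t) \<le> norm (indicator B t + (cmod (v t))\<^sup>2 :: real)"
  proof (rule AE_I2)
    fix t :: "real ^ 'd"
    show "norm (v t) \<le> norm (indicator B t + (cmod (v t))\<^sup>2 :: real)"
    proof (cases "v t = 0")
      case False
      have "t \<in> B"
      proof -
        have "- of_int N \<le> t $ i \<and> t $ i \<le> of_int N + 1" for i
        proof -
          have "\<bar>\<lfloor>t $ i\<rfloor>\<bar> \<le> N" using N False by (auto simp: supported_in_def int_cube_def floor_vec_def)
          then show ?thesis by linarith
        qed
        then show ?thesis by (simp add: B_def mem_box_cart)
      qed
      moreover have "2 * cmod (v t) \<le> 1 + (cmod (v t))\<^sup>2"
        using sum_squares_bound[of 1 "cmod (v t)"] by simp
      moreover have "0 \<le> cmod (v t)" by simp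
      ultimately have "cmod (v t) \<le> 1 + (cmod (v t))\<^sup>2" by linarith
      then show ?thesis using \<open>t \<in> B\<close> by simp
    qed simp
  qed
qed

lemma fourier_borel [measurable]:
  assumes "v \<in> borel_measurable borel"
  shows "fourier v \<in> borel_measurable borel"
proof -
  note assms[measurable]
  have "(\<lambda>p. v (snd p) * cis (2 * pi * (- fst p \<bullet> snd p))) \<in> borel_measurable (borel \<Otimes>\<^sub>M lborel)"
    unfolding cis_conv_exp by measurable
  from lborel.borel_measurable_lebesgue_integral[of "\<lambda>\<theta> t. v t * cis (2 * pi * (- \<theta> \<bullet> t))" borel] this
  show ?thesis unfolding fourier_def[abs_def] echar_def by (simp add: case_prod_beta')
qed

lemma integrable_times_echar:
  assumes "integrable lborel v"
  shows "integrable lborel (\<lambda>t. v t * echar \<theta> t)"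
proof (rule Bochner_Integration.integrable_bound[OF assms])
  have [measurable]: "v \<in> borel_measurable borel" using borel_measurable_integrable[OF assms] by simp
  show "(\<lambda>t. v t * echar \<theta> t) \<in> borel_measurable lborel" by measurable
qed (simp add: norm_mult)

lemma fourier_diff:
  assumes "integrable lborel u" "integrable lborel v"
  shows "fourier (\<lambda>t. u t - v t) \<theta> = fourier u \<theta> - fourier v \<theta>"
  unfolding fourier_def left_diff_distrib
  by (rule Bochner_Integration.integral_diff) (intro integrable_times_echar assms)+

lemma square_integrable_shift_torus:
  fixes v :: "real ^ 'd \<Rightarrow> complex"
  assumes v: "square_integrable lborel v" and N: "supported_in N v"
  shows "square_integrable torus (\<lambda>t. v (t + real_vec l))"
proof -
  have [measurable]: "v \<in> borel_measurable borel" using v by (simp add: square_integrable_def)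
  have "integrable torus (\<lambda>t. (cmod (v (t + real_vec l)))\<^sup>2)"
    by (rule integral_tiling(2)[where F="int_cube N"])
       (use v N in \<open>auto simp: square_integrable_def supported_in_def\<close>)
  then show ?thesis by (auto simp: square_integrable_def intro!: measurable_torusI)
qed

lemma square_integrable_times_echar:
  assumes "square_integrable torus f"
  shows "square_integrable torus (\<lambda>t. f t * (c * echar \<theta> t))"
proof -
  have [measurable]: "f \<in> borel_measurable torus" "echar \<theta> \<in> borel_measurable torus"
    using assms by (auto simp: square_integrable_def intro!: measurable_torusI)
  have "(\<lambda>t. (cmod (f t * (c * echar \<theta> t)))\<^sup>2) = (\<lambda>t. (cmod (f t))\<^sup>2 * (cmod c)\<^sup>2)"
    by (simp add: norm_mult power_mult_distrib)
  then show ?thesis using assms by (simp add: square_integrable_def)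
qed

lemma square_integrable_gelfand:
  assumes v: "square_integrable lborel v" and N: "supported_in N v"
  shows "square_integrable torus (gelfand N v \<theta>)"
  unfolding gelfand_def echar_add_right
  by (intro square_integrable_sum)
     (subst mult.commute[of "echar _ _"], intro square_integrable_times_echar square_integrable_shift_torus[OF assms])

text \<open>Characters of integer frequency do not see integer translations, so folding the Fourier
  integral into the torus turns the value at \<theta> + n into the n-th Fourier coefficient of the
  Bloch sum.\<close>

lemma ip_gelfand:
  assumes v: "square_integrable lborel v" and N: "supported_in N v"
  shows "ip torus (gelfand N v \<theta>) (echar (real_vec n)) = fourier v (\<theta> + real_vec n)"
proof -
  have [measurable]: "v \<in> borel_measurable borel" using v by (simp add: square_integrable_def)
  have "fourier v (\<theta> + real_vec n) =
      (\<integral>t. (\<Sum>l\<in>int_cube N. v (t + real_vec l) * echar (- (\<theta> + real_vec n)) (t + real_vec l)) \<partial>torus)"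
    unfolding fourier_def
    by (rule integral_tiling(1))
       (use N in \<open>auto simp: supported_in_def intro!: integrable_times_echar square_integrable_supported_integrable[OF assms]\<close>)
  also have "\<dots> = ip torus (gelfand N v \<theta>) (echar (real_vec n))"
    unfolding ip_def gelfand_def sum_distrib_right
  proof (intro Bochner_Integration.integral_cong sum.cong refl)
    fix t :: "real ^ 'a" and l :: "int ^ 'a"
    have "echar (- (\<theta> + real_vec n)) (t + real_vec l) =
        echar (- \<theta>) (t + real_vec l) * echar (real_vec (- n)) (t + real_vec l)"
      by (simp add: echar_add_left[symmetric] real_vec_uminus)
    then show "v (t + real_vec l) * echar (- (\<theta> + real_vec n)) (t + real_vec l) =
        v (t + real_vec l) * echar (- \<theta>) (t + real_vec l) * cnj (echar (real_vec n) t)"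
      by (simp add: echar_periodic cnj_echar real_vec_uminus[symmetric])
  qed
  finally show ?thesis ..
qed

lemma sqnorm_gelfand:
  assumes v: "square_integrable lborel v" and N: "supported_in N v"
  shows "square_integrable (count_space UNIV) (\<lambda>n. fourier v (\<theta> + real_vec n))"
    and "sqnorm (count_space UNIV) (\<lambda>n. fourier v (\<theta> + real_vec n)) = sqnorm torus (gelfand N v \<theta>)"
  using parseval_torus[OF square_integrable_gelfand[OF assms, of \<theta>]] by (simp_all add: ip_gelfand[OF assms])

lemma sqnorm_sum_echar:
  assumes "finite I" "inj_on m I"
  shows "sqnorm torus (\<lambda>\<theta>. \<Sum>l\<in>I. a l * echar (real_vec (m l)) \<theta>) = (\<Sum>l\<in>I. (cmod (a l))\<^sup>2)"
proof -
  have "sqnorm torus (\<lambda>\<theta>. 0 - (\<Sum>l\<in>I. a l * echar (real_vec (m l)) \<theta>)) =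
      sqnorm torus (\<lambda>_ :: real ^ 'b. 0) - (\<Sum>l\<in>I. (cmod (ip torus (\<lambda>_. 0) (echar (real_vec (m l)))))\<^sup>2)
        + (\<Sum>l\<in>I. (cmod (a l - ip torus (\<lambda>_. 0) (echar (real_vec (m l)))))\<^sup>2)"
    using assms by (intro sqnorm_diff_orthonormal) (auto simp: ip_torus_echar inj_on_eq_iff)
  then show ?thesis by (simp add: ip_def sqnorm_def)
qed

lemma measurable_gelfand:
  fixes v :: "real ^ 'd \<Rightarrow> complex"
  assumes [measurable]: "v \<in> borel_measurable borel"
  shows "(\<lambda>p. gelfand N v (fst p) (snd p))
      \<in> borel_measurable ((torus :: (real ^ 'd) measure) \<Otimes>\<^sub>M (torus :: (real ^ 'd) measure))"
proof -
  have id[measurable]: "(\<lambda>x. x) \<in> (torus :: (real ^ 'd) measure) \<rightarrow>\<^sub>M borel" by (rule measurable_torusI) simp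
  have f[measurable]: "fst \<in> (torus :: (real ^ 'd) measure) \<Otimes>\<^sub>M (torus :: (real ^ 'd) measure) \<rightarrow>\<^sub>M borel"
    using measurable_compose[OF measurable_fst id] by simp
  have s[measurable]: "snd \<in> (torus :: (real ^ 'd) measure) \<Otimes>\<^sub>M (torus :: (real ^ 'd) measure) \<rightarrow>\<^sub>M borel"
    using measurable_compose[OF measurable_snd id] by simp
  have "(\<lambda>p. \<Sum>l\<in>int_cube N. v (snd p + real_vec l) * cis (2 * pi * (- fst p \<bullet> (snd p + real_vec l))))
      \<in> borel_measurable ((torus :: (real ^ 'd) measure) \<Otimes>\<^sub>M (torus :: (real ^ 'd) measure))"
    unfolding cis_conv_exp by measurable
  then show ?thesis
    unfolding gelfand_def echar_def .
qed

text \<open>Unitarity of the Gelfand transform. For fixed t the sum is a unimodular factor times a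
  trigonometric polynomial in \<theta> with coefficients \<open>v (t + real_vec l)\<close>, so its
  mean square in \<theta> is the sum of their squared moduli; Tonelli and unfolding in t give the
  norm of \<open>v\<close>.\<close>

lemma nn_integral_sqnorm_gelfand:
  fixes v :: "real ^ 'd \<Rightarrow> complex"
  assumes v: "square_integrable lborel v" and N: "supported_in N v"
  shows "(\<integral>\<^sup>+\<theta>. ennreal (sqnorm torus (gelfand N v \<theta>)) \<partial>torus) = ennreal (sqnorm lborel v)"
proof -
  have [measurable]: "v \<in> borel_measurable borel" using v by (simp add: square_integrable_def)
  interpret P: pair_sigma_finite "torus :: (real ^ 'd) measure" "torus :: (real ^ 'd) measure"
    by (intro pair_sigma_finite.intro torus.sigma_finite_measure_axioms)
  note measurable_gelfand[of v N, measurable]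
  have sw: "sqnorm torus (\<lambda>\<theta>. gelfand N v \<theta> t) = (\<Sum>l\<in>int_cube N. (cmod (v (t + real_vec l)))\<^sup>2)"
    and si: "square_integrable torus (\<lambda>\<theta>. gelfand N v \<theta> t)" for t
  proof -
    define a where "a l = v (t + real_vec l)" for l
    have e: "gelfand N v \<theta> t = echar t (- \<theta>) * (\<Sum>l\<in>int_cube N. a l * echar (real_vec (- l)) \<theta>)" for \<theta>
      unfolding gelfand_def sum_distrib_left a_def
    proof (intro sum.cong refl)
      fix l :: "int ^ 'd"
      have "echar (- \<theta>) (t + real_vec l) = echar t (- \<theta>) * echar (real_vec (- l)) \<theta>"
        unfolding echar_add_right echar_commute[of "- \<theta>"] by (simp add: echar_def real_vec_uminus)
      then show "v (t + real_vec l) * echar (- \<theta>) (t + real_vec l) =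
          echar t (- \<theta>) * (v (t + real_vec l) * echar (real_vec (- l)) \<theta>)" by simp
    qed
    have "sqnorm torus (\<lambda>\<theta>. gelfand N v \<theta> t) = sqnorm torus (\<lambda>\<theta>. \<Sum>l\<in>int_cube N. a l * echar (real_vec (- l)) \<theta>)"
      unfolding sqnorm_def e by (simp add: norm_mult)
    also have "\<dots> = (\<Sum>l\<in>int_cube N. (cmod (a l))\<^sup>2)"
      by (rule sqnorm_sum_echar) (auto simp: inj_on_def)
    finally show "sqnorm torus (\<lambda>\<theta>. gelfand N v \<theta> t) = (\<Sum>l\<in>int_cube N. (cmod (v (t + real_vec l)))\<^sup>2)"
      by (simp add: a_def)
    have [measurable]: "(\<lambda>\<theta>. echar t (- \<theta>)) \<in> borel_measurable torus"
      by (intro measurable_torusI) measurable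
    have sq: "square_integrable torus (\<lambda>\<theta>. \<Sum>l\<in>int_cube N. a l * echar (real_vec (- l)) \<theta>)"
      by (intro square_integrable_sum square_integrable_scale square_integrable_echar)
    have [measurable]: "(\<lambda>\<theta>. \<Sum>l\<in>int_cube N. a l * echar (real_vec (- l)) \<theta>) \<in> borel_measurable torus"
      using sq by (simp add: square_integrable_def)
    have "(\<lambda>\<theta>. gelfand N v \<theta> t) \<in> borel_measurable torus" unfolding e by measurable
    moreover have "integrable torus (\<lambda>\<theta>. (cmod (gelfand N v \<theta> t))\<^sup>2)"
      using sq unfolding square_integrable_def e by (simp add: norm_mult)
    ultimately show "square_integrable torus (\<lambda>\<theta>. gelfand N v \<theta> t)" by (simp add: square_integrable_def)
  qed
  have nn: "ennreal (sqnorm M f) = (\<integral>\<^sup>+x. ennreal ((cmod (f x))\<^sup>2) \<partial>M)" if "square_integrable M f" for M f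
    using that by (simp add: sqnorm_def square_integrable_def nn_integral_eq_integral)
  have "(\<integral>\<^sup>+\<theta>. ennreal (sqnorm torus (gelfand N v \<theta>)) \<partial>torus) =
      (\<integral>\<^sup>+\<theta>. \<integral>\<^sup>+t. ennreal ((cmod (gelfand N v \<theta> t))\<^sup>2) \<partial>torus \<partial>torus)"
    by (simp add: nn square_integrable_gelfand[OF assms])
  also have "\<dots> = (\<integral>\<^sup>+t. \<integral>\<^sup>+\<theta>. ennreal ((cmod (gelfand N v \<theta> t))\<^sup>2) \<partial>torus \<partial>torus)"
    using P.Fubini'[of "\<lambda>\<theta> t. ennreal ((cmod (gelfand N v \<theta> t))\<^sup>2)"] by (simp add: case_prod_beta')
  also have "\<dots> = (\<integral>\<^sup>+t. ennreal (\<Sum>l\<in>int_cube N. (cmod (v (t + real_vec l)))\<^sup>2) \<partial>torus)"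
    by (simp add: nn[symmetric] si sw)
  also have "\<dots> = ennreal (\<integral>t. (\<Sum>l\<in>int_cube N. (cmod (v (t + real_vec l)))\<^sup>2) \<partial>torus)"
    using square_integrable_shift_torus[OF assms]
    by (intro nn_integral_eq_integral Bochner_Integration.integrable_sum)
       (auto simp: square_integrable_def intro!: AE_I2 sum_nonneg)
  also have "(\<integral>t. (\<Sum>l\<in>int_cube N. (cmod (v (t + real_vec l)))\<^sup>2) \<partial>torus) = sqnorm lborel v"
    unfolding sqnorm_def
    by (rule integral_tiling(1)[symmetric])
       (use v N in \<open>auto simp: square_integrable_def supported_in_def\<close>)
  finally show ?thesis .
qed

lemma nn_integral_sqnorm_fourier:
  assumes v: "square_integrable lborel v" and N: "supported_in N v"
  shows "(\<integral>\<^sup>+\<theta>. ennreal (sqnorm (count_space UNIV) (\<lambda>n. fourier v (\<theta> + real_vec n))) \<partial>torus) =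
    ennreal (sqnorm lborel v)"
  unfolding sqnorm_gelfand(2)[OF assms] by (rule nn_integral_sqnorm_gelfand[OF assms])

lemma measurable_sqnorm_fourier:
  assumes v: "square_integrable lborel v" and N: "supported_in N v"
  shows "(\<lambda>\<theta>. sqnorm (count_space UNIV) (\<lambda>n. fourier v (\<theta> + real_vec n))) \<in> borel_measurable torus"
proof -
  have "v \<in> borel_measurable borel" using v by (simp add: square_integrable_def)
  note measurable_gelfand[OF this, of N, measurable]
  have "(\<lambda>p. (cmod (gelfand N v (fst p) (snd p)))\<^sup>2) \<in> borel_measurable (torus \<Otimes>\<^sub>M torus)"
    by measurable
  then show ?thesis unfolding sqnorm_gelfand(2)[OF assms] unfolding sqnorm_def
    by (intro torus.borel_measurable_lebesgue_integral) (simp add: case_prod_beta')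
qed

lemma supported_in_mono: "supported_in N v \<Longrightarrow> N \<le> N' \<Longrightarrow> supported_in N' v"
  unfolding supported_in_def int_cube_def mem_Collect_eq by (meson order_trans)

lemma gelfand_times_periodic:
  assumes "\<And>t l. W (t + real_vec l) = W t"
  shows "gelfand N (\<lambda>t. W t * v t) \<theta> t = W t * gelfand N v \<theta> t"
  by (simp add: gelfand_def assms sum_distrib_left mult.assoc)

text \<open>Stands in for the fibre operator of W. A combination over several quasimomenta is still
  a single function on the torus, multiplied by the same W; Parseval moves the pointwise bound to
  the coefficients.\<close>

lemma sqnorm_fourier_times_periodic_le:
  assumes v: "square_integrable lborel v" and N: "supported_in N v"
    and W: "W \<in> borel_measurable borel" "\<And>t l. W (t + real_vec l) = W t" "\<And>t. cmod (W t) \<le> \<omega>"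
    and F: "finite F"
  shows "square_integrable lborel (\<lambda>t. W t * v t)" "supported_in N (\<lambda>t. W t * v t)"
    "sqnorm (count_space UNIV) (\<lambda>n. \<Sum>\<theta>\<in>F. \<gamma> \<theta> * fourier (\<lambda>t. W t * v t) (\<theta> + real_vec n))
      \<le> \<omega>\<^sup>2 * sqnorm (count_space UNIV) (\<lambda>n. \<Sum>\<theta>\<in>F. \<gamma> \<theta> * fourier v (\<theta> + real_vec n))"
proof -
  have [measurable]: "v \<in> borel_measurable borel" "W \<in> borel_measurable borel"
    using v W by (auto simp: square_integrable_def)
  have b: "(cmod (W t * z))\<^sup>2 \<le> \<omega>\<^sup>2 * (cmod z)\<^sup>2" for t z
    using power_mono[OF W(3)[of t], of 2] by (simp add: norm_mult power_mult_distrib mult_right_mono)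
  have "integrable lborel (\<lambda>t. (cmod (W t * v t))\<^sup>2)"
  proof (rule Bochner_Integration.integrable_bound)
    show "integrable lborel (\<lambda>t. \<omega>\<^sup>2 * (cmod (v t))\<^sup>2)" using v by (simp add: square_integrable_def)
  qed (use b in auto)
  then show Wv: "square_integrable lborel (\<lambda>t. W t * v t)" by (simp add: square_integrable_def)
  show WN: "supported_in N (\<lambda>t. W t * v t)" using N by (auto simp: supported_in_def)
  define f where "f = (\<lambda>t. \<Sum>\<theta>\<in>F. \<gamma> \<theta> * gelfand N v \<theta> t)"
  have f: "square_integrable torus f"
    unfolding f_def by (intro square_integrable_sum square_integrable_scale square_integrable_gelfand[OF v N])
  have Wf: "(\<lambda>t. W t * f t) = (\<lambda>t. \<Sum>\<theta>\<in>F. \<gamma> \<theta> * gelfand N (\<lambda>t. W t * v t) \<theta> t)"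
    by (simp add: f_def gelfand_times_periodic W sum_distrib_left mult.left_commute)
  have sWf: "square_integrable torus (\<lambda>t. W t * f t)"
    unfolding Wf by (intro square_integrable_sum square_integrable_scale square_integrable_gelfand[OF Wv WN])
  have 1: "ip torus f (echar (real_vec n)) = (\<Sum>\<theta>\<in>F. \<gamma> \<theta> * fourier v (\<theta> + real_vec n))" for n
    unfolding f_def
    by (subst ip_sum_left) (auto simp: ip_scale_left ip_gelfand[OF v N] square_integrable_gelfand[OF v N])
  have 2: "ip torus (\<lambda>t. W t * f t) (echar (real_vec n)) =
      (\<Sum>\<theta>\<in>F. \<gamma> \<theta> * fourier (\<lambda>t. W t * v t) (\<theta> + real_vec n))" for n
    unfolding Wf
    by (subst ip_sum_left) (auto simp: ip_scale_left ip_gelfand[OF Wv WN] square_integrable_gelfand[OF Wv WN])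
  have "sqnorm torus (\<lambda>t. W t * f t) \<le> \<omega>\<^sup>2 * sqnorm torus f"
    unfolding sqnorm_def integral_mult_right_zero[symmetric]
    using f sWf by (intro integral_mono b) (auto simp: square_integrable_def)
  then show "sqnorm (count_space UNIV) (\<lambda>n. \<Sum>\<theta>\<in>F. \<gamma> \<theta> * fourier (\<lambda>t. W t * v t) (\<theta> + real_vec n))
      \<le> \<omega>\<^sup>2 * sqnorm (count_space UNIV) (\<lambda>n. \<Sum>\<theta>\<in>F. \<gamma> \<theta> * fourier v (\<theta> + real_vec n))"
    using parseval_torus(2)[OF f] parseval_torus(2)[OF sWf] by (simp add: 1 2)
qed

section \<open>Kernels of the fibre operators\<close>

text \<open>Cauchy-Schwarz against the geometric weights (1/2)^i, whose sum is the constant 2, at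
  each index; summing over finitely many indices then gives membership and the norm bound. This is
  the quantitative substitute for completeness.\<close>

lemma series_square_integrable:
  fixes d :: "nat \<Rightarrow> 'n::countable \<Rightarrow> complex"
  defines "M \<equiv> count_space (UNIV :: 'n set)"
  assumes d: "\<And>i. square_integrable M (d i)" and s: "summable (\<lambda>i. 2 ^ i * sqnorm M (d i))"
  shows "\<And>n. summable (\<lambda>i. d i n)"
    and "square_integrable M (\<lambda>n. \<Sum>i. d i n)"
    and "sqnorm M (\<lambda>n. \<Sum>i. d i n) \<le> 2 * (\<Sum>i. 2 ^ i * sqnorm M (d i))"
proof -
  have pt: "(cmod (d i n))\<^sup>2 \<le> sqnorm M (d i)" for i n
    using sqnorm_count_space_ge_point[of "d i" n] d unfolding M_def by simp
  have s2: "summable (\<lambda>i. 2 ^ i * (cmod (d i n))\<^sup>2)" for n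
    by (rule summable_comparison_test'[OF s]) (auto intro: mult_left_mono pt simp: abs_mult)
  have abs_s: "summable (\<lambda>i. cmod (d i n))" for n
  proof (rule summable_comparison_test')
    show "summable (\<lambda>i. (1 / 2) ^ i + 2 ^ i * (cmod (d i n))\<^sup>2)"
      by (intro summable_add s2 summable_geometric) simp
    fix i
    have "2 * (sqrt ((1 / 2) ^ i) * (sqrt (2 ^ i) * cmod (d i n))) \<le>
        (sqrt ((1 / 2) ^ i))\<^sup>2 + (sqrt (2 ^ i) * cmod (d i n))\<^sup>2"
      using sum_squares_bound[of "sqrt ((1 / 2) ^ i)" "sqrt (2 ^ i) * cmod (d i n)"] by simp
    moreover have "sqrt ((1 / 2) ^ i) * (sqrt (2 ^ i) * cmod (d i n)) = cmod (d i n)"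
    proof -
      have "sqrt ((1 / 2) ^ i) * sqrt (2 ^ i) = 1"
        by (simp add: real_sqrt_mult[symmetric] power_mult_distrib[symmetric])
      then show ?thesis by (metis mult.assoc mult_1)
    qed
    ultimately have "2 * cmod (d i n) \<le> (1 / 2) ^ i + 2 ^ i * (cmod (d i n))\<^sup>2"
      by (simp add: power_mult_distrib)
    then show "norm (cmod (d i n)) \<le> (1 / 2) ^ i + 2 ^ i * (cmod (d i n))\<^sup>2"
      using norm_ge_zero[of "d i n"] unfolding real_norm_def abs_norm_cancel by linarith
  qed
  then show sd: "summable (\<lambda>i. d i n)" for n by (rule summable_norm_cancel)
  have cs: "(cmod (\<Sum>i. d i n))\<^sup>2 \<le> 2 * (\<Sum>i. 2 ^ i * (cmod (d i n))\<^sup>2)" for n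
  proof -
    have fin: "(cmod (\<Sum>i<k. d i n))\<^sup>2 \<le> 2 * (\<Sum>i. 2 ^ i * (cmod (d i n))\<^sup>2)" for k
    proof -
      have "(cmod (\<Sum>i<k. d i n))\<^sup>2 \<le> (\<Sum>i<k. cmod (d i n))\<^sup>2"
        by (intro power_mono norm_sum) simp
      also have "\<dots> = (\<Sum>i<k. sqrt ((1 / 2) ^ i) * (sqrt (2 ^ i) * cmod (d i n)))\<^sup>2"
      proof -
        have "sqrt ((1 / 2) ^ i) * sqrt (2 ^ i) = 1" for i
          by (simp add: real_sqrt_mult[symmetric] power_mult_distrib[symmetric])
        then show ?thesis by (simp add: mult.assoc[symmetric])
      qed
      also have "\<dots> \<le> (\<Sum>i<k. (sqrt ((1 / 2) ^ i))\<^sup>2) * (\<Sum>i<k. (sqrt (2 ^ i) * cmod (d i n))\<^sup>2)"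
        by (rule Cauchy_Schwarz_ineq_sum)
      also have "\<dots> = (\<Sum>i<k. (1 / 2) ^ i) * (\<Sum>i<k. 2 ^ i * (cmod (d i n))\<^sup>2)"
        by (simp add: power_mult_distrib)
      also have "\<dots> \<le> 2 * (\<Sum>i. 2 ^ i * (cmod (d i n))\<^sup>2)"
      proof (intro mult_mono sum_le_suminf s2)
        have "(\<Sum>i<k. (1 / 2) ^ i) \<le> (\<Sum>i. (1 / 2 :: real) ^ i)"
          by (intro sum_le_suminf summable_geometric) auto
        then show "(\<Sum>i<k. (1 / 2) ^ i) \<le> (2 :: real)" by (simp add: suminf_geometric)
      qed (auto intro!: sum_nonneg)
      finally show ?thesis .
    qed
    have "(\<lambda>k. (cmod (\<Sum>i<k. d i n))\<^sup>2) \<longlonglongrightarrow> (cmod (\<Sum>i. d i n))\<^sup>2"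
      by (intro tendsto_intros summable_LIMSEQ sd)
    then show ?thesis by (rule LIMSEQ_le_const2) (use fin in auto)
  qed
  have "(\<Sum>n\<in>F. (cmod (\<Sum>i. d i n))\<^sup>2) \<le> 2 * (\<Sum>i. 2 ^ i * sqnorm M (d i))" if "finite F" for F
  proof -
    have "(\<Sum>n\<in>F. (cmod (\<Sum>i. d i n))\<^sup>2) \<le> (\<Sum>n\<in>F. 2 * (\<Sum>i. 2 ^ i * (cmod (d i n))\<^sup>2))"
      by (intro sum_mono cs)
    also have "\<dots> = 2 * (\<Sum>n\<in>F. \<Sum>i. 2 ^ i * (cmod (d i n))\<^sup>2)"
      by (rule sum_distrib_left[symmetric])
    also have "(\<Sum>n\<in>F. \<Sum>i. 2 ^ i * (cmod (d i n))\<^sup>2) = (\<Sum>i. \<Sum>n\<in>F. 2 ^ i * (cmod (d i n))\<^sup>2)"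
      by (rule suminf_sum[symmetric]) (rule s2)
    also have "2 * (\<Sum>i. \<Sum>n\<in>F. 2 ^ i * (cmod (d i n))\<^sup>2) \<le> 2 * (\<Sum>i. 2 ^ i * sqnorm M (d i))"
    proof (intro mult_left_mono suminf_le s summable_sum s2)
      show "(\<Sum>n\<in>F. 2 ^ i * (cmod (d i n))\<^sup>2) \<le> 2 ^ i * sqnorm M (d i)" for i
        unfolding sum_distrib_left[symmetric] M_def
        using d[of i] that by (intro mult_left_mono sum_le_sqnorm_count_space) (auto simp: M_def)
    qed simp
    finally show ?thesis .
  qed
  from square_integrable_count_spaceI[OF this]
  show "square_integrable M (\<lambda>n. \<Sum>i. d i n)"
    "sqnorm M (\<lambda>n. \<Sum>i. d i n) \<le> 2 * (\<Sum>i. 2 ^ i * sqnorm M (d i))"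
    unfolding M_def by auto
qed

text \<open>Evaluate the double integral of the indicator of x + t \<eta> in E over x and over t in
  [0,1]. For fixed t translation invariance gives the measure of E, for fixed x countability gives
  0. The unit interval normalises the t-integral.\<close>

lemma null_set_countable_on_lines:
  fixes E :: "'a::euclidean_space set"
  assumes E[measurable]: "E \<in> sets borel" and c: "\<And>x. countable {t::real. x + t *\<^sub>R \<eta> \<in> E}"
  shows "emeasure lborel E = 0"
proof -
  have m: "(\<lambda>p. indicator E (fst p + snd p *\<^sub>R \<eta>) * indicator {0..1::real} (snd p) :: ennreal)
      \<in> borel_measurable ((lborel :: 'a measure) \<Otimes>\<^sub>M (lborel :: real measure))"
    by measurable
  have "(\<integral>\<^sup>+x. indicator E (x + t *\<^sub>R \<eta>) * indicator {0..1::real} t \<partial>lborel) =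
      emeasure lborel E * indicator {0..1::real} t" for t :: real
  proof -
    have "(\<integral>\<^sup>+x. indicator E (x + t *\<^sub>R \<eta>) \<partial>lborel) =
        (\<integral>\<^sup>+x. indicator E x \<partial>distr lborel borel ((+) (t *\<^sub>R \<eta>)))"
      by (subst nn_integral_distr) (auto simp: add.commute)
    also have "\<dots> = emeasure lborel E" by (simp add: lborel_distr_plus)
    finally show ?thesis by (subst nn_integral_multc) auto
  qed
  then have "(\<integral>\<^sup>+t. \<integral>\<^sup>+x. indicator E (x + t *\<^sub>R \<eta>) * indicator {0..1::real} t \<partial>lborel \<partial>lborel) = emeasure lborel E"
    by (simp add: nn_integral_cmult)
  moreover have "(\<integral>\<^sup>+t. \<integral>\<^sup>+x. indicator E (x + t *\<^sub>R \<eta>) * indicator {0..1::real} t \<partial>lborel \<partial>lborel) =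
      (\<integral>\<^sup>+x. \<integral>\<^sup>+t. indicator E (x + t *\<^sub>R \<eta>) * indicator {0..1::real} t \<partial>lborel \<partial>lborel)"
    using lborel_pair.Fubini'[of "\<lambda>x t. indicator E (x + t *\<^sub>R \<eta>) * indicator {0..1::real} t"] m
    by (simp add: case_prod_beta')
  moreover have "(\<integral>\<^sup>+t. indicator E (x + t *\<^sub>R \<eta>) * indicator {0..1::real} t \<partial>lborel) = 0" for x
  proof -
    have "emeasure lborel {t::real. x + t *\<^sub>R \<eta> \<in> E} = 0"
      by (rule emeasure_lborel_countable[OF c])
    then have "AE t in lborel. x + t *\<^sub>R \<eta> \<notin> E"
      by (intro AE_I[where N="{t. x + t *\<^sub>R \<eta> \<in> E}"]) auto
    then have "AE t in lborel. indicator E (x + t *\<^sub>R \<eta>) * indicator {0..1::real} t = (0 :: ennreal)"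
      by eventually_elim simp
    then show ?thesis by (simp add: nn_integral_0_iff_AE)
  qed
  ultimately show ?thesis by simp
qed

text \<open>Keeps the factor of the main term arbitrarily close to 1. The kernel inequality must
  survive the limit with the exact constant \<omega>^2, since it is later weighed against |h| \<ge>
  2 \<omega>.\<close>

lemma cmod_add_square_le_eps:
  assumes "0 < \<epsilon>"
  shows "(cmod (a + b))\<^sup>2 \<le> (1 + \<epsilon>) * (cmod a)\<^sup>2 + (1 + 1 / \<epsilon>) * (cmod b)\<^sup>2"
proof -
  have "(cmod (a + b))\<^sup>2 \<le> (cmod a + cmod b)\<^sup>2"
    by (intro power_mono norm_triangle_ineq) auto
  also have "\<dots> = (cmod a)\<^sup>2 + 2 * (sqrt \<epsilon> * cmod a) * (cmod b / sqrt \<epsilon>) + (cmod b)\<^sup>2"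
    using assms by (simp add: power2_sum)
  also have "\<dots> \<le> (cmod a)\<^sup>2 + ((sqrt \<epsilon> * cmod a)\<^sup>2 + (cmod b / sqrt \<epsilon>)\<^sup>2) + (cmod b)\<^sup>2"
    by (intro add_mono sum_squares_bound) auto
  also have "\<dots> = (1 + \<epsilon>) * (cmod a)\<^sup>2 + (1 + 1 / \<epsilon>) * (cmod b)\<^sup>2"
    using assms by (simp add: power_mult_distrib power_divide algebra_simps)
  finally show ?thesis .
qed

lemma sqnorm_add_le_eps:
  assumes f: "square_integrable M f" and g: "square_integrable M g" and e: "0 < \<epsilon>"
  shows "sqnorm M (\<lambda>x. f x + g x) \<le> (1 + \<epsilon>) * sqnorm M f + (1 + 1 / \<epsilon>) * sqnorm M g"
proof -
  have "sqnorm M (\<lambda>x. f x + g x) \<le> (\<integral>x. (1 + \<epsilon>) * (cmod (f x))\<^sup>2 + (1 + 1 / \<epsilon>) * (cmod (g x))\<^sup>2 \<partial>M)"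
    unfolding sqnorm_def using f g square_integrable_add[OF f g]
    by (intro integral_mono cmod_add_square_le_eps e) (auto simp: square_integrable_def)
  then show ?thesis using f g by (simp add: sqnorm_def square_integrable_def)
qed

lemma sqnorm_sum_tendsto_0:
  assumes f: "\<And>i j. i \<in> F \<Longrightarrow> square_integrable M (f i j)"
    and lim: "\<And>i. i \<in> F \<Longrightarrow> (\<lambda>j::nat. sqnorm M (f i j)) \<longlonglongrightarrow> 0"
  shows "(\<lambda>j. sqnorm M (\<lambda>x. \<Sum>i\<in>F. \<gamma> i * f i j x)) \<longlonglongrightarrow> 0"
  using assms
proof (induction F rule: infinite_finite_induct)
  case (insert i F)
  have sF: "square_integrable M (\<lambda>x. \<Sum>i\<in>F. \<gamma> i * f i j x)" for j
    using insert.prems(1) by (intro square_integrable_sum square_integrable_scale) auto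
  have si: "square_integrable M (\<lambda>x. \<gamma> i * f i j x)" for j
    using insert.prems(1) by (intro square_integrable_scale) auto
  have "(\<lambda>j. sqnorm M (\<lambda>x. \<gamma> i * f i j x + (\<Sum>i\<in>F. \<gamma> i * f i j x))) \<longlonglongrightarrow> 0"
  proof (rule tendsto_sandwich[OF _ _ tendsto_const])
    show "\<forall>\<^sub>F j in sequentially. 0 \<le> sqnorm M (\<lambda>x. \<gamma> i * f i j x + (\<Sum>i\<in>F. \<gamma> i * f i j x))" by simp
    show "\<forall>\<^sub>F j in sequentially. sqnorm M (\<lambda>x. \<gamma> i * f i j x + (\<Sum>i\<in>F. \<gamma> i * f i j x)) \<le>
        2 * ((cmod (\<gamma> i))\<^sup>2 * sqnorm M (f i j)) + 2 * sqnorm M (\<lambda>x. \<Sum>i\<in>F. \<gamma> i * f i j x)"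
      using sqnorm_add_le[OF si sF] by (simp add: sqnorm_scale)
    have "(\<lambda>j. 2 * ((cmod (\<gamma> i))\<^sup>2 * sqnorm M (f i j)) + 2 * sqnorm M (\<lambda>x. \<Sum>i\<in>F. \<gamma> i * f i j x)) \<longlonglongrightarrow>
        2 * ((cmod (\<gamma> i))\<^sup>2 * 0) + 2 * 0"
      using insert by (intro tendsto_intros) auto
    then show "(\<lambda>j. 2 * ((cmod (\<gamma> i))\<^sup>2 * sqnorm M (f i j)) + 2 * sqnorm M (\<lambda>x. \<Sum>i\<in>F. \<gamma> i * f i j x)) \<longlonglongrightarrow> 0"
      by simp
  qed
  then show ?case using insert by simp
qed (simp_all add: sqnorm_def)

lemma finite_bounded_lattice:
  fixes P :: "real ^ 'd \<Rightarrow> real ^ 'd"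
  assumes P: "linear P" "inj P"
  shows "finite {n. norm (P (\<theta> + real_vec n)) \<le> R}"
proof -
  obtain B where B: "0 < B" "\<And>x. B * norm x \<le> norm (P x)"
    using linear_inj_bounded_below_pos[OF P] by blast
  have "{n. norm (P (\<theta> + real_vec n)) \<le> R} \<subseteq> {l :: int ^ 'd. \<forall>i. \<bar>l $ i\<bar> \<le> \<lceil>R / B + norm \<theta>\<rceil>}"
  proof safe
    fix n i assume "norm (P (\<theta> + real_vec n)) \<le> R"
    then have "B * norm (\<theta> + real_vec n) \<le> R" using B(2) order_trans by blast
    then have "norm (\<theta> + real_vec n) \<le> R / B" using B(1) by (simp add: field_simps)
    then have "norm (real_vec n) \<le> R / B + norm \<theta>"
      using norm_triangle_ineq4[of "\<theta> + real_vec n" \<theta>] by simp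
    moreover have "\<bar>real_of_int (n $ i)\<bar> \<le> norm (real_vec n)"
      using component_le_norm_cart[of "real_vec n" i] by simp
    ultimately have "\<bar>real_of_int (n $ i)\<bar> \<le> R / B + norm \<theta>" by linarith
    then show "\<bar>n $ i\<bar> \<le> \<lceil>R / B + norm \<theta>\<rceil>" by linarith
  qed
  then show ?thesis by (rule finite_subset[OF _ finite_bounded_int_vec])
qed

text \<open>
  Along the dual direction of a lattice vector, the complex quasimomentum \<open>\<rho> + \<i>\<tau>\<close> makes the imaginary part
  of the symbol at least \<open>2\<tau>\<pi>\<close> in modulus for every frequency.
\<close>

lemma countable_quasimomenta_on_line:
  fixes P :: "real ^ 'd \<Rightarrow> real ^ 'd" and C :: "real ^ 'd \<Rightarrow> int ^ 'd \<Rightarrow> complex"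
  defines "M \<equiv> count_space (UNIV :: (int ^ 'd) set)"
  assumes P: "linear P" "inj P" and \<eta>: "\<And>\<theta>. P \<eta> \<bullet> P \<theta> = 2 * pi * (\<theta> $ k)" and \<omega>: "0 < \<omega>"
    and C: "\<And>\<theta>. \<theta> \<in> G \<Longrightarrow> square_integrable M (C \<theta>)" "\<And>\<theta>. \<theta> \<in> G \<Longrightarrow> \<exists>n. C \<theta> n \<noteq> 0"
    and le: "\<And>F \<gamma>. finite F \<Longrightarrow> F \<subseteq> G \<Longrightarrow>
      square_integrable M (\<lambda>n. \<Sum>\<theta>\<in>F. \<gamma> \<theta> * (of_real ((norm (P (\<theta> + real_vec n)))\<^sup>2) * C \<theta> n)) \<and>
      sqnorm M (\<lambda>n. \<Sum>\<theta>\<in>F. \<gamma> \<theta> * (of_real ((norm (P (\<theta> + real_vec n)))\<^sup>2) * C \<theta> n))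
        \<le> \<omega>\<^sup>2 * sqnorm M (\<lambda>n. \<Sum>\<theta>\<in>F. \<gamma> \<theta> * C \<theta> n)"
  shows "countable {\<kappa>::real. \<theta>0 + \<kappa> *\<^sub>R \<eta> \<in> G}"
proof -
  define r where "r n = (norm (P (\<theta>0 + real_vec n)))\<^sup>2" for n
  define m where "m n = 2 * pi * ((\<theta>0 + real_vec n) $ k)" for n
  define \<beta> where "\<beta> = (norm (P \<eta>))\<^sup>2"
  have "P \<eta> \<noteq> 0"
  proof
    assume "P \<eta> = 0"
    then have "0 = 2 * pi * ((axis k 1 :: real ^ 'd) $ k)" using \<eta>[of "axis k 1"] by simp
    then show False by (simp add: axis_def)
  qed
  then have \<beta>: "0 < \<beta>" by (simp add: \<beta>_def)
  have \<eta>0: "\<eta> \<noteq> 0" using \<open>P \<eta> \<noteq> 0\<close> linear_0[OF P(1)] by auto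
  \<comment> \<open>Makes m n + \<rho> \<beta> equal to pi (2 \<open>n $ k\<close> + 1), an odd
    multiple of pi and so never smaller than pi in modulus. With \<tau> = (\<omega> + 1) / pi the
    symbol is then at least 2 \<omega> + 2.\<close>
  define \<rho> where "\<rho> = (pi - 2 * pi * (\<theta>0 $ k)) / \<beta>"
  define \<tau> where "\<tau> = (\<omega> + 1) / pi"
  define \<kappa>0 where "\<kappa>0 = Complex \<rho> \<tau>"
  define h where "h = (\<lambda>\<kappa> n. of_real (r n) + 2 * \<kappa> * of_real (m n) + \<kappa>\<^sup>2 * of_real \<beta> :: complex)"
  define \<Lambda> where "\<Lambda> n = 1 + norm (P (\<theta>0 + real_vec n))" for n
  \<comment> \<open>With s the norm of P (\<theta>0 + n), the symbol is at least s^2 - 2 X s - X^2.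
    Beyond \<open>Y\<close> this exceeds s^2 / 4, hence (1 + s)^2 / 16; up to \<open>Y\<close> the
    symbol is at least 1, and 1 / (1 + Y)^2 serves.\<close>
  define X where "X = cmod \<kappa>0 * norm (P \<eta>)"
  define Y where "Y = 1 + 4 * X"
  define \<delta> where "\<delta> = min (1 / 16) (1 / (1 + Y)\<^sup>2)"
  have \<tau>: "0 < \<tau>" using \<omega> by (simp add: \<tau>_def)
  have X0: "0 \<le> X" by (simp add: X_def)
  have mle: "\<bar>m n\<bar> \<le> norm (P \<eta>) * norm (P (\<theta>0 + real_vec n))" for n
    using Cauchy_Schwarz_ineq2[of "P \<eta>" "P (\<theta>0 + real_vec n)"] unfolding \<eta> m_def .
  have h2: "2 * \<omega> + 2 \<le> cmod (h \<kappa>0 n)" for n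
  proof -
    have "m n + \<rho> * \<beta> = pi * (2 * of_int (n $ k) + 1)"
    proof -
      have "\<rho> * \<beta> = pi - 2 * pi * (\<theta>0 $ k)" using \<beta> by (simp add: \<rho>_def)
      then show ?thesis by (simp add: m_def algebra_simps)
    qed
    then have "\<bar>m n + \<rho> * \<beta>\<bar> = pi * \<bar>2 * of_int (n $ k) + 1\<bar>" by (simp add: abs_mult)
    moreover have "1 \<le> \<bar>2 * real_of_int (n $ k) + 1\<bar>"
    proof -
      have "1 \<le> \<bar>2 * n $ k + 1\<bar>" by presburger
      then have "real_of_int 1 \<le> real_of_int \<bar>2 * n $ k + 1\<bar>" by (simp only: of_int_le_iff)
      then show ?thesis by simp
    qed
    ultimately have "pi \<le> \<bar>m n + \<rho> * \<beta>\<bar>" using mult_left_mono[of 1 "\<bar>2 * real_of_int (n $ k) + 1\<bar>" pi] by simp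
    then have "2 * \<tau> * pi \<le> 2 * \<tau> * \<bar>m n + \<rho> * \<beta>\<bar>" using \<tau> by simp
    also have "\<dots> = \<bar>Im (h \<kappa>0 n)\<bar>"
    proof -
      have "Im (h \<kappa>0 n) = 2 * \<tau> * (m n + \<rho> * \<beta>)"
        by (simp add: h_def \<kappa>0_def power2_eq_square algebra_simps)
      then show ?thesis using \<tau> by (simp add: abs_mult)
    qed
    also have "\<dots> \<le> cmod (h \<kappa>0 n)" by (rule abs_Im_le_cmod)
    finally show ?thesis by (simp add: \<tau>_def)
  qed
  have \<delta>: "0 < \<delta>" using X0 by (simp add: \<delta>_def Y_def)
  have hd: "\<delta> * (\<Lambda> n)\<^sup>2 \<le> cmod (h \<kappa>0 n)" for n
  proof -
    define s where "s = norm (P (\<theta>0 + real_vec n))"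
    have s0: "0 \<le> s" by (simp add: s_def)
    have "s\<^sup>2 - 2 * X * s - X\<^sup>2 \<le> cmod (h \<kappa>0 n)"
    proof -
      have "cmod (2 * \<kappa>0 * of_real (m n)) \<le> 2 * X * s"
      proof -
        have "cmod (2 * \<kappa>0 * of_real (m n)) = 2 * cmod \<kappa>0 * \<bar>m n\<bar>" by (simp add: norm_mult)
        also have "\<dots> \<le> 2 * cmod \<kappa>0 * (norm (P \<eta>) * s)" using mle[of n] by (intro mult_left_mono) (auto simp: s_def)
        finally show ?thesis by (simp add: X_def)
      qed
      moreover have "cmod (\<kappa>0\<^sup>2 * of_real \<beta>) = X\<^sup>2"
        by (simp add: norm_mult norm_power X_def \<beta>_def power_mult_distrib)
      moreover have "cmod (complex_of_real (r n)) = s\<^sup>2" by (simp add: r_def s_def norm_power)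
      moreover have "cmod (complex_of_real (r n)) \<le> cmod (h \<kappa>0 n) + cmod (2 * \<kappa>0 * of_real (m n)) + cmod (\<kappa>0\<^sup>2 * of_real \<beta>)"
        using norm_triangle_ineq4[of "h \<kappa>0 n" "2 * \<kappa>0 * of_real (m n) + \<kappa>0\<^sup>2 * of_real \<beta>"]
          norm_triangle_ineq[of "2 * \<kappa>0 * of_real (m n)" "\<kappa>0\<^sup>2 * of_real \<beta>"]
        by (simp add: h_def)
      ultimately show ?thesis by linarith
    qed
    moreover have "\<Lambda> n = 1 + s" by (simp add: \<Lambda>_def s_def)
    moreover have "\<delta> * (1 + s)\<^sup>2 \<le> cmod (h \<kappa>0 n)"
    proof (cases "s \<le> Y")
      case True
      have "\<delta> * (1 + s)\<^sup>2 \<le> 1 / (1 + Y)\<^sup>2 * (1 + Y)\<^sup>2"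
        using True s0 by (intro mult_mono power_mono) (auto simp: \<delta>_def)
      also have "\<dots> = 1" using X0 by (simp add: Y_def)
      finally show ?thesis using h2[of n] \<omega> by linarith
    next
      case False
      then have s1: "1 \<le> s" "4 * X \<le> s" using X0 by (auto simp: Y_def)
      have "\<delta> * (1 + s)\<^sup>2 \<le> 1 / 16 * (2 * s)\<^sup>2"
        using s1 s0 by (intro mult_mono power_mono) (auto simp: \<delta>_def)
      also have "\<dots> = s\<^sup>2 / 4" by (simp add: power_mult_distrib)
      also have "\<dots> \<le> s\<^sup>2 - 2 * X * s - X\<^sup>2"
      proof -
        have "4 * X * s \<le> s * s" using s1 s0 by (intro mult_right_mono) auto
        then have "4 * (X * s) \<le> s\<^sup>2" by (simp add: power2_eq_square)
        moreover have "(4 * X)\<^sup>2 \<le> s\<^sup>2" using s1 X0 by (intro power_mono) auto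
        then have "16 * X\<^sup>2 \<le> s\<^sup>2" by (simp add: power_mult_distrib)
        moreover have "2 * X * s = 2 * (X * s)" "0 \<le> X\<^sup>2" by simp_all
        ultimately show ?thesis by linarith
      qed
      finally show ?thesis using \<open>s\<^sup>2 - 2 * X * s - X\<^sup>2 \<le> cmod (h \<kappa>0 n)\<close> by linarith
    qed
    ultimately show ?thesis by simp
  qed
  have sym: "h (of_real \<kappa>) n = of_real ((norm (P (\<theta>0 + \<kappa> *\<^sub>R \<eta> + real_vec n)))\<^sup>2)" for \<kappa> :: real and n
  proof -
    have "P (\<theta>0 + \<kappa> *\<^sub>R \<eta> + real_vec n) = P (\<theta>0 + real_vec n) + \<kappa> *\<^sub>R P \<eta>"
      using P(1) by (simp add: linear_add linear_cmul algebra_simps)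
    note Peq = this
    have "(norm (P (\<theta>0 + \<kappa> *\<^sub>R \<eta> + real_vec n)))\<^sup>2 = r n + 2 * \<kappa> * m n + \<kappa>\<^sup>2 * \<beta>"
    proof -
      have "(p + \<kappa> *\<^sub>R q) \<bullet> (p + \<kappa> *\<^sub>R q) = p \<bullet> p + 2 * \<kappa> * (q \<bullet> p) + \<kappa>\<^sup>2 * (q \<bullet> q)" for p q :: "real ^ 'd"
        by (simp add: inner_add_left inner_add_right power2_eq_square inner_commute[of p q] algebra_simps)
      then show ?thesis unfolding r_def \<beta>_def m_def \<eta>[symmetric] power2_norm_eq_inner Peq .
    qed
    then show ?thesis by (simp add: h_def)
  qed
  let ?K = "{\<kappa>::real. \<theta>0 + \<kappa> *\<^sub>R \<eta> \<in> G}"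
  define c where "c \<kappa> = C (\<theta>0 + \<kappa> *\<^sub>R \<eta>)" for \<kappa> :: real
  \<comment> \<open>Defined by the pencil equation, which therefore holds trivially; that
    \<open>w\<close> comes from a bounded operator is contained in \<open>combo\<close>.\<close>
  define w where "w \<kappa> n = - (h (of_real \<kappa>) n * c \<kappa> n)" for \<kappa> :: real and n
  have line_inj: "inj (\<lambda>\<kappa>::real. \<theta>0 + \<kappa> *\<^sub>R \<eta>)" using \<eta>0 by (auto simp: inj_def)
  have combo: "square_integrable M (\<lambda>n. \<Sum>\<kappa>\<in>F. \<gamma> \<kappa> * w \<kappa> n) \<and>
      sqnorm M (\<lambda>n. \<Sum>\<kappa>\<in>F. \<gamma> \<kappa> * w \<kappa> n) \<le> \<omega>\<^sup>2 * sqnorm M (\<lambda>n. \<Sum>\<kappa>\<in>F. \<gamma> \<kappa> * c \<kappa> n)"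
    if F: "finite F" "F \<subseteq> ?K" for F \<gamma>
  proof -
    define I where "I = the_inv (\<lambda>\<kappa>::real. \<theta>0 + \<kappa> *\<^sub>R \<eta>)"
    define H where "H = (\<lambda>\<kappa>::real. \<theta>0 + \<kappa> *\<^sub>R \<eta>) ` F"
    have I: "I (\<theta>0 + \<kappa> *\<^sub>R \<eta>) = \<kappa>" for \<kappa> unfolding I_def by (rule the_inv_f_f[OF line_inj])
    have H: "finite H" "H \<subseteq> G" using F by (auto simp: H_def)
    have re: "(\<Sum>\<theta>\<in>H. f \<theta>) = (\<Sum>\<kappa>\<in>F. f (\<theta>0 + \<kappa> *\<^sub>R \<eta>))" for f :: "real ^ 'd \<Rightarrow> complex"
      unfolding H_def by (subst sum.reindex) (auto intro: inj_on_subset[OF line_inj])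
    have 1: "(\<lambda>n. \<Sum>\<theta>\<in>H. \<gamma> (I \<theta>) * (of_real ((norm (P (\<theta> + real_vec n)))\<^sup>2) * C \<theta> n)) =
        (\<lambda>n. - (\<Sum>\<kappa>\<in>F. \<gamma> \<kappa> * w \<kappa> n))"
      unfolding re I by (simp add: w_def c_def sym sum_negf)
    have 2: "(\<lambda>n. \<Sum>\<theta>\<in>H. \<gamma> (I \<theta>) * C \<theta> n) = (\<lambda>n. \<Sum>\<kappa>\<in>F. \<gamma> \<kappa> * c \<kappa> n)"
      unfolding re I by (simp add: c_def)
    have 3: "sqnorm M (\<lambda>n. - f n) = sqnorm M f" "square_integrable M (\<lambda>n. - f n) = square_integrable M f" for f
      by (simp_all add: sqnorm_def square_integrable_def M_def)
    show ?thesis using le[OF H, of "\<lambda>\<theta>. \<gamma> (I \<theta>)"] unfolding 1 2 3 .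
  qed
  show ?thesis
  proof (rule countable_pencil_spectrum[where r=r and m=m and \<beta>=\<beta> and c=c and w=w and \<zeta>=\<kappa>0 and \<Lambda>=\<Lambda>
        and \<omega>=\<omega> and \<delta>=\<delta> and B="norm (P \<eta>)"])
    show "Im \<kappa>0 \<noteq> 0" using \<tau> by (simp add: \<kappa>0_def)
    show "1 \<le> \<Lambda> n" for n by (simp add: \<Lambda>_def)
    show "finite {n. \<Lambda> n \<le> R}" for R
      using finite_bounded_lattice[OF P, of \<theta>0 "R - 1"] by (simp add: \<Lambda>_def algebra_simps)
    show "0 < \<omega>" "0 < \<delta>" by fact+
    show "2 * \<omega> \<le> cmod (of_real (r n) + 2 * \<kappa>0 * of_real (m n) + \<kappa>0\<^sup>2 * of_real \<beta>)" for n
      using h2[of n] by (simp add: h_def)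
    show "\<delta> * (\<Lambda> n)\<^sup>2 \<le> cmod (of_real (r n) + 2 * \<kappa>0 * of_real (m n) + \<kappa>0\<^sup>2 * of_real \<beta>)" for n
      using hd[of n] by (simp add: h_def)
    show "\<bar>m n\<bar> \<le> norm (P \<eta>) * \<Lambda> n" for n
      using mle[of n] by (simp add: \<Lambda>_def distrib_left add_increasing)
    show "square_integrable (count_space UNIV) (c \<kappa>)" "\<exists>n. c \<kappa> n \<noteq> 0" if "\<kappa> \<in> ?K" for \<kappa>
      using C[of "\<theta>0 + \<kappa> *\<^sub>R \<eta>"] that by (auto simp: c_def M_def)
    show "square_integrable (count_space UNIV) (w \<kappa>)" if "\<kappa> \<in> ?K" for \<kappa>
      using combo[of "{\<kappa>}" "\<lambda>_. 1"] that by (simp add: M_def)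
    show "(of_real (r n) + 2 * of_real \<kappa> * of_real (m n) + (of_real \<kappa>)\<^sup>2 * of_real \<beta>) * c \<kappa> n + w \<kappa> n = 0"
      for \<kappa> :: real and n by (simp add: w_def h_def)
    show "sqnorm (count_space UNIV) (\<lambda>n. \<Sum>\<kappa>\<in>F. \<gamma> \<kappa> * w \<kappa> n)
        \<le> \<omega>\<^sup>2 * sqnorm (count_space UNIV) (\<lambda>n. \<Sum>\<kappa>\<in>F. \<gamma> \<kappa> * c \<kappa> n)"
      if "finite F" "F \<subseteq> ?K" for F \<gamma>
      using combo[OF that] by (simp add: M_def)
  qed
qed

text \<open>
  Here \<open>v j\<close> are the cut-off versions of \<open>u\<close>, and \<open>p j\<close>, \<open>q j b\<close> the commutator errors, whose coefficients
  \<open>a b\<close> grow with the frequency. The geometric rates make the coefficients converge in \<open>\<ell>\<^sup>2\<close> for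
  almost every quasimomentum, so that no completeness of \<open>L\<^sup>2\<close> is needed.
\<close>

lemma absence_in_coordinates:
  fixes u W :: "real ^ 'd \<Rightarrow> complex" and P :: "real ^ 'd \<Rightarrow> real ^ 'd"
    and v p :: "nat \<Rightarrow> real ^ 'd \<Rightarrow> complex" and q :: "nat \<Rightarrow> 'b \<Rightarrow> real ^ 'd \<Rightarrow> complex"
    and a :: "'b \<Rightarrow> real ^ 'd \<Rightarrow> complex" and N :: "nat \<Rightarrow> int"
  assumes P: "linear P" "inj P" and \<eta>: "\<And>\<theta>. P \<eta> \<bullet> P \<theta> = 2 * pi * (\<theta> $ k)"
    and \<omega>: "0 < \<omega>"
    and W: "W \<in> borel_measurable borel" "\<And>t l. W (t + real_vec l) = W t" "\<And>t. cmod (W t) \<le> \<omega>"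
    and u: "square_integrable lborel u"
    and B: "finite B"
    and v: "\<And>j. square_integrable lborel (v j)" "\<And>j. supported_in (N j) (v j)"
    and p: "\<And>j. square_integrable lborel (p j)" "\<And>j. supported_in (N j) (p j)"
    and q: "\<And>j b. b \<in> B \<Longrightarrow> square_integrable lborel (q j b)" "\<And>j b. b \<in> B \<Longrightarrow> supported_in (N j) (q j b)"
    and sv: "\<And>j. sqnorm lborel (\<lambda>t. u t - v j t) \<le> (1 / 8) ^ j"
    and sp: "\<And>j. sqnorm lborel (p j) \<le> (1 / 8) ^ j"
    and sq: "\<And>j b. b \<in> B \<Longrightarrow> sqnorm lborel (q j b) \<le> (1 / 8) ^ j"
    and eq: "\<And>j \<theta>. of_real ((norm (P \<theta>))\<^sup>2) * fourier (v j) \<theta> + fourier (\<lambda>t. W t * v j t) \<theta> =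
      fourier (p j) \<theta> + (\<Sum>b\<in>B. a b \<theta> * fourier (q j b) \<theta>)"
  shows "sqnorm lborel u = 0"
proof -
  let ?M = "count_space (UNIV :: (int ^ 'd) set)"
  define S where "S f \<theta> = sqnorm ?M (\<lambda>n. fourier f (\<theta> + real_vec n))" for f and \<theta> :: "real ^ 'd"
  have S0 [simp]: "0 \<le> S f \<theta>" for f \<theta> by (simp add: S_def)
  define d where "d j = (\<lambda>t. v (Suc j) t - v j t)" for j
  have ds: "square_integrable lborel (d j)" for j unfolding d_def by (intro square_integrable_diff v)
  define N' where "N' j = max (N (Suc j)) (N j)" for j
  have dN: "supported_in (N' j) (d j)" for j
    using supported_in_mono[OF v(2)[of j], of "N' j"] supported_in_mono[OF v(2)[of "Suc j"], of "N' j"]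
    by (auto simp: d_def supported_in_def N'_def) (metis diff_zero diff_self)
  have vi: "integrable lborel (v j)" for j by (rule square_integrable_supported_integrable[OF v])
  have dn: "sqnorm lborel (d j) \<le> 4 * (1 / 8) ^ j" for j
  proof -
    have "sqnorm lborel (\<lambda>t. (u t - v j t) + (v (Suc j) t - u t)) \<le>
        2 * sqnorm lborel (\<lambda>t. u t - v j t) + 2 * sqnorm lborel (\<lambda>t. v (Suc j) t - u t)"
      by (intro sqnorm_add_le square_integrable_diff u v)
    also have "sqnorm lborel (\<lambda>t. v (Suc j) t - u t) = sqnorm lborel (\<lambda>t. u t - v (Suc j) t)"
      by (simp add: sqnorm_def norm_minus_commute)
    also have "2 * sqnorm lborel (\<lambda>t. u t - v j t) + 2 * sqnorm lborel (\<lambda>t. u t - v (Suc j) t) \<le>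
        2 * (1 / 8) ^ j + 2 * (1 / 8) ^ Suc j"
      by (intro add_mono mult_left_mono sv) auto
    also have "\<dots> \<le> 4 * (1 / 8) ^ j" by simp
    finally show ?thesis by (simp add: d_def algebra_simps)
  qed
  have Sm[measurable]: "S (v j) \<in> borel_measurable torus" "S (d j) \<in> borel_measurable torus"
    "S (p j) \<in> borel_measurable torus" "b \<in> B \<Longrightarrow> S (q j b) \<in> borel_measurable torus" for j b
    unfolding S_def
    by (rule measurable_sqnorm_fourier[OF v], rule measurable_sqnorm_fourier[OF ds dN],
        rule measurable_sqnorm_fourier[OF p], rule measurable_sqnorm_fourier[OF q])
  have SI: "(\<integral>\<^sup>+\<theta>. ennreal (S f \<theta>) \<partial>torus) = ennreal (sqnorm lborel f)"
    if "square_integrable lborel f" "supported_in N f" for f N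
    unfolding S_def by (rule nn_integral_sqnorm_fourier[OF that])
  \<comment> \<open>The weight 2^j is the one required by \<open>series_square_integrable\<close>.
    Against the rate 8^-j it leaves integrals of order 4^-j, so the sum over j is finite for almost
    every \<theta>, and its finiteness controls every limit below.\<close>
  define g where "g j \<theta> = 2 ^ j * S (d j) \<theta> + S (p j) \<theta> + (\<Sum>b\<in>B. S (q j b) \<theta>)" for j \<theta>
  have g0: "0 \<le> g j \<theta>" for j \<theta> by (simp add: g_def sum_nonneg)
  have gm[measurable]: "g j \<in> borel_measurable torus" for j unfolding g_def by measurable
  define Good where "Good \<theta> \<longleftrightarrow> (\<Sum>j. ennreal (g j \<theta>)) \<noteq> \<infinity>" for \<theta>
  have gI: "(\<integral>\<^sup>+\<theta>. ennreal (g j \<theta>) \<partial>torus) \<le> ennreal ((5 + real (card B)) * (1 / 4) ^ j)" for j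
  proof -
    have "(\<integral>\<^sup>+\<theta>. ennreal (g j \<theta>) \<partial>torus) = (\<integral>\<^sup>+\<theta>. ennreal (2 ^ j) * ennreal (S (d j) \<theta>) + ennreal (S (p j) \<theta>)
        + (\<Sum>b\<in>B. ennreal (S (q j b) \<theta>)) \<partial>torus)"
      by (intro nn_integral_cong) (simp add: g_def ennreal_plus ennreal_mult sum_nonneg)
    also have "\<dots> = ennreal (2 ^ j) * ennreal (sqnorm lborel (d j)) + ennreal (sqnorm lborel (p j)) +
        (\<Sum>b\<in>B. ennreal (sqnorm lborel (q j b)))"
      by (simp del: sum_ennreal add: nn_integral_add nn_integral_cmult nn_integral_sum SI[OF ds dN] SI[OF p] SI[OF q])
    also have "\<dots> = ennreal (2 ^ j * sqnorm lborel (d j) + sqnorm lborel (p j) + (\<Sum>b\<in>B. sqnorm lborel (q j b)))"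
      by (simp add: ennreal_plus ennreal_mult sum_nonneg)
    also have "\<dots> \<le> ennreal ((5 + real (card B)) * (1 / 4) ^ j)"
    proof (rule ennreal_leI)
      have "2 ^ j * sqnorm lborel (d j) \<le> 2 ^ j * (4 * (1 / 8) ^ j)" by (intro mult_left_mono dn) simp
      also have "\<dots> = 4 * (1 / 4) ^ j" by (simp add: power_mult_distrib[symmetric])
      finally have 1: "2 ^ j * sqnorm lborel (d j) \<le> 4 * (1 / 4) ^ j" .
      have le: "(1 / 8) ^ j \<le> (1 / 4 :: real) ^ j" by (intro power_mono) auto
      have 2: "sqnorm lborel (p j) \<le> (1 / 4) ^ j" using sp[of j] le by linarith
      have "(\<Sum>b\<in>B. sqnorm lborel (q j b)) \<le> real (card B) * (1 / 4) ^ j"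
        using sq le by (intro sum_bounded_above) (meson order_trans)
      with 1 2 show "2 ^ j * sqnorm lborel (d j) + sqnorm lborel (p j) + (\<Sum>b\<in>B. sqnorm lborel (q j b))
          \<le> (5 + real (card B)) * (1 / 4) ^ j" by (simp add: distrib_right)
    qed
    finally show ?thesis .
  qed
  have AE_Good: "AE \<theta> in torus. Good \<theta>"
    unfolding Good_def
  proof (rule nn_integral_noteq_infinite)
    have sm: "summable (\<lambda>j. (5 + real (card B)) * (1 / 4 :: real) ^ j)"
      by (intro summable_mult summable_geometric) simp
    have "(\<integral>\<^sup>+\<theta>. (\<Sum>j. ennreal (g j \<theta>)) \<partial>torus) = (\<Sum>j. \<integral>\<^sup>+\<theta>. ennreal (g j \<theta>) \<partial>torus)"
      by (rule nn_integral_suminf) simp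
    also have "\<dots> \<le> (\<Sum>j. ennreal ((5 + real (card B)) * (1 / 4) ^ j))"
      by (intro suminf_le gI) auto
    also have "\<dots> = ennreal (\<Sum>j. (5 + real (card B)) * (1 / 4) ^ j)"
      by (rule suminf_ennreal2) (use sm in auto)
    also have "\<dots> < \<infinity>" by simp
    finally show "(\<integral>\<^sup>+\<theta>. (\<Sum>j. ennreal (g j \<theta>)) \<partial>torus) \<noteq> \<infinity>" by simp
  qed measurable
  \<comment> \<open>The limit is taken frequency by frequency. \<open>e J\<close> is the tail of the
    telescoping series, so that the limit is also reached in the square-summable norm.\<close>
  define c where "c \<theta> n = lim (\<lambda>j. fourier (v j) (\<theta> + real_vec n))" for \<theta> and n :: "int ^ 'd"
  define e where "e J \<theta> n = c \<theta> n - fourier (v J) (\<theta> + real_vec n)" for J \<theta> and n :: "int ^ 'd"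
  have good: "(\<lambda>j. fourier (v j) (\<theta> + real_vec n)) \<longlonglongrightarrow> c \<theta> n"
    "square_integrable ?M (e J \<theta>)"
    "sqnorm ?M (e J \<theta>) \<le> 2 * (\<Sum>i. 2 ^ i * S (d (i + J)) \<theta>)"
    "summable (\<lambda>i. 2 ^ i * S (d (i + J)) \<theta>)"
    "(\<lambda>J. sqnorm ?M (e J \<theta>)) \<longlonglongrightarrow> 0"
    "(\<lambda>j. fourier (p j) (\<theta> + real_vec n)) \<longlonglongrightarrow> 0"
    "b \<in> B \<Longrightarrow> (\<lambda>j. fourier (q j b) (\<theta> + real_vec n)) \<longlonglongrightarrow> 0"
    if "Good \<theta>" for \<theta> n J b
  proof -
    have sg: "summable (\<lambda>j. g j \<theta>)"
      by (rule summable_suminf_not_top[of "\<lambda>j. g j \<theta>"]) (use g0 that in \<open>auto simp: Good_def\<close>)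
    have sgs: "summable (\<lambda>i. g (i + J) \<theta>)" for J
      by (rule summable_ignore_initial_segment[OF sg])
    have Sd: "2 ^ j * S (d j) \<theta> \<le> g j \<theta>" and Sp: "S (p j) \<theta> \<le> g j \<theta>" for j
      by (simp_all add: g_def sum_nonneg add_nonneg_nonneg)
    have Sq: "S (q j b) \<theta> \<le> g j \<theta>" if "b \<in> B" for j b
    proof -
      have "S (q j b) \<theta> \<le> (\<Sum>b\<in>B. S (q j b) \<theta>)" using that B by (intro member_le_sum) auto
      moreover have "0 \<le> 2 ^ j * S (d j) \<theta> + S (p j) \<theta>" by simp
      ultimately show ?thesis unfolding g_def by linarith
    qed
    define D where "D j n = fourier (d j) (\<theta> + real_vec n)" for j and n :: "int ^ 'd"
    have D: "D j n = fourier (v (Suc j)) (\<theta> + real_vec n) - fourier (v j) (\<theta> + real_vec n)" for j n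
      unfolding D_def d_def by (rule fourier_diff[OF vi vi])
    have DS: "square_integrable ?M (D j)" "sqnorm ?M (D j) = S (d j) \<theta>" for j
      unfolding D_def S_def using sqnorm_gelfand(1)[OF ds dN] by auto
    have bnd: "2 ^ i * S (d (i + J)) \<theta> \<le> (1 / 2) ^ J * g (i + J) \<theta>" for i J
    proof -
      have "2 ^ i * S (d (i + J)) \<theta> = (1 / 2) ^ J * (2 ^ (i + J) * S (d (i + J)) \<theta>)"
        by (simp add: power_add power_one_over)
      also have "\<dots> \<le> (1 / 2) ^ J * g (i + J) \<theta>" by (intro mult_left_mono Sd) simp
      finally show ?thesis .
    qed
    have sgJ: "summable (\<lambda>i. (1 / 2) ^ J * g (i + J) \<theta>)" for J
      by (intro summable_mult sgs)
    show sJ: "summable (\<lambda>i. 2 ^ i * S (d (i + J)) \<theta>)" for J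
      by (rule summable_comparison_test'[OF sgJ[of J]]) (use bnd in auto)
    have sJ': "summable (\<lambda>i. 2 ^ i * sqnorm ?M (D (i + J)))" for J using sJ by (simp add: DS)
    note ser = series_square_integrable[of "\<lambda>i. D (i + _)", OF DS(1) sJ']
    have tele: "(\<Sum>i<k. D (i + J) n) = fourier (v (k + J)) (\<theta> + real_vec n) - fourier (v J) (\<theta> + real_vec n)" for k J n
      by (induction k) (auto simp: D)
    have lim: "(\<lambda>j. fourier (v j) (\<theta> + real_vec n)) \<longlonglongrightarrow> (\<Sum>i. D i n) + fourier (v 0) (\<theta> + real_vec n)" for n
    proof -
      have "(\<lambda>k. (\<Sum>i<k. D (i + 0) n) + fourier (v 0) (\<theta> + real_vec n)) \<longlonglongrightarrow> (\<Sum>i. D (i + 0) n) + fourier (v 0) (\<theta> + real_vec n)"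
        by (intro tendsto_intros summable_LIMSEQ ser(1)[of 0])
      then show ?thesis unfolding tele by simp
    qed
    then show cl: "(\<lambda>j. fourier (v j) (\<theta> + real_vec n)) \<longlonglongrightarrow> c \<theta> n" for n
      unfolding c_def by (metis limI)
    have eJ: "e J \<theta> = (\<lambda>n. \<Sum>i. D (i + J) n)" for J
    proof
      fix n
      have "(\<lambda>k. \<Sum>i<k. D (i + J) n) \<longlonglongrightarrow> (\<Sum>i. D (i + J) n)" by (rule summable_LIMSEQ[OF ser(1)])
      moreover have "(\<lambda>k. \<Sum>i<k. D (i + J) n) \<longlonglongrightarrow> e J \<theta> n"
        unfolding tele e_def by (intro tendsto_intros LIMSEQ_ignore_initial_segment cl)
      ultimately show "e J \<theta> n = (\<Sum>i. D (i + J) n)" by (rule LIMSEQ_unique[symmetric])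
    qed
    show "square_integrable ?M (e J \<theta>)" unfolding eJ by (rule ser(2))
    show le: "sqnorm ?M (e J \<theta>) \<le> 2 * (\<Sum>i. 2 ^ i * S (d (i + J)) \<theta>)" for J
      using ser(3)[of J] unfolding eJ by (simp add: DS)
    show "(\<lambda>J. sqnorm ?M (e J \<theta>)) \<longlonglongrightarrow> 0"
    proof (rule tendsto_sandwich[OF _ _ tendsto_const])
      show "\<forall>\<^sub>F J in sequentially. 0 \<le> sqnorm ?M (e J \<theta>)" by simp
      show "\<forall>\<^sub>F J in sequentially. sqnorm ?M (e J \<theta>) \<le> 2 * ((1 / 2) ^ J * (\<Sum>i. g i \<theta>))"
      proof (intro always_eventually allI)
        fix J
        have "(\<Sum>i. 2 ^ i * S (d (i + J)) \<theta>) \<le> (\<Sum>i. (1 / 2) ^ J * g (i + J) \<theta>)"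
          by (intro suminf_le bnd sJ sgJ)
        also have "\<dots> = (1 / 2) ^ J * (\<Sum>i. g (i + J) \<theta>)" by (intro suminf_mult sgs)
        also have "(\<Sum>i. g (i + J) \<theta>) = (\<Sum>i. g i \<theta>) - (\<Sum>i<J. g i \<theta>)"
          by (rule suminf_minus_initial_segment[OF sg])
        also have "(1 / 2) ^ J * ((\<Sum>i. g i \<theta>) - (\<Sum>i<J. g i \<theta>)) \<le> (1 / 2) ^ J * (\<Sum>i. g i \<theta>)"
          using g0 by (intro mult_left_mono) (auto intro: sum_nonneg)
        finally show "sqnorm ?M (e J \<theta>) \<le> 2 * ((1 / 2) ^ J * (\<Sum>i. g i \<theta>))" using le[of J] by linarith
      qed
      have "(\<lambda>J. 2 * ((1 / 2) ^ J * (\<Sum>i. g i \<theta>))) \<longlonglongrightarrow> 2 * (0 * (\<Sum>i. g i \<theta>))"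
        by (intro tendsto_intros LIMSEQ_power_zero) simp
      then show "(\<lambda>J. 2 * ((1 / 2) ^ J * (\<Sum>i. g i \<theta>))) \<longlonglongrightarrow> 0" by simp
    qed
    have small: "(\<lambda>j. fourier (f j) (\<theta> + real_vec n)) \<longlonglongrightarrow> 0"
      if f: "\<And>j. square_integrable lborel (f j)" "\<And>j. supported_in (N j) (f j)" and le: "\<And>j. S (f j) \<theta> \<le> g j \<theta>" for f
    proof -
      have "(\<lambda>j. (cmod (fourier (f j) (\<theta> + real_vec n)))\<^sup>2) \<longlonglongrightarrow> 0"
      proof (rule tendsto_sandwich[OF _ _ tendsto_const summable_LIMSEQ_zero[OF sg]])
        show "\<forall>\<^sub>F j in sequentially. (cmod (fourier (f j) (\<theta> + real_vec n)))\<^sup>2 \<le> g j \<theta>"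
        proof (intro always_eventually allI)
          fix j
          have "(cmod (fourier (f j) (\<theta> + real_vec n)))\<^sup>2 \<le> S (f j) \<theta>"
            unfolding S_def by (rule sqnorm_count_space_ge_point[OF sqnorm_gelfand(1)[OF f]])
          then show "(cmod (fourier (f j) (\<theta> + real_vec n)))\<^sup>2 \<le> g j \<theta>" using le[of j] by linarith
        qed
      qed simp
      from tendsto_real_sqrt[OF this] show ?thesis by (simp add: tendsto_norm_zero_iff)
    qed
    show "(\<lambda>j. fourier (p j) (\<theta> + real_vec n)) \<longlonglongrightarrow> 0" by (rule small[OF p Sp])
    show "(\<lambda>j. fourier (q j b) (\<theta> + real_vec n)) \<longlonglongrightarrow> 0" if "b \<in> B" by (rule small[OF q[OF that] Sq[OF that]])
  qed
  define G where "G = {\<theta> \<in> unit_cube. Good \<theta> \<and> (\<exists>n. c \<theta> n \<noteq> 0)}"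
  have cs: "square_integrable ?M (c \<theta>)" if "Good \<theta>" for \<theta>
  proof -
    have "square_integrable ?M (\<lambda>n. e 0 \<theta> n + fourier (v 0) (\<theta> + real_vec n))"
      by (intro square_integrable_add good that sqnorm_gelfand(1)[OF v])
    then show ?thesis by (simp add: e_def)
  qed
  have le: "square_integrable ?M (\<lambda>n. \<Sum>\<theta>\<in>F. \<gamma> \<theta> * (of_real ((norm (P (\<theta> + real_vec n)))\<^sup>2) * c \<theta> n)) \<and>
      sqnorm ?M (\<lambda>n. \<Sum>\<theta>\<in>F. \<gamma> \<theta> * (of_real ((norm (P (\<theta> + real_vec n)))\<^sup>2) * c \<theta> n))
        \<le> \<omega>\<^sup>2 * sqnorm ?M (\<lambda>n. \<Sum>\<theta>\<in>F. \<gamma> \<theta> * c \<theta> n)" if F: "finite F" "F \<subseteq> G" for F \<gamma>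
  proof -
    have Fg: "Good \<theta>" if "\<theta> \<in> F" for \<theta> using that F(2) by (auto simp: G_def)
    define X where "X = sqnorm ?M (\<lambda>n. \<Sum>\<theta>\<in>F. \<gamma> \<theta> * c \<theta> n)"
    define Y where "Y j = sqnorm ?M (\<lambda>n. \<Sum>\<theta>\<in>F. (- \<gamma> \<theta>) * e j \<theta> n)" for j
    have Y: "Y \<longlonglongrightarrow> 0" unfolding Y_def
      by (rule sqnorm_sum_tendsto_0) (use Fg good in auto)
    \<comment> \<open>For a fixed frequency the coefficients \<open>a b\<close> are fixed numbers,
      so the commutator terms vanish in the limit although \<open>a b\<close> grows with the
      frequency.\<close>
    have wl: "(\<lambda>j. fourier (\<lambda>t. W t * v j t) (\<theta> + real_vec n)) \<longlonglongrightarrow>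
        - (of_real ((norm (P (\<theta> + real_vec n)))\<^sup>2) * c \<theta> n)" if "\<theta> \<in> F" for \<theta> n
    proof -
      have "(\<lambda>j. fourier (p j) (\<theta> + real_vec n) + (\<Sum>b\<in>B. a b (\<theta> + real_vec n) * fourier (q j b) (\<theta> + real_vec n))
          - of_real ((norm (P (\<theta> + real_vec n)))\<^sup>2) * fourier (v j) (\<theta> + real_vec n)) \<longlonglongrightarrow>
          0 + (\<Sum>b\<in>B. a b (\<theta> + real_vec n) * 0) - of_real ((norm (P (\<theta> + real_vec n)))\<^sup>2) * c \<theta> n"
        by (intro tendsto_intros good Fg that)
      moreover have "fourier (p j) (\<theta> + real_vec n) + (\<Sum>b\<in>B. a b (\<theta> + real_vec n) * fourier (q j b) (\<theta> + real_vec n))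
          - of_real ((norm (P (\<theta> + real_vec n)))\<^sup>2) * fourier (v j) (\<theta> + real_vec n) =
          fourier (\<lambda>t. W t * v j t) (\<theta> + real_vec n)" for j
        using eq[of "\<theta> + real_vec n" j] by (simp add: algebra_simps)
      ultimately show ?thesis by simp
    qed
    have fin: "(\<Sum>n\<in>I. (cmod (\<Sum>\<theta>\<in>F. \<gamma> \<theta> * (of_real ((norm (P (\<theta> + real_vec n)))\<^sup>2) * c \<theta> n)))\<^sup>2) \<le> \<omega>\<^sup>2 * X"
      if I: "finite I" for I
    proof -
      define A where "A = (\<Sum>n\<in>I. (cmod (\<Sum>\<theta>\<in>F. \<gamma> \<theta> * (of_real ((norm (P (\<theta> + real_vec n)))\<^sup>2) * c \<theta> n)))\<^sup>2)"
      \<comment> \<open>Only finitely many frequencies enter \<open>A\<close>, so pointwise limits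
        suffice on the left; on the right j tends to infinity for fixed \<epsilon>, which removes
        \<open>Y\<close>, and \<epsilon> tends to 0 afterwards.\<close>
      have Aeps: "A \<le> \<omega>\<^sup>2 * ((1 + \<epsilon>) * X)" if \<epsilon>: "0 < \<epsilon>" for \<epsilon>
      proof (rule LIMSEQ_le)
        have "(\<lambda>j. \<Sum>n\<in>I. (cmod (\<Sum>\<theta>\<in>F. \<gamma> \<theta> * fourier (\<lambda>t. W t * v j t) (\<theta> + real_vec n)))\<^sup>2) \<longlonglongrightarrow>
          (\<Sum>n\<in>I. (cmod (\<Sum>\<theta>\<in>F. \<gamma> \<theta> * - (of_real ((norm (P (\<theta> + real_vec n)))\<^sup>2) * c \<theta> n)))\<^sup>2)"
          by (intro tendsto_intros wl)
        then show "(\<lambda>j. \<Sum>n\<in>I. (cmod (\<Sum>\<theta>\<in>F. \<gamma> \<theta> * fourier (\<lambda>t. W t * v j t) (\<theta> + real_vec n)))\<^sup>2) \<longlonglongrightarrow> A"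
          by (simp add: A_def sum_negf)
        have "(\<lambda>j. \<omega>\<^sup>2 * ((1 + \<epsilon>) * X + (1 + 1 / \<epsilon>) * Y j)) \<longlonglongrightarrow> \<omega>\<^sup>2 * ((1 + \<epsilon>) * X + (1 + 1 / \<epsilon>) * 0)"
          by (intro tendsto_intros Y)
        then show "(\<lambda>j. \<omega>\<^sup>2 * ((1 + \<epsilon>) * X + (1 + 1 / \<epsilon>) * Y j)) \<longlonglongrightarrow> \<omega>\<^sup>2 * ((1 + \<epsilon>) * X)" by simp
        have "(\<Sum>n\<in>I. (cmod (\<Sum>\<theta>\<in>F. \<gamma> \<theta> * fourier (\<lambda>t. W t * v j t) (\<theta> + real_vec n)))\<^sup>2)
            \<le> \<omega>\<^sup>2 * ((1 + \<epsilon>) * X + (1 + 1 / \<epsilon>) * Y j)" for j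
        proof -
          note fw = sqnorm_fourier_times_periodic_le[OF v(1)[of j] v(2)[of j] W F(1)]
          have "(\<Sum>n\<in>I. (cmod (\<Sum>\<theta>\<in>F. \<gamma> \<theta> * fourier (\<lambda>t. W t * v j t) (\<theta> + real_vec n)))\<^sup>2)
              \<le> sqnorm ?M (\<lambda>n. \<Sum>\<theta>\<in>F. \<gamma> \<theta> * fourier (\<lambda>t. W t * v j t) (\<theta> + real_vec n))"
            by (intro sum_le_sqnorm_count_space I square_integrable_sum square_integrable_scale
                sqnorm_gelfand(1)[OF fw(1,2)])
          also have "\<dots> \<le> \<omega>\<^sup>2 * sqnorm ?M (\<lambda>n. \<Sum>\<theta>\<in>F. \<gamma> \<theta> * fourier (v j) (\<theta> + real_vec n))"
            by (rule fw(3))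
          also have "(\<lambda>n. \<Sum>\<theta>\<in>F. \<gamma> \<theta> * fourier (v j) (\<theta> + real_vec n)) =
              (\<lambda>n. (\<Sum>\<theta>\<in>F. \<gamma> \<theta> * c \<theta> n) + (\<Sum>\<theta>\<in>F. (- \<gamma> \<theta>) * e j \<theta> n))"
            by (simp add: e_def sum.distrib[symmetric] algebra_simps)
          also have "\<omega>\<^sup>2 * sqnorm ?M \<dots> \<le> \<omega>\<^sup>2 * ((1 + \<epsilon>) * X + (1 + 1 / \<epsilon>) * Y j)"
            unfolding X_def Y_def
            by (intro mult_left_mono sqnorm_add_le_eps square_integrable_sum square_integrable_scale cs good Fg \<epsilon>) auto
          finally show ?thesis .
        qed
        then show "\<exists>N. \<forall>j\<ge>N. (\<Sum>n\<in>I. (cmod (\<Sum>\<theta>\<in>F. \<gamma> \<theta> * fourier (\<lambda>t. W t * v j t) (\<theta> + real_vec n)))\<^sup>2)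
            \<le> \<omega>\<^sup>2 * ((1 + \<epsilon>) * X + (1 + 1 / \<epsilon>) * Y j)" by blast
      qed
      have "A \<le> \<omega>\<^sup>2 * ((1 + 0) * X)"
      proof (rule LIMSEQ_le_const)
        show "(\<lambda>k. \<omega>\<^sup>2 * ((1 + inverse (real (Suc k))) * X)) \<longlonglongrightarrow> \<omega>\<^sup>2 * ((1 + 0) * X)"
          by (intro tendsto_intros LIMSEQ_inverse_real_of_nat)
        show "\<exists>N. \<forall>k\<ge>N. A \<le> \<omega>\<^sup>2 * ((1 + inverse (real (Suc k))) * X)" using Aeps by auto
      qed
      then show ?thesis by (simp add: A_def)
    qed
    show ?thesis using square_integrable_count_spaceI[OF fin] unfolding X_def by auto
  qed
  have cm[measurable]: "(\<lambda>\<theta>. c \<theta> n) \<in> borel_measurable torus" for n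
  proof -
    have "(\<lambda>\<theta>. fourier (v j) (\<theta> + real_vec n)) \<in> borel_measurable torus" for j
    proof -
      have [measurable]: "v j \<in> borel_measurable borel" using v(1)[of j] by (simp add: square_integrable_def)
      show ?thesis by (intro measurable_torusI) measurable
    qed
    then show ?thesis unfolding c_def by (rule borel_measurable_lim_metric)
  qed
  have Gs: "G \<in> sets borel"
  proof -
    have "{\<theta> \<in> space torus. Good \<theta> \<and> (\<exists>n. c \<theta> n \<noteq> 0)} \<in> sets torus"
      unfolding Good_def by measurable
    then show ?thesis by (simp add: G_def space_torus torus_def sets_restrict_space_iff)
  qed
  have "emeasure lborel G = 0"
  proof (rule null_set_countable_on_lines[OF Gs, of \<eta>])
    show "countable {t::real. x + t *\<^sub>R \<eta> \<in> G}" for x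
    proof (rule countable_quasimomenta_on_line[OF P \<eta> \<omega>, of G c])
      show "square_integrable ?M (c \<theta>)" "\<exists>n. c \<theta> n \<noteq> 0" if "\<theta> \<in> G" for \<theta>
        using that cs by (auto simp: G_def)
    qed (rule le)
  qed
  then have "AE \<theta> in torus. \<theta> \<notin> G"
    using Gs unfolding torus_def
    by (subst AE_restrict_space_iff) (auto intro!: AE_I[where N=G])
  with AE_Good have AE0: "AE \<theta> in torus. Good \<theta> \<and> (\<forall>n. c \<theta> n = 0)"
    using AE_space by eventually_elim (auto simp: G_def space_torus)
  \<comment> \<open>Once the limit \<open>c\<close> vanishes almost everywhere, the tail
    \<open>e J\<close> is minus the transform of \<open>v J\<close>, so the tail bound integrates to
    a bound on \<open>v J\<close> itself. The series sums to 8 (4/3) 8^-J, rounded up to 16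
    8^-J.\<close>
  have vn: "sqnorm lborel (v J) \<le> 16 * (1 / 8) ^ J" for J
  proof -
    have sm: "summable (\<lambda>i. 8 * (1 / 8) ^ J * (1 / 4 :: real) ^ i)"
      by (intro summable_mult summable_geometric) simp
    have "ennreal (sqnorm lborel (v J)) = (\<integral>\<^sup>+\<theta>. ennreal (S (v J) \<theta>) \<partial>torus)" by (rule SI[OF v, symmetric])
    also have "\<dots> \<le> (\<integral>\<^sup>+\<theta>. (\<Sum>i. ennreal (2 * 2 ^ i) * ennreal (S (d (i + J)) \<theta>)) \<partial>torus)"
    proof (rule nn_integral_mono_AE)
      show "AE \<theta> in torus. ennreal (S (v J) \<theta>) \<le> (\<Sum>i. ennreal (2 * 2 ^ i) * ennreal (S (d (i + J)) \<theta>))"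
        using AE0
      proof eventually_elim
        case (elim \<theta>)
        then have g: "Good \<theta>" and c0: "\<And>n. c \<theta> n = 0" by auto
        have "S (v J) \<theta> = sqnorm ?M (e J \<theta>)" by (simp add: S_def e_def c0 sqnorm_def)
        also have "\<dots> \<le> 2 * (\<Sum>i. 2 ^ i * S (d (i + J)) \<theta>)" by (rule good(3)[OF g])
        also have "\<dots> = (\<Sum>i. 2 * 2 ^ i * S (d (i + J)) \<theta>)"
          using suminf_mult[OF good(4)[OF g], of 2 J] by (simp add: mult.assoc)
        finally have "ennreal (S (v J) \<theta>) \<le> ennreal (\<Sum>i. 2 * 2 ^ i * S (d (i + J)) \<theta>)" by (rule ennreal_leI)
        also have "\<dots> = (\<Sum>i. ennreal (2 * 2 ^ i * S (d (i + J)) \<theta>))"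
          using summable_mult[OF good(4)[OF g], of 2 J] by (intro suminf_ennreal2[symmetric]) (auto simp: mult.assoc)
        also have "\<dots> = (\<Sum>i. ennreal (2 * 2 ^ i) * ennreal (S (d (i + J)) \<theta>))" by (simp add: ennreal_mult)
        finally show ?case .
      qed
    qed
    also have "\<dots> = (\<Sum>i. ennreal (2 * 2 ^ i) * ennreal (sqnorm lborel (d (i + J))))"
      by (subst nn_integral_suminf) (auto simp: nn_integral_cmult SI[OF ds dN])
    also have "\<dots> \<le> (\<Sum>i. ennreal (8 * (1 / 8) ^ J * (1 / 4) ^ i))"
    proof (intro suminf_le)
      fix i
      have "2 * 2 ^ i * sqnorm lborel (d (i + J)) \<le> 2 * 2 ^ i * (4 * (1 / 8) ^ (i + J))"
        by (intro mult_left_mono dn) simp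
      also have "\<dots> = 8 * (1 / 8) ^ J * (2 ^ i * (1 / 8) ^ i)" by (simp add: power_add)
      also have "2 ^ i * (1 / 8) ^ i = (1 / 4 :: real) ^ i" by (simp add: power_mult_distrib[symmetric])
      finally show "ennreal (2 * 2 ^ i) * ennreal (sqnorm lborel (d (i + J))) \<le> ennreal (8 * (1 / 8) ^ J * (1 / 4) ^ i)"
        by (simp add: ennreal_mult[symmetric] ennreal_leI)
    qed auto
    also have "\<dots> = ennreal (\<Sum>i. 8 * (1 / 8) ^ J * (1 / 4) ^ i)" by (rule suminf_ennreal2) (use sm in auto)
    also have "(\<Sum>i. 8 * (1 / 8) ^ J * (1 / 4 :: real) ^ i) = 8 * (1 / 8) ^ J * (4 / 3)"
      by (subst suminf_mult) (auto simp: suminf_geometric intro!: summable_geometric)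
    finally have "sqnorm lborel (v J) \<le> 8 * (1 / 8) ^ J * (4 / 3)" by (simp add: ennreal_le_iff)
    moreover have "0 \<le> (1 / 8 :: real) ^ J" by simp
    ultimately show ?thesis by linarith
  qed
  have bnd: "sqnorm lborel u \<le> 34 * (1 / 8) ^ J" for J
  proof -
    have "sqnorm lborel (\<lambda>t. (u t - v J t) + v J t) \<le> 2 * sqnorm lborel (\<lambda>t. u t - v J t) + 2 * sqnorm lborel (v J)"
      by (intro sqnorm_add_le square_integrable_diff u v)
    then show ?thesis using sv[of J] vn[of J] by simp
  qed
  have lim: "(\<lambda>J. 34 * (1 / 8 :: real) ^ J) \<longlonglongrightarrow> 34 * 0"
    by (intro tendsto_intros LIMSEQ_power_zero) simp
  have "sqnorm lborel u \<le> 34 * 0" by (rule LIMSEQ_le_const[OF lim]) (use bnd in blast)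
  then show ?thesis using sqnorm_nonneg[of lborel u] by simp
qed

section \<open>Test functions\<close>

lemma pderiv_alongI:
  assumes "\<And>x. (f has_derivative f' x) (at x)"
  shows "pderiv_along b f = (\<lambda>x. f' x b)"
  unfolding pderiv_along_def using frechet_derivative_at[OF assms] by metis

lemma differentiable_has_derivative:
  "f differentiable (at x) \<Longrightarrow> (f has_derivative frechet_derivative f (at x)) (at x)"
  by (rule frechet_derivative_works[THEN iffD1])

lemma C_k_SucD: "f \<in> C_k (Suc k) \<Longrightarrow> f \<in> C_k k"
proof (induction k arbitrary: f)
  case 0
  then show ?case by (auto intro: continuous_at_imp_continuous_on differentiable_imp_continuous_within)
next
  case (Suc k)
  have "(\<forall>x. f differentiable (at x)) \<and> (\<forall>b\<in>Basis. pderiv_along b f \<in> C_k (Suc k))"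
    using Suc.prems unfolding C_k.simps(2)[of "Suc k"] mem_Collect_eq .
  then have f: "\<forall>x. f differentiable (at x)" and b: "\<forall>b\<in>Basis. pderiv_along b f \<in> C_k (Suc k)"
    by blast+
  then have "\<forall>b\<in>Basis. pderiv_along b f \<in> C_k k" using Suc.IH by blast
  with f show ?case unfolding C_k.simps(2) by blast
qed

lemma C_k_const: "(\<lambda>x. c) \<in> C_k k"
proof (induction k arbitrary: c)
  case (Suc k)
  have "pderiv_along b (\<lambda>x. c) = (\<lambda>x. 0)" for b :: 'a by (rule pderiv_alongI) (rule has_derivative_const)
  then show ?case using Suc by simp
qed simp

lemma pderiv_along_add:
  assumes "\<forall>x. f differentiable (at x)" "\<forall>x. g differentiable (at x)"
  shows "pderiv_along b (\<lambda>x. f x + g x) = (\<lambda>x. pderiv_along b f x + pderiv_along b g x)"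
  unfolding pderiv_along_def[of b f] pderiv_along_def[of b g]
  by (rule pderiv_alongI) (intro has_derivative_add differentiable_has_derivative; simp add: assms)

lemma pderiv_along_mult:
  assumes "\<forall>x. f differentiable (at x)" "\<forall>x. g differentiable (at x)"
  shows "pderiv_along b (\<lambda>x. f x * g x) = (\<lambda>x. f x * pderiv_along b g x + pderiv_along b f x * g x)"
  unfolding pderiv_along_def[of b f] pderiv_along_def[of b g]
  by (rule pderiv_alongI) (intro has_derivative_mult differentiable_has_derivative; simp add: assms)

lemma C_k_add: "f \<in> C_k k \<Longrightarrow> g \<in> C_k k \<Longrightarrow> (\<lambda>x. f x + g x) \<in> C_k k"
proof (induction k arbitrary: f g)
  case 0
  then show ?case by (auto intro: continuous_on_add)
next
  case (Suc k)
  then show ?case by (auto simp: pderiv_along_add intro: differentiable_add)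
qed

lemma C_k_mult: "f \<in> C_k k \<Longrightarrow> g \<in> C_k k \<Longrightarrow> (\<lambda>x. f x * g x) \<in> C_k k"
proof (induction k arbitrary: f g)
  case 0
  then show ?case by (auto intro: continuous_on_mult)
next
  case (Suc k)
  have d: "\<forall>x. f differentiable (at x)" "\<forall>x. g differentiable (at x)" using Suc.prems by auto
  have "pderiv_along b (\<lambda>x. f x * g x) \<in> C_k k" if "b \<in> Basis" for b
    unfolding pderiv_along_mult[OF d] using that Suc.prems
    by (intro C_k_add Suc.IH C_k_SucD[OF Suc.prems(1)] C_k_SucD[OF Suc.prems(2)]) auto
  then show ?case using d by auto
qed

lemma pderiv_along_const: "pderiv_along b (\<lambda>x. c) = (\<lambda>x. 0)"
  by (rule pderiv_alongI) (rule has_derivative_const)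

lemma pderiv_along_cmult:
  assumes "\<forall>x. f differentiable (at x)"
  shows "pderiv_along b (\<lambda>x. c * f x) = (\<lambda>x. c * pderiv_along b f x)"
  by (subst pderiv_along_mult) (auto simp: assms pderiv_along_const)

lemma C_k_prod: "(\<And>i. i \<in> I \<Longrightarrow> f i \<in> C_k k) \<Longrightarrow> (\<lambda>x. \<Prod>i\<in>I. f i x) \<in> C_k k"
  by (induction I rule: infinite_finite_induct) (auto intro: C_k_const C_k_mult)

lemma pderiv_along_dilation:
  assumes "\<forall>x. f differentiable (at x)"
  shows "pderiv_along b (\<lambda>x. f (r *\<^sub>R x)) = (\<lambda>x. of_real r * pderiv_along b f (r *\<^sub>R x))"
    and "(\<lambda>x. f (r *\<^sub>R x)) differentiable (at x)"
proof -
  have *: "((\<lambda>x. f (r *\<^sub>R x)) has_derivative (\<lambda>h. frechet_derivative f (at (r *\<^sub>R x)) (r *\<^sub>R h))) (at x)" for x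
  proof -
    have "((\<lambda>x. r *\<^sub>R x) has_derivative (\<lambda>h. r *\<^sub>R h)) (at x)" by (auto intro!: derivative_eq_intros)
    moreover have "(f has_derivative frechet_derivative f (at (r *\<^sub>R x))) (at (r *\<^sub>R x))"
      using assms by (intro differentiable_has_derivative) simp
    ultimately show ?thesis by (rule has_derivative_compose)
  qed
  have "linear (frechet_derivative f (at y))" for y
    using differentiable_has_derivative[of f y] assms has_derivative_linear by blast
  then show "pderiv_along b (\<lambda>x. f (r *\<^sub>R x)) = (\<lambda>x. of_real r * pderiv_along b f (r *\<^sub>R x))"
    unfolding pderiv_along_def[of b f]
    by (subst pderiv_alongI[OF *]) (simp add: linear_cmul scaleR_conv_of_real)
  show "(\<lambda>x. f (r *\<^sub>R x)) differentiable (at x)" using * differentiableI by blast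
qed

lemma C_k_dilation: "f \<in> C_k k \<Longrightarrow> (\<lambda>x. f (r *\<^sub>R x)) \<in> C_k k"
proof (induction k arbitrary: f)
  case 0
  then show ?case by (auto intro!: continuous_on_compose2[of UNIV f] continuous_intros)
next
  case (Suc k)
  then have d: "\<forall>x. f differentiable (at x)" by simp
  have "pderiv_along b (\<lambda>x. f (r *\<^sub>R x)) \<in> C_k k" if "b \<in> Basis" for b
    unfolding pderiv_along_dilation(1)[OF d] using Suc.prems that
    by (intro C_k_mult C_k_const Suc.IH) auto
  then show ?case using pderiv_along_dilation(2)[OF d] by simp
qed

text \<open>The sequence \<open>g\<close> lists all derivatives of the profile \<open>g 0\<close>.
  With m arbitrary the induction on k passes from \<open>g m\<close> to \<open>g (Suc m)\<close> and
  never needs their formulas.\<close>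

lemma C_k_profile:
  fixes g :: "nat \<Rightarrow> real \<Rightarrow> real" and e :: "'a::euclidean_space"
  assumes g: "\<And>m t. (g m has_real_derivative g (Suc m) t) (at t)"
  shows "(\<lambda>x. complex_of_real (g m (a * (x \<bullet> e) + c))) \<in> C_k k"
proof (induction k arbitrary: m)
  have D: "((\<lambda>x. complex_of_real (g m (a * (x \<bullet> e) + c))) has_derivative
      (\<lambda>h. of_real (a * (h \<bullet> e)) * of_real (g (Suc m) (a * (x \<bullet> e) + c)))) (at x)" for x :: 'a and m
  proof -
    have "((\<lambda>x. a * (x \<bullet> e) + c) has_derivative (\<lambda>h. a * (h \<bullet> e))) (at x)"
      by (auto intro!: derivative_eq_intros)
    moreover have "(g m has_derivative (\<lambda>h. g (Suc m) (a * (x \<bullet> e) + c) * h)) (at (a * (x \<bullet> e) + c))"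
      using g[of m "a * (x \<bullet> e) + c"] by (simp add: has_field_derivative_def)
    ultimately have "((\<lambda>x. g m (a * (x \<bullet> e) + c)) has_derivative
        (\<lambda>h. g (Suc m) (a * (x \<bullet> e) + c) * (a * (h \<bullet> e)))) (at x)"
      by (rule has_derivative_compose)
    from has_derivative_of_real[OF this] show ?thesis by (simp add: mult.commute)
  qed
  {
    case 0
    show ?case unfolding C_k.simps mem_Collect_eq
      by (rule continuous_at_imp_continuous_on) (rule ballI, rule has_derivative_continuous[OF D])
  next
    case (Suc k)
    have "pderiv_along b (\<lambda>x. complex_of_real (g m (a * (x \<bullet> e) + c))) \<in> C_k k" for b
      unfolding pderiv_alongI[OF D] by (intro C_k_mult C_k_const Suc.IH)
    moreover have "(\<lambda>x. complex_of_real (g m (a * (x \<bullet> e) + c))) differentiable (at x)" for x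
      using D differentiableI by blast
    ultimately show ?case by simp
  }
qed

text \<open>Kept in the original coordinates, where the weak equation lives. At \<xi> = P \<theta>
  and x = A t, with P dual to A up to 2 pi, it becomes \<open>echar (- \<theta>) t\<close>.\<close>

definition wave :: "'a::euclidean_space \<Rightarrow> 'a \<Rightarrow> complex" where
  "wave \<xi> x = cis (- (\<xi> \<bullet> x))"

lemma wave_has_derivative:
  "(wave \<xi> has_derivative (\<lambda>h. - \<i> * of_real (\<xi> \<bullet> h) * wave \<xi> x)) (at x)"
proof -
  have 1: "((\<lambda>x. \<i> * complex_of_real (- (\<xi> \<bullet> x))) has_derivative (\<lambda>h. \<i> * complex_of_real (- (\<xi> \<bullet> h)))) (at x)"
    by (auto intro!: derivative_eq_intros)
  have 2: "(exp has_derivative (*) (exp (\<i> * complex_of_real (- (\<xi> \<bullet> x))))) (at (\<i> * complex_of_real (- (\<xi> \<bullet> x))))"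
    using DERIV_exp[of "\<i> * complex_of_real (- (\<xi> \<bullet> x))"] unfolding has_field_derivative_def .
  from has_derivative_compose[OF 1 2]
  show ?thesis unfolding wave_def[abs_def] cis_conv_exp by (simp add: mult.commute)
qed

lemma differentiable_wave: "wave \<xi> differentiable (at x)"
  using wave_has_derivative differentiableI by blast

lemma pderiv_along_wave: "pderiv_along b (wave \<xi>) = (\<lambda>x. - \<i> * of_real (\<xi> \<bullet> b) * wave \<xi> x)"
  by (rule pderiv_alongI) (rule wave_has_derivative)

lemma C_k_wave: "wave \<xi> \<in> C_k k"
proof (induction k)
  case 0
  show ?case unfolding C_k.simps mem_Collect_eq
    by (rule continuous_at_imp_continuous_on) (rule ballI, rule has_derivative_continuous[OF wave_has_derivative])
next
  case (Suc k)
  have "pderiv_along b (wave \<xi>) \<in> C_k k" for b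
    unfolding pderiv_along_wave by (intro C_k_mult C_k_const Suc)
  then show ?case by (simp add: differentiable_wave)
qed

section \<open>A smooth bump function\<close>

primrec flat_poly :: "nat \<Rightarrow> real poly" where
  "flat_poly 0 = 1"
| "flat_poly (Suc m) = [:0, 0, 1:] * (flat_poly m - pderiv (flat_poly m))"

text \<open>The m-th derivative of exp (-1/t) extended by 0. With y = 1/t, differentiating p(y) exp
  (-y) gives y^2 (p(y) - p'(y)) exp (-y), which is the recursion of
  \<open>flat_poly\<close>.\<close>

definition flat :: "nat \<Rightarrow> real \<Rightarrow> real" where
  "flat m t = (if t \<le> 0 then 0 else poly (flat_poly m) (1 / t) * exp (- (1 / t)))"

lemma poly_times_exp_tendsto_0: "((\<lambda>x. poly p x * exp (- x)) \<longlongrightarrow> (0::real)) at_top"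
proof -
  have "((\<lambda>x. \<Sum>i\<le>degree p. coeff p i * (x ^ i / exp x)) \<longlongrightarrow> (\<Sum>i\<le>degree p. coeff p i * 0)) at_top"
    by (intro tendsto_intros tendsto_power_div_exp_0)
  moreover have "poly p x * exp (- x) = (\<Sum>i\<le>degree p. coeff p i * (x ^ i / exp x))" for x
    by (simp add: poly_altdef sum_distrib_right exp_minus divide_inverse mult.assoc)
  ultimately show ?thesis by simp
qed

lemma flat_has_derivative: "(flat m has_real_derivative flat (Suc m) t) (at t)"
proof (cases t "0 :: real" rule: linorder_cases)
  case less
  have "((\<lambda>_. 0) has_real_derivative 0) (at t)" by simp
  then have "(flat m has_real_derivative 0) (at t)"
    by (rule has_field_derivative_transform_within_open[where S="{..<0}"]) (use less in \<open>auto simp: flat_def\<close>)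
  then show ?thesis using less by (simp add: flat_def)
next
  case greater
  have "((\<lambda>t. poly (flat_poly m) (1 / t) * exp (- (1 / t))) has_real_derivative
      poly (flat_poly (Suc m)) (1 / t) * exp (- (1 / t))) (at t)"
  proof -
    have inv: "((\<lambda>t. 1 / t) has_real_derivative - (1 / t\<^sup>2)) (at t)"
      using greater by (auto intro!: derivative_eq_intros simp: power2_eq_square)
    have 1: "((\<lambda>t. poly (flat_poly m) (1 / t)) has_real_derivative
        poly (pderiv (flat_poly m)) (1 / t) * - (1 / t\<^sup>2)) (at t)"
      by (rule DERIV_chain2[OF poly_DERIV inv])
    have 2: "((\<lambda>t. exp (- (1 / t))) has_real_derivative exp (- (1 / t)) * (1 / t\<^sup>2)) (at t)"
      using DERIV_chain2[OF DERIV_exp DERIV_minus[OF inv]] by simp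
    show ?thesis
      by (rule DERIV_cong[OF DERIV_mult[OF 1 2]]) (simp add: algebra_simps power2_eq_square)
  qed
  then have "(flat m has_real_derivative poly (flat_poly (Suc m)) (1 / t) * exp (- (1 / t))) (at t)"
    by (rule has_field_derivative_transform_within_open[where S="{0<..}"]) (use greater in \<open>auto simp: flat_def\<close>)
  then show ?thesis using greater by (simp add: flat_def)
next
  case equal
  \<comment> \<open>The difference quotient at 0. From the right, h = 1/x turns it into x p(x) exp
    (-x) as x tends to infinity.\<close>
  have "((\<lambda>h. flat m h / h) \<longlongrightarrow> 0) (at 0)"
  proof (rule filterlim_split_at)
    have "\<forall>\<^sub>F h in at_left 0. flat m h / h = 0"
      by (auto simp: eventually_at_filter flat_def)
    then show "((\<lambda>h. flat m h / h) \<longlongrightarrow> 0) (at_left 0)"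
      by (rule tendsto_eventually)
    have "((\<lambda>x. flat m (inverse x) / inverse x) \<longlongrightarrow> 0) at_top"
    proof (rule Lim_transform_eventually)
      show "((\<lambda>x. poly ([:0, 1:] * flat_poly m) x * exp (- x)) \<longlongrightarrow> (0::real)) at_top"
        by (rule poly_times_exp_tendsto_0)
      show "\<forall>\<^sub>F x in at_top. poly ([:0, 1:] * flat_poly m) x * exp (- x) = flat m (inverse x) / inverse x"
        using eventually_gt_at_top[of 0] by eventually_elim (auto simp: flat_def field_simps)
    qed
    then show "((\<lambda>h. flat m h / h) \<longlongrightarrow> 0) (at_right 0)"
      by (simp add: filterlim_at_right_to_top)
  qed
  then show ?thesis using equal by (simp add: has_field_derivative_iff flat_def)
qed

text \<open>The factor exp 2 compensates the two values exp (-1) at the origin, so that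
  \<open>bump\<close> is 1 there and the dilated cut-offs converge pointwise to 1. The factors are
  written in the affine form of \<open>C_k_profile\<close>.\<close>

definition bump :: "'a::euclidean_space \<Rightarrow> complex" where
  "bump x = (\<Prod>b\<in>Basis. of_real (exp 2) * of_real (flat 0 (1 * (x \<bullet> b) + 1)) * of_real (flat 0 ((- 1) * (x \<bullet> b) + 1)))"

lemma C_k_bump: "bump \<in> C_k k"
  unfolding bump_def[abs_def] by (intro C_k_prod C_k_mult C_k_const C_k_profile flat_has_derivative)

lemma bump_0: "bump 0 = 1"
  by (simp add: bump_def flat_def flip: of_real_mult exp_add)

lemma bump_support: "bump x \<noteq> 0 \<Longrightarrow> x \<in> cbox (- One) One"
  unfolding bump_def flat_def mem_box by (auto split: if_splits)

lemma pderiv_along_eq_0: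
  assumes "open S" "x \<in> S" "\<And>y. y \<in> S \<Longrightarrow> f y = 0"
  shows "pderiv_along b f x = 0"
proof -
  have "(f has_derivative (\<lambda>_. 0)) (at x)"
    by (rule has_derivative_transform_within_open[OF has_derivative_const assms(1,2)]) (simp add: assms(3))
  then show ?thesis unfolding pderiv_along_def by (metis frechet_derivative_at)
qed

lemma pderiv_along_support:
  assumes "\<And>x. f x \<noteq> 0 \<Longrightarrow> x \<in> K" "closed K" "pderiv_along b f x \<noteq> 0"
  shows "x \<in> K"
  using pderiv_along_eq_0[of "- K" x f b] assms by (auto simp: open_closed)

lemma test_functionsI:
  assumes "\<And>k. f \<in> C_k k" "compact K" "\<And>x. f x \<noteq> 0 \<Longrightarrow> x \<in> K"
  shows "f \<in> test_functions"
proof -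
  have "closure {x. f x \<noteq> 0} \<subseteq> K"
    using assms(2,3) by (intro closure_minimal compact_imp_closed) auto
  then have "compact (closure {x. f x \<noteq> 0})"
    using assms(2) by (metis closed_closure compact_Int_closed inf_absorb2)
  then show ?thesis using assms(1) by (simp add: test_functions_def)
qed

lemma C_k_pderiv: "f \<in> C_k (Suc k) \<Longrightarrow> b \<in> Basis \<Longrightarrow> pderiv_along b f \<in> C_k k"
  by simp

lemma C_k_differentiable: "f \<in> C_k (Suc k) \<Longrightarrow> \<forall>x. f differentiable (at x)"
  by simp

lemma C_k_continuous: "f \<in> C_k k \<Longrightarrow> continuous_on UNIV f"
  by (induction k) (auto intro: continuous_at_imp_continuous_on differentiable_imp_continuous_within)

lemma test_functions_pderiv:
  assumes "f \<in> test_functions" "b \<in> Basis"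
  shows "pderiv_along b f \<in> test_functions"
proof (rule test_functionsI)
  show "pderiv_along b f \<in> C_k k" for k
    using assms by (intro C_k_pderiv) (auto simp: test_functions_def simp del: C_k.simps)
  show "compact (closure {x. f x \<noteq> 0})" using assms by (simp add: test_functions_def)
  show "x \<in> closure {x. f x \<noteq> 0}" if "pderiv_along b f x \<noteq> 0" for x
    by (rule pderiv_along_support[OF subsetD[OF closure_subset] _ that]) auto
qed

lemma integrable_times_compact_support:
  fixes u f :: "'a::euclidean_space \<Rightarrow> complex"
  assumes "locally_integrable u" "f \<in> test_functions"
  shows "integrable lebesgue (\<lambda>x. u x * f x)"
proof -
  define K where "K = closure {x. f x \<noteq> 0}"
  have K1: "compact K" using assms unfolding K_def test_functions_def by blast
  have K2: "x \<in> K" if "f x \<noteq> 0" for x unfolding K_def by (rule subsetD[OF closure_subset]) (simp add: that)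
  note K = K1 K2
  have cf: "continuous_on UNIV f" using assms C_k_continuous[of f 0] unfolding test_functions_def by blast
  obtain B where B: "\<And>x. x \<in> K \<Longrightarrow> cmod (f x) \<le> B"
    using compact_imp_bounded[OF compact_continuous_image[OF continuous_on_subset[OF cf] K(1)]]
    by (auto simp: bounded_iff)
  have u: "integrable lebesgue (\<lambda>x. indicator K x *\<^sub>R u x)"
    using assms(1) K(1) by (simp add: locally_integrable_def set_integrable_def)
  have fm: "f \<in> borel_measurable lebesgue"
    using borel_measurable_continuous_onI[OF cf] by (simp add: measurable_completion)
  have "integrable lebesgue (\<lambda>x. (indicator K x *\<^sub>R u x) * f x)"
  proof (rule Bochner_Integration.integrable_bound)
    show "integrable lebesgue (\<lambda>x. B * norm (indicator K x *\<^sub>R u x))"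
      using u by (intro integrable_mult_right integrable_norm)
    show "(\<lambda>x. (indicator K x *\<^sub>R u x) * f x) \<in> borel_measurable lebesgue"
      by (intro borel_measurable_times borel_measurable_integrable[OF u] fm)
    show "AE x in lebesgue. norm ((indicator K x *\<^sub>R u x) * f x) \<le> norm (B * norm (indicator K x *\<^sub>R u x))"
    proof (rule AE_I2)
      fix x
      show "norm ((indicator K x *\<^sub>R u x) * f x) \<le> norm (B * norm (indicator K x *\<^sub>R u x))"
        using B[of x] mult_right_mono[of "cmod (f x)" "\<bar>B\<bar>" "cmod (u x)"]
        by (auto simp: indicator_def norm_mult abs_mult mult.commute)
    qed
  qed
  moreover have "(\<lambda>x. (indicator K x *\<^sub>R u x) * f x) = (\<lambda>x. u x * f x)"
    using K(2) by (auto simp: indicator_def fun_eq_iff)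
  ultimately show ?thesis by simp
qed

section \<open>Testing the eigenvalue equation with modulated cut-offs\<close>

definition lap :: "('a::euclidean_space \<Rightarrow> complex) \<Rightarrow> 'a \<Rightarrow> complex" where
  "lap f x = (\<Sum>b\<in>Basis. pderiv_along b (pderiv_along b f) x)"

text \<open>Both derivatives are moved to the test function, using the definition of the weak
  derivative once with \<open>pderiv_along b f\<close> and once with \<open>f\<close>; the two signs
  cancel.\<close>

lemma weak_eigen_equation:
  assumes S: "(u, \<lambda>x. z * u x) \<in> schroedinger V" and f: "f \<in> test_functions"
    and V: "V \<in> borel_measurable lebesgue"
  shows "(\<integral>x. u x * lap f x \<partial>lebesgue) = (\<integral>x. (of_real (V x) - z) * u x * f x \<partial>lebesgue)"
proof -
  obtain w where w: "weak_laplacian u w" "AE x in lebesgue. z * u x = - w x + complex_of_real (V x) * u x"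
    using S by (auto simp: schroedinger_def)
  obtain g h where gh: "\<And>b. b \<in> Basis \<Longrightarrow> weak_pderiv b u (g b)" "\<And>b. b \<in> Basis \<Longrightarrow> weak_pderiv b (g b) (h b)"
    and wh: "AE x in lebesgue. w x = (\<Sum>b\<in>Basis. h b x)"
    using w(1) by (auto simp: weak_laplacian_def)
  have parts: "(\<integral>x. u x * pderiv_along b (pderiv_along b f) x \<partial>lebesgue) = (\<integral>x. h b x * f x \<partial>lebesgue)"
    if b: "b \<in> Basis" for b
    using gh[OF b] f test_functions_pderiv[OF f b] by (simp add: weak_pderiv_def)
  have hl: "locally_integrable (h b)" and ul: "locally_integrable u" if "b \<in> Basis" for b
    using gh[OF that] by (auto simp: weak_pderiv_def)
  have "(\<integral>x. u x * lap f x \<partial>lebesgue) = (\<Sum>b\<in>Basis. \<integral>x. u x * pderiv_along b (pderiv_along b f) x \<partial>lebesgue)"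
    unfolding lap_def sum_distrib_left
    by (intro Bochner_Integration.integral_sum integrable_times_compact_support ul test_functions_pderiv f)
  also have "\<dots> = (\<Sum>b\<in>Basis. \<integral>x. h b x * f x \<partial>lebesgue)" by (intro sum.cong refl parts)
  also have "\<dots> = (\<integral>x. (\<Sum>b\<in>Basis. h b x * f x) \<partial>lebesgue)"
    by (intro Bochner_Integration.integral_sum[symmetric] integrable_times_compact_support hl f)
  also have "\<dots> = (\<integral>x. (of_real (V x) - z) * u x * f x \<partial>lebesgue)"
  proof (rule integral_cong_AE)
    have int: "integrable lebesgue (\<lambda>x. \<Sum>b\<in>Basis. h b x * f x)"
      by (intro Bochner_Integration.integrable_sum integrable_times_compact_support hl f)
    show "(\<lambda>x. \<Sum>b\<in>Basis. h b x * f x) \<in> borel_measurable lebesgue"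
      using int by (rule borel_measurable_integrable)
    show ae: "AE x in lebesgue. (\<Sum>b\<in>Basis. h b x * f x) = (of_real (V x) - z) * u x * f x"
      using w(2) wh
    proof eventually_elim
      case (elim x)
      then have "(\<Sum>b\<in>Basis. h b x) = (of_real (V x) - z) * u x" by (simp add: left_diff_distrib)
      then show ?case by (simp add: sum_distrib_right[symmetric])
    qed
    show "(\<lambda>x. (of_real (V x) - z) * u x * f x) \<in> borel_measurable lebesgue"
    proof -
      have [measurable]: "f \<in> borel_measurable lebesgue"
      proof -
        have cf: "continuous_on UNIV f" using f C_k_continuous[of f 0] unfolding test_functions_def by blast
        show ?thesis using borel_measurable_continuous_onI[OF cf] by (simp add: measurable_completion)
      qed
      have [measurable]: "u \<in> borel_measurable lebesgue" using S
        by (auto simp: schroedinger_def numeral_2_eq_2 L2_def)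
      note V[measurable]
      show ?thesis by measurable
    qed
  qed
  finally show ?thesis .
qed

text \<open>The terms containing derivatives of \<phi> are the commutator. The cross term is linear
  in \<xi>; this is the source of the coefficients that grow with the frequency.\<close>

lemma lap_times_wave:
  assumes \<phi>: "\<phi> \<in> C_k 2"
  shows "lap (\<lambda>x. \<phi> x * wave \<xi> x) x =
    lap \<phi> x * wave \<xi> x - 2 * \<i> * (\<Sum>b\<in>Basis. of_real (\<xi> \<bullet> b) * (pderiv_along b \<phi> x * wave \<xi> x))
      - of_real ((norm \<xi>)\<^sup>2) * (\<phi> x * wave \<xi> x)"
proof -
  have d1: "\<forall>x. \<phi> differentiable (at x)" using \<phi> by (simp add: numeral_2_eq_2)
  have d2: "\<forall>x. pderiv_along b \<phi> differentiable (at x)" if "b \<in> Basis" for b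
    using \<phi> that by (simp add: numeral_2_eq_2)
  have dw: "\<forall>x. wave \<xi> differentiable (at x)" by (simp add: differentiable_wave)
  have dcw: "\<forall>x. (\<lambda>x. c * wave \<xi> x) differentiable (at x)" for c
    by (simp add: differentiable_wave differentiable_mult)
  have pcw: "pderiv_along b (\<lambda>x. c * wave \<xi> x) = (\<lambda>x. c * (- \<i> * of_real (\<xi> \<bullet> b) * wave \<xi> x))" for c b
    unfolding pderiv_along_cmult[OF dw] pderiv_along_wave ..
  have "pderiv_along b (pderiv_along b (\<lambda>x. \<phi> x * wave \<xi> x)) x =
      pderiv_along b (pderiv_along b \<phi>) x * wave \<xi> x
      - 2 * \<i> * (of_real (\<xi> \<bullet> b) * (pderiv_along b \<phi> x * wave \<xi> x))
      - of_real ((\<xi> \<bullet> b)\<^sup>2) * (\<phi> x * wave \<xi> x)" if b: "b \<in> Basis" for b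
  proof -
    have 1: "pderiv_along b (\<lambda>x. \<phi> x * wave \<xi> x) =
        (\<lambda>x. \<phi> x * ((- \<i> * of_real (\<xi> \<bullet> b)) * wave \<xi> x) + pderiv_along b \<phi> x * wave \<xi> x)"
      unfolding pderiv_along_mult[OF d1 dw] pderiv_along_wave ..
    have 2: "pderiv_along b (\<lambda>x. \<phi> x * ((- \<i> * of_real (\<xi> \<bullet> b)) * wave \<xi> x) + pderiv_along b \<phi> x * wave \<xi> x) =
        (\<lambda>x. pderiv_along b (\<lambda>x. \<phi> x * ((- \<i> * of_real (\<xi> \<bullet> b)) * wave \<xi> x)) x
          + pderiv_along b (\<lambda>x. pderiv_along b \<phi> x * wave \<xi> x) x)"
      by (rule pderiv_along_add) (use d1 d2[OF b] dw dcw in \<open>auto intro!: differentiable_mult\<close>)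
    show ?thesis
      unfolding 1 2 pderiv_along_mult[OF d1 dcw] pderiv_along_mult[OF d2[OF b] dw] pcw pderiv_along_wave
      by (simp add: power2_eq_square algebra_simps)
  qed
  note terms = this
  have "lap (\<lambda>x. \<phi> x * wave \<xi> x) x = (\<Sum>b\<in>Basis. pderiv_along b (pderiv_along b \<phi>) x * wave \<xi> x
      - 2 * \<i> * (of_real (\<xi> \<bullet> b) * (pderiv_along b \<phi> x * wave \<xi> x))
      - of_real ((\<xi> \<bullet> b)\<^sup>2) * (\<phi> x * wave \<xi> x))"
    unfolding lap_def by (intro sum.cong refl terms)
  also have "\<dots> = lap \<phi> x * wave \<xi> x - 2 * \<i> * (\<Sum>b\<in>Basis. of_real (\<xi> \<bullet> b) * (pderiv_along b \<phi> x * wave \<xi> x))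
      - of_real (\<Sum>b\<in>Basis. (\<xi> \<bullet> b)\<^sup>2) * (\<phi> x * wave \<xi> x)"
    unfolding lap_def by (simp only: sum_subtractf sum_distrib_left sum_distrib_right of_real_sum)
  also have "(\<Sum>b\<in>Basis. (\<xi> \<bullet> b)\<^sup>2) = (norm \<xi>)\<^sup>2"
  proof -
    have "(\<Sum>b\<in>Basis. (\<xi> \<bullet> b)\<^sup>2) = (\<Sum>b\<in>Basis. (\<xi> \<bullet> b) * (\<xi> \<bullet> b))"
      by (intro sum.cong refl power2_eq_square)
    also have "\<dots> = \<xi> \<bullet> \<xi>" by (rule euclidean_inner[symmetric])
    also have "\<dots> = (norm \<xi>)\<^sup>2" by (rule power2_norm_eq_inner[symmetric])
    finally show ?thesis .
  qed
  finally show ?thesis .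
qed

lemma test_function_dilation:
  assumes f: "f \<in> test_functions" and r: "r \<noteq> 0"
  shows "(\<lambda>x. f (r *\<^sub>R x)) \<in> test_functions"
proof (rule test_functionsI)
  show "(\<lambda>x. f (r *\<^sub>R x)) \<in> C_k k" for k using f by (intro C_k_dilation) (simp add: test_functions_def)
  have "compact (closure {x. f x \<noteq> 0})" using f by (simp add: test_functions_def)
  then show "compact ((\<lambda>x. (1 / r) *\<^sub>R x) ` closure {x. f x \<noteq> 0})"
    by (intro compact_continuous_image continuous_intros)
  fix x assume "f (r *\<^sub>R x) \<noteq> 0"
  then have "r *\<^sub>R x \<in> closure {x. f x \<noteq> 0}" by (intro subsetD[OF closure_subset]) simp
  then show "x \<in> (\<lambda>x. (1 / r) *\<^sub>R x) ` closure {x. f x \<noteq> 0}"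
    by (rule rev_image_eqI) (simp add: r)
qed

lemma test_function_mult_C_k:
  assumes f: "f \<in> test_functions" and g: "\<And>k. g \<in> C_k k"
  shows "(\<lambda>x. f x * g x) \<in> test_functions"
proof (rule test_functionsI)
  show "(\<lambda>x. f x * g x) \<in> C_k k" for k using f g by (intro C_k_mult) (auto simp: test_functions_def)
  show "compact (closure {x. f x \<noteq> 0})" using f by (simp add: test_functions_def)
  show "x \<in> closure {x. f x \<noteq> 0}" if "f x * g x \<noteq> 0" for x
    using that by (intro subsetD[OF closure_subset]) auto
qed

lemma test_function_bump: "bump \<in> test_functions"
  by (rule test_functionsI[OF C_k_bump compact_cbox bump_support])

lemma test_functions_lap:
  assumes "f \<in> test_functions"
  shows "lap f \<in> test_functions"
proof -
  have zero: "(\<lambda>x. 0) \<in> test_functions" by (rule test_functionsI[of _ "{}"]) (auto simp: C_k_const simp del: C_k.simps)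
  have add: "(\<lambda>x. f x + g x) \<in> test_functions" if "f \<in> test_functions" "g \<in> test_functions" for f g
  proof (rule test_functionsI[of _ "closure {x. f x \<noteq> 0} \<union> closure {x. g x \<noteq> 0}"])
    show "(\<lambda>x. f x + g x) \<in> C_k k" for k using that by (intro C_k_add) (auto simp: test_functions_def)
    show "compact (closure {x. f x \<noteq> 0} \<union> closure {x. g x \<noteq> 0})"
      using that by (intro compact_Un) (auto simp: test_functions_def)
    show "x \<in> closure {x. f x \<noteq> 0} \<union> closure {x. g x \<noteq> 0}" if "f x + g x \<noteq> 0" for x
      using that subsetD[OF closure_subset, of x "{x. f x \<noteq> 0}"] subsetD[OF closure_subset, of x "{x. g x \<noteq> 0}"]
      by (cases "f x = 0") auto
  qed
  have "(\<lambda>x. \<Sum>b\<in>A. pderiv_along b (pderiv_along b f) x) \<in> test_functions" if "A \<subseteq> Basis" for A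
    using that
  proof (induction A rule: infinite_finite_induct)
    case (insert b A)
    then have "(\<lambda>x. pderiv_along b (pderiv_along b f) x + (\<Sum>b\<in>A. pderiv_along b (pderiv_along b f) x)) \<in> test_functions"
      by (intro add test_functions_pderiv assms) auto
    then show ?case using insert by simp
  qed (use zero in auto)
  then show ?thesis unfolding lap_def[abs_def] by auto
qed

text \<open>The equation is tested with a dilated bump times a plane wave. The commutator terms
  carry r and r^2 and so become small as the cut-off is widened by r tending to 0.\<close>

lemma bump_equation:
  assumes S: "(u, \<lambda>x. z * u x) \<in> schroedinger V" and r: "r \<noteq> 0"
    and V: "V \<in> borel_measurable lebesgue"
  shows "of_real ((norm \<xi>)\<^sup>2) * (\<integral>x. u x * bump (r *\<^sub>R x) * wave \<xi> x \<partial>lebesgue) +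
      (\<integral>x. (of_real (V x) - z) * u x * bump (r *\<^sub>R x) * wave \<xi> x \<partial>lebesgue) =
    (\<integral>x. u x * (of_real (r\<^sup>2) * lap bump (r *\<^sub>R x)) * wave \<xi> x \<partial>lebesgue) +
    (\<Sum>b\<in>Basis. (- 2 * \<i> * of_real (\<xi> \<bullet> b)) *
        (\<integral>x. u x * (of_real r * pderiv_along b bump (r *\<^sub>R x)) * wave \<xi> x \<partial>lebesgue))"
proof -
  define \<phi> :: "'a \<Rightarrow> complex" where "\<phi> = (\<lambda>x. bump (r *\<^sub>R x))"
  have \<phi>: "\<phi> \<in> test_functions" unfolding \<phi>_def by (rule test_function_dilation[OF test_function_bump r])
  have lu: "locally_integrable u" using S
    by (auto simp: schroedinger_def weak_laplacian_def weak_pderiv_def intro: SOME_Basis)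
  have C1: "\<forall>x. (bump :: 'a \<Rightarrow> complex) differentiable (at x)" by (rule C_k_differentiable[OF C_k_bump])
  have C2: "\<forall>x. pderiv_along b (bump :: 'a \<Rightarrow> complex) differentiable (at x)" if "b \<in> Basis" for b
    by (rule C_k_differentiable[OF C_k_pderiv[OF C_k_bump that]])
  have p1: "pderiv_along b \<phi> = (\<lambda>x. of_real r * pderiv_along b bump (r *\<^sub>R x))" for b
    unfolding \<phi>_def by (rule pderiv_along_dilation(1)[OF C1])
  have p2: "pderiv_along b (pderiv_along b \<phi>) x = of_real (r\<^sup>2) * pderiv_along b (pderiv_along b bump) (r *\<^sub>R x)"
    if "b \<in> Basis" for b x
    unfolding p1
    by (subst pderiv_along_cmult)
       (auto simp: pderiv_along_dilation[OF C2[OF that], where r=r] power2_eq_square)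
  have lapx: "lap \<phi> x = of_real (r\<^sup>2) * lap bump (r *\<^sub>R x)" for x
    unfolding lap_def sum_distrib_left by (intro sum.cong refl p2)
  have tw: "(\<lambda>x. f x * wave \<xi> x) \<in> test_functions" if "f \<in> test_functions" for f
    by (rule test_function_mult_C_k[OF that C_k_wave])
  have iw: "integrable lebesgue (\<lambda>x. u x * (f x * wave \<xi> x))" if "f \<in> test_functions" for f
    by (rule integrable_times_compact_support[OF lu tw[OF that]])
  have "(\<integral>x. u x * lap (\<lambda>x. \<phi> x * wave \<xi> x) x \<partial>lebesgue) = (\<integral>x. u x * (lap \<phi> x * wave \<xi> x)
      + (\<Sum>b\<in>Basis. (- 2 * \<i> * of_real (\<xi> \<bullet> b)) * (u x * (pderiv_along b \<phi> x * wave \<xi> x)))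
      - of_real ((norm \<xi>)\<^sup>2) * (u x * (\<phi> x * wave \<xi> x)) \<partial>lebesgue)"
    using \<phi> by (subst lap_times_wave) (auto simp: test_functions_def algebra_simps sum_distrib_left sum_negf simp del: C_k.simps)
  also have "\<dots> = (\<integral>x. u x * (lap \<phi> x * wave \<xi> x) \<partial>lebesgue)
      + (\<Sum>b\<in>Basis. (- 2 * \<i> * of_real (\<xi> \<bullet> b)) * (\<integral>x. u x * (pderiv_along b \<phi> x * wave \<xi> x) \<partial>lebesgue))
      - of_real ((norm \<xi>)\<^sup>2) * (\<integral>x. u x * (\<phi> x * wave \<xi> x) \<partial>lebesgue)"
    using \<phi>
    by (simp add: iw test_functions_lap test_functions_pderiv Bochner_Integration.integral_sum)
  finally have "(\<integral>x. u x * (lap \<phi> x * wave \<xi> x) \<partial>lebesgue)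
      + (\<Sum>b\<in>Basis. (- 2 * \<i> * of_real (\<xi> \<bullet> b)) * (\<integral>x. u x * (pderiv_along b \<phi> x * wave \<xi> x) \<partial>lebesgue))
      - of_real ((norm \<xi>)\<^sup>2) * (\<integral>x. u x * (\<phi> x * wave \<xi> x) \<partial>lebesgue) =
      (\<integral>x. (of_real (V x) - z) * u x * (\<phi> x * wave \<xi> x) \<partial>lebesgue)"
    using weak_eigen_equation[OF S tw[OF \<phi>] V] by simp
  then show ?thesis unfolding p1 lapx by (simp add: \<phi>_def algebra_simps)
qed

lemma test_function_bounded:
  assumes "f \<in> test_functions"
  shows "\<exists>B N. \<forall>x. cmod (f x) \<le> B \<and> (f x \<noteq> 0 \<longrightarrow> norm x \<le> N)"
proof -
  define K where "K = closure {x. f x \<noteq> 0}"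
  have K1: "compact K" using assms unfolding K_def test_functions_def by blast
  have K2: "x \<in> K" if "f x \<noteq> 0" for x unfolding K_def by (rule subsetD[OF closure_subset]) (simp add: that)
  note K = K1 K2
  have cf: "continuous_on UNIV f" using assms C_k_continuous[of f 0] unfolding test_functions_def by blast
  obtain B where B: "\<And>x. x \<in> K \<Longrightarrow> cmod (f x) \<le> B"
    using compact_imp_bounded[OF compact_continuous_image[OF continuous_on_subset[OF cf] K(1)]]
    by (auto simp: bounded_iff)
  obtain N where N: "\<And>x. x \<in> K \<Longrightarrow> norm x \<le> N"
    using compact_imp_bounded[OF K(1)] by (auto simp: bounded_iff)
  have "cmod (f x) \<le> max B 0 \<and> (f x \<noteq> 0 \<longrightarrow> norm x \<le> N)" for x
    using B[of x] N[of x] K(2)[of x] by (cases "f x = 0") auto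
  then show ?thesis by blast
qed

section \<open>Lattice coordinates\<close>

lemma nn_integral_lborel_shift:
  fixes f :: "'a::euclidean_space \<Rightarrow> ennreal"
  assumes [measurable]: "f \<in> borel_measurable borel"
  shows "(\<integral>\<^sup>+t. f (t + c) \<partial>lborel) = (\<integral>\<^sup>+t. f t \<partial>lborel)"
  by (subst (2) lborel_distr_plus[of c, symmetric], subst nn_integral_distr) (auto simp: add.commute)

lemma nn_integral_lborel_reflect:
  fixes f :: "'a::euclidean_space \<Rightarrow> ennreal"
  assumes [measurable]: "f \<in> borel_measurable borel"
  shows "(\<integral>\<^sup>+t. f (c - t) \<partial>lborel) = (\<integral>\<^sup>+t. f t \<partial>lborel)"
proof -
  have "distr lborel borel (\<lambda>x. c - x) = lborel"
    using lborel_affine[of "-1" c] by (simp add: density_1)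
  then have "(\<integral>\<^sup>+t. f t \<partial>lborel) = (\<integral>\<^sup>+t. f t \<partial>distr lborel borel (\<lambda>x. c - x))" by simp
  also have "\<dots> = (\<integral>\<^sup>+t. f (c - t) \<partial>lborel)" by (subst nn_integral_distr) auto
  finally show ?thesis ..
qed

lemma linear_borel_measurable:
  fixes A :: "'a::euclidean_space \<Rightarrow> 'b::euclidean_space"
  assumes "linear A"
  shows "A \<in> borel_measurable borel"
  using assms by (intro borel_measurable_continuous_onI linear_continuous_on) (simp add: linear_conv_bounded_linear)

text \<open>
  Uniqueness of Haar measure: shifting \<open>y\<close> by \<open>A s\<close>, then \<open>s\<close> by \<open>- A\<^sup>-\<^sup>1 y\<close>, turns
  \<open>\<integral>\<integral> f (A s) g y\<close> into \<open>\<integral>\<integral> f (A s - y) g (A s)\<close>.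
\<close>

lemma distr_linear_lborel:
  fixes A :: "'a::euclidean_space \<Rightarrow> 'a"
  assumes A: "linear A" "inj A"
  shows "\<exists>\<kappa>>0. distr lborel borel A = density lborel (\<lambda>_. ennreal \<kappa>)"
proof -
  note Am[measurable] = linear_borel_measurable[OF A(1)]
  define \<mu> where "\<mu> S = emeasure (distr lborel borel A) S" for S
  have surj: "surj A" using A linear_injective_imp_surjective by blast
  have \<mu>: "\<mu> S = (\<integral>\<^sup>+s. indicator S (A s) \<partial>lborel)" if [measurable]: "S \<in> sets borel" for S
    unfolding \<mu>_def
    by (subst nn_integral_indicator[symmetric], simp, subst nn_integral_distr) auto
  have key: "\<mu> S * emeasure lborel T = \<mu> T * emeasure lborel S"
    if [measurable]: "S \<in> sets borel" "T \<in> sets borel" for S T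
  proof -
    have "\<mu> S * emeasure lborel T = (\<integral>\<^sup>+s. indicator S (A s) * (\<integral>\<^sup>+y. indicator T (y + A s) \<partial>lborel) \<partial>lborel)"
      by (simp add: nn_integral_lborel_shift nn_integral_multc \<mu>)
    also have "\<dots> = (\<integral>\<^sup>+s. \<integral>\<^sup>+y. indicator S (A s) * indicator T (y + A s) \<partial>lborel \<partial>lborel)"
      by (simp add: nn_integral_cmult)
    also have "\<dots> = (\<integral>\<^sup>+y. \<integral>\<^sup>+s. indicator S (A s) * indicator T (y + A s) \<partial>lborel \<partial>lborel)"
      by (rule lborel_pair.Fubini') measurable
    also have "\<dots> = (\<integral>\<^sup>+y. \<integral>\<^sup>+s. indicator S (A s - y) * indicator T (A s) \<partial>lborel \<partial>lborel)"
    proof (rule nn_integral_cong)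
      fix y :: 'a
      obtain x where x: "y = A x" using surj by (metis surjD)
      have As: "A (s + (- x)) = A s - y" for s
        using A(1) by (simp add: x linear_diff)
      have "(\<integral>\<^sup>+s. indicator S (A s) * indicator T (y + A s) \<partial>lborel) =
          (\<integral>\<^sup>+s. indicator S (A (s + (- x))) * indicator T (y + A (s + (- x))) \<partial>lborel)"
        by (rule nn_integral_lborel_shift[symmetric]) measurable
      then show "(\<integral>\<^sup>+s. indicator S (A s) * indicator T (y + A s) \<partial>lborel) =
          (\<integral>\<^sup>+s. indicator S (A s - y) * indicator T (A s) \<partial>lborel)" unfolding As by simp
    qed
    also have "\<dots> = (\<integral>\<^sup>+s. \<integral>\<^sup>+y. indicator S (A s - y) * indicator T (A s) \<partial>lborel \<partial>lborel)"
      by (rule lborel_pair.Fubini'[symmetric]) measurable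
    also have "\<dots> = (\<integral>\<^sup>+s. (\<integral>\<^sup>+y. indicator S (A s - y) \<partial>lborel) * indicator T (A s) \<partial>lborel)"
      by (simp add: nn_integral_multc)
    also have "\<dots> = \<mu> T * emeasure lborel S"
      by (simp add: nn_integral_lborel_reflect nn_integral_cmult \<mu> mult.commute)
    finally show ?thesis .
  qed
  \<comment> \<open>A reference set of measure 1: in \<open>key\<close> it isolates the constant
    \<open>\<mu> T\<close>. That constant is finite because the preimage of \<open>T\<close> is
    bounded, and nonzero because otherwise the whole space would be null.\<close>
  define T where "T = cbox 0 (One :: 'a)"
  have T: "T \<in> sets borel" "emeasure lborel T = 1" by (simp_all add: T_def emeasure_lborel_cbox_eq)
  have \<mu>S: "\<mu> S = \<mu> T * emeasure lborel S" if "S \<in> sets borel" for S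
    using key[OF that T(1)] T(2) by simp
  have "\<mu> T < \<infinity>"
  proof -
    obtain B where B: "0 < B" "\<And>x. B * norm x \<le> norm (A x)"
      using linear_inj_bounded_below_pos[OF A] by blast
    obtain R where R: "\<And>x. x \<in> T \<Longrightarrow> norm x \<le> R" using bounded_cbox[of 0 "One :: 'a"] by (auto simp: T_def bounded_iff)
    have "A -` T \<subseteq> cball 0 (R / B)"
    proof
      fix x assume "x \<in> A -` T"
      then have "B * norm x \<le> R" using B(2)[of x] R[of "A x"] by simp
      then show "x \<in> cball 0 (R / B)" using B(1) by (simp add: field_simps)
    qed
    moreover have "\<mu> T = emeasure lborel (A -` T)" unfolding \<mu>_def using T(1) by (subst emeasure_distr) auto
    ultimately have "\<mu> T \<le> emeasure lborel (cball (0 :: 'a) (R / B))" by (simp add: emeasure_mono)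
    also have "\<dots> < \<infinity>" by (rule emeasure_bounded_finite[OF bounded_cball])
    finally show ?thesis .
  qed
  moreover have "\<mu> T \<noteq> 0"
  proof
    assume "\<mu> T = 0"
    then have "\<mu> UNIV = 0" using \<mu>S[of UNIV] by simp
    then show False unfolding \<mu>_def by (subst (asm) emeasure_distr) auto
  qed
  ultimately obtain \<kappa> where \<kappa>: "0 < \<kappa>" "\<mu> T = ennreal \<kappa>"
    by (cases "\<mu> T") (auto simp: less_le)
  have "distr lborel borel A = density lborel (\<lambda>_. ennreal \<kappa>)"
    by (rule measure_eqI) (auto simp: emeasure_density_const \<mu>S[unfolded \<mu>_def] \<kappa>[unfolded \<mu>_def])
  with \<kappa>(1) show ?thesis by blast
qed

lemma integral_linear_change:
  fixes A :: "'a::euclidean_space \<Rightarrow> 'a" and f :: "'a \<Rightarrow> 'b::{banach, second_countable_topology}"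
  assumes A: "linear A" and \<kappa>: "0 < \<kappa>" "distr lborel borel A = density lborel (\<lambda>_. ennreal \<kappa>)"
    and f[measurable]: "f \<in> borel_measurable borel"
  shows "(\<integral>t. f (A t) \<partial>lborel) = \<kappa> *\<^sub>R (\<integral>x. f x \<partial>lborel)"
    and "integrable lborel (\<lambda>t. f (A t)) \<longleftrightarrow> integrable lborel f"
proof -
  note linear_borel_measurable[OF A, measurable]
  have "(\<integral>t. f (A t) \<partial>lborel) = (\<integral>x. f x \<partial>density lborel (\<lambda>_. ennreal \<kappa>))"
    unfolding \<kappa>(2)[symmetric] by (subst integral_distr) auto
  also have "\<dots> = \<kappa> *\<^sub>R (\<integral>x. f x \<partial>lborel)"
    using \<kappa>(1) by (subst integral_density) auto
  finally show "(\<integral>t. f (A t) \<partial>lborel) = \<kappa> *\<^sub>R (\<integral>x. f x \<partial>lborel)" .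
  have "integrable lborel (\<lambda>t. f (A t)) \<longleftrightarrow> integrable (density lborel (\<lambda>_. ennreal \<kappa>)) f"
    unfolding \<kappa>(2)[symmetric] by (subst integrable_distr_eq) auto
  also have "\<dots> \<longleftrightarrow> integrable lborel (\<lambda>x. \<kappa> *\<^sub>R f x)"
    using \<kappa>(1) by (subst integrable_density) auto
  also have "\<dots> \<longleftrightarrow> integrable lborel f"
    using integrable_scaleR_right[of "1 / \<kappa>" lborel "\<lambda>x. \<kappa> *\<^sub>R f x"] \<kappa>(1) by auto
  finally show "integrable lborel (\<lambda>t. f (A t)) \<longleftrightarrow> integrable lborel f" .
qed

lemma AE_linear_change:
  fixes A :: "'a::euclidean_space \<Rightarrow> 'a"
  assumes A: "linear A" and \<kappa>: "0 < \<kappa>" "distr lborel borel A = density lborel (\<lambda>_. ennreal \<kappa>)"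
    and P: "{x. P x} \<in> sets borel"
  shows "(AE t in lborel. P (A t)) \<longleftrightarrow> (AE x in lborel. P x)"
proof -
  note linear_borel_measurable[OF A, measurable]
  have "(AE t in lborel. P (A t)) \<longleftrightarrow> (AE x in distr lborel borel A. P x)"
    using P by (subst AE_distr_iff) auto
  also have "\<dots> \<longleftrightarrow> (AE x in lborel. P x)"
    unfolding \<kappa>(2) using \<kappa>(1) by (subst AE_density) auto
  finally show ?thesis .
qed

section \<open>The lattice and its dual\<close>

lemma lattice_coordinates:
  fixes L :: "(real ^ 'd) set"
  assumes "lattice_of_rank CARD('d) L"
  shows "\<exists>A :: real ^ 'd \<Rightarrow> real ^ 'd. linear A \<and> inj A \<and> (\<forall>l. A (real_vec l) \<in> L)"
proof -
  obtain B where B: "finite B" "independent B" "L = int_span B" "card B = CARD('d)"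
    using assms by (auto simp: lattice_of_rank_def lattice_basis_def)
  obtain f where f: "bij_betw f (UNIV :: 'd set) B"
    using B(1,4) finite_same_card_bij[of "UNIV :: 'd set" B] by auto
  define g where "g = the_inv_into UNIV f"
  have g: "g (f i) = i" for i
    unfolding g_def using f by (intro the_inv_into_f_f) (auto simp: bij_betw_def)
  define A :: "real ^ 'd \<Rightarrow> real ^ 'd" where "A t = (\<Sum>i\<in>UNIV. t $ i *\<^sub>R f i)" for t
  have re: "(\<Sum>b\<in>B. h (g b) *\<^sub>R b) = (\<Sum>i\<in>UNIV. h i *\<^sub>R f i)" for h :: "'d \<Rightarrow> real"
    by (subst sum.reindex_bij_betw[OF f, symmetric]) (simp add: g)
  have lin: "linear A"
    by (rule linearI) (simp_all add: A_def scaleR_left_distrib sum.distrib scaleR_sum_right)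
  moreover have "inj A"
    unfolding linear_injective_0[OF lin]
  proof (intro allI impI)
    fix t assume "A t = 0"
    then have 0: "(\<Sum>b\<in>B. (t $ g b) *\<^sub>R b) = 0" using re[of "\<lambda>i. t $ i"] by (simp add: A_def)
    have "t $ i = 0" for i
    proof -
      have "f i \<in> B" using f by (auto simp: bij_betw_def)
      then have "t $ g (f i) = 0" using independentD[OF B(2,1) order_refl 0] by blast
      then show ?thesis by (simp add: g)
    qed
    then show "t = 0" by (simp add: vec_eq_iff)
  qed
  moreover have "A (real_vec l) \<in> L" for l
    unfolding B(3) int_span_def A_def using re[of "\<lambda>i. of_int (l $ i)"]
    by (auto intro!: exI[of _ "\<lambda>b. l $ g b"])
  ultimately show ?thesis by blast
qed

text \<open>\<open>P\<close> is 2 pi times the inverse transpose of \<open>A\<close>: it maps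
  integer vectors into the dual lattice and a quasimomentum to the wave vector it has in the
  original coordinates.\<close>

lemma dual_coordinates:
  fixes A :: "real ^ 'd \<Rightarrow> real ^ 'd"
  assumes A: "linear A" "inj A"
  shows "\<exists>P. linear P \<and> inj P \<and> (\<forall>\<theta> t. P \<theta> \<bullet> A t = 2 * pi * (\<theta> \<bullet> t))"
proof -
  obtain C where C: "linear C" "\<And>x. C (A x) = x"
    using linear_injective_left_inverse[OF A] by (metis comp_apply id_apply)
  define P where "P \<theta> = (2 * pi) *\<^sub>R adjoint C \<theta>" for \<theta>
  have lin: "linear P" unfolding P_def
    by (intro linear_compose_scale_right adjoint_linear C)
  have dual: "P \<theta> \<bullet> A t = 2 * pi * (\<theta> \<bullet> t)" for \<theta> t
    unfolding P_def using adjoint_clauses(2)[OF C(1), of \<theta> "A t"] by (simp add: C)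
  have "inj P"
    unfolding linear_injective_0[OF lin]
  proof (intro allI impI)
    fix \<theta> assume "P \<theta> = 0"
    then have "\<theta> \<bullet> \<theta> = 0" using dual[of \<theta> \<theta>] by simp
    then show "\<theta> = 0" by simp
  qed
  with lin dual show ?thesis by blast
qed

section \<open>Borel representatives and supports\<close>

lemma AE_lebesgue_iff_lborel: "(AE x in lebesgue. P x) \<longleftrightarrow> (AE x in lborel. P x)"
  by (rule AE_completion_iff)

text \<open>Push-forwards and Tonelli are applied to \<open>lborel\<close>, whereas the operator is
  defined over its completion; this passes between the two, separately for real and imaginary
  parts.\<close>

lemma complex_borel_representative:
  fixes f :: "'a::euclidean_space \<Rightarrow> complex"
  assumes "f \<in> borel_measurable lebesgue"
  shows "\<exists>g\<in>borel_measurable borel. AE x in lborel. f x = g x"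
proof -
  obtain a where a: "a \<in> borel_measurable lborel" "AE x in lborel. Re (f x) = a x"
    using completion_ex_borel_measurable_real[of "\<lambda>x. Re (f x)" lborel] assms by auto
  obtain b where b: "b \<in> borel_measurable lborel" "AE x in lborel. Im (f x) = b x"
    using completion_ex_borel_measurable_real[of "\<lambda>x. Im (f x)" lborel] assms by auto
  show ?thesis
  proof (rule bexI[of _ "\<lambda>x. complex_of_real (a x) + \<i> * complex_of_real (b x)"])
    show "AE x in lborel. f x = complex_of_real (a x) + \<i> * complex_of_real (b x)"
      using a(2) b(2) by eventually_elim (simp add: complex_eq_iff)
  qed (use a(1) b(1) in simp)
qed

lemma floor_vec_measurable: "(\<lambda>t :: real ^ 'd. real_vec (floor_vec t)) \<in> borel_measurable borel"
proof (subst borel_measurable_euclidean_space, intro ballI)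
  fix b :: "real ^ 'd" assume "b \<in> Basis"
  then obtain i where "b = axis i 1" by (auto simp: Basis_vec_def)
  then show "(\<lambda>t :: real ^ 'd. real_vec (floor_vec t) \<bullet> b) \<in> borel_measurable borel"
    by (simp add: inner_axis floor_vec_def)
qed

lemma supported_in_exists:
  fixes v :: "real ^ 'd \<Rightarrow> complex"
  assumes "\<And>t. v t \<noteq> 0 \<Longrightarrow> norm t \<le> R"
  shows "supported_in (\<lceil>R\<rceil> + 1) v"
  unfolding supported_in_def int_cube_def
proof (intro allI impI CollectI)
  fix t i assume "v t \<noteq> 0"
  then have "\<bar>t $ i\<bar> \<le> R" using assms[of t] component_le_norm_cart[of t i] by linarith
  then show "\<bar>floor_vec t $ i\<bar> \<le> \<lceil>R\<rceil> + 1" unfolding floor_vec_def vec_lambda_beta by linarith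
qed

lemma square_integrable_bounded_mult:
  assumes u: "square_integrable M u" and m: "m \<in> borel_measurable M" "\<And>x. cmod (m x) \<le> C"
  shows "square_integrable M (\<lambda>x. u x * m x)" "sqnorm M (\<lambda>x. u x * m x) \<le> C\<^sup>2 * sqnorm M u"
proof -
  have [measurable]: "u \<in> borel_measurable M" "m \<in> borel_measurable M" using u m by (auto simp: square_integrable_def)
  have b: "(cmod (u x * m x))\<^sup>2 \<le> C\<^sup>2 * (cmod (u x))\<^sup>2" for x
    using power_mono[OF m(2)[of x], of 2] by (simp add: norm_mult power_mult_distrib mult.commute mult_right_mono)
  have i: "integrable M (\<lambda>x. C\<^sup>2 * (cmod (u x))\<^sup>2)" using u by (simp add: square_integrable_def)
  have "integrable M (\<lambda>x. (cmod (u x * m x))\<^sup>2)"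
    by (rule Bochner_Integration.integrable_bound[OF i]) (use b in auto)
  then show s: "square_integrable M (\<lambda>x. u x * m x)" by (simp add: square_integrable_def)
  show "sqnorm M (\<lambda>x. u x * m x) \<le> C\<^sup>2 * sqnorm M u"
    unfolding sqnorm_def integral_mult_right_zero[symmetric]
    using s i by (intro integral_mono b) (auto simp: square_integrable_def)
qed

text \<open>In the coordinates of \<open>A\<close>, with Borel representatives of the eigenfunction
  and of V - z, the dilated bumps supply the cut-offs, and \<open>bump_equation\<close> at \<xi> = P
  \<theta> becomes the identity \<open>eq\<close> after the common factor 1 / \<kappa> is
  cancelled.\<close>

lemma eigenfunction_eq_0:
  fixes V :: "real ^ 'd \<Rightarrow> real" and L :: "(real ^ 'd) set"
  assumes V: "V \<in> Linfty" and L: "lattice_of_rank CARD('d) L" and per: "periodic_wrt L V"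
    and S: "(u, \<lambda>x. z * u x) \<in> schroedinger V"
  shows "AE x in lebesgue. u x = 0"
proof -
  obtain A :: "real ^ 'd \<Rightarrow> real ^ 'd" where A: "linear A" "inj A" "\<And>l. A (real_vec l) \<in> L"
    using lattice_coordinates[OF L] by blast
  obtain P :: "real ^ 'd \<Rightarrow> real ^ 'd" where P: "linear P" "inj P" "\<And>\<theta> t. P \<theta> \<bullet> A t = 2 * pi * (\<theta> \<bullet> t)"
    using dual_coordinates[OF A(1,2)] by blast
  obtain \<kappa> where \<kappa>: "0 < \<kappa>" "distr lborel borel A = density lborel (\<lambda>_. ennreal \<kappa>)"
    using distr_linear_lborel[OF A(1,2)] by blast
  note Am[measurable] = linear_borel_measurable[OF A(1)]
  define k :: 'd where "k = (SOME i. True)"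
  \<comment> \<open>The direction whose wave vector is the k-th lattice vector; by duality its inner
    product with P \<theta> reads off the coordinate \<open>\<theta> $ k\<close>.\<close>
  obtain \<eta> where "P \<eta> = A (axis k 1)"
    using linear_injective_imp_surjective[OF P(1,2)] by (metis surjD)
  then have \<eta>: "P \<eta> \<bullet> P \<theta> = 2 * pi * (\<theta> $ k)" for \<theta>
    using P(3)[of \<theta> "axis k 1"] by (simp add: inner_commute inner_axis)
  have Vm: "V \<in> borel_measurable lebesgue" using V by (simp add: Linfty_def)
  have um: "u \<in> borel_measurable lebesgue" and ui: "integrable lebesgue (\<lambda>x. (cmod (u x))\<^sup>2)"
    using S by (auto simp: schroedinger_def numeral_2_eq_2 L2_def)
  obtain u0 where u0[measurable]: "u0 \<in> borel_measurable borel" and u_eq: "AE x in lborel. u x = u0 x"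
    using complex_borel_representative[OF um] by blast
  obtain C where C: "AE x in lebesgue. \<bar>V x\<bar> \<le> C" using V by (auto simp: Linfty_def)
  obtain V1 where V1: "V1 \<in> borel_measurable lborel" "AE x in lborel. V x = V1 x"
    using completion_ex_borel_measurable_real[OF Vm] by blast
  \<comment> \<open>Clipping makes the bound hold at every point instead of almost everywhere,
    without changing V off a null set.\<close>
  define V0 where "V0 x = max (- \<bar>C\<bar>) (min \<bar>C\<bar> (V1 x))" for x
  have V0[measurable]: "V0 \<in> borel_measurable borel" using V1(1) unfolding V0_def by simp
  have V_eq: "AE x in lborel. V x = V0 x"
    using C[unfolded AE_lebesgue_iff_lborel] V1(2) by eventually_elim (auto simp: V0_def)
  define w where "w x = complex_of_real (V0 x) - z" for x
  have w[measurable]: "w \<in> borel_measurable borel" unfolding w_def by measurable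
  \<comment> \<open>The summand 1 keeps \<omega> positive even when C and z vanish.\<close>
  define \<omega> where "\<omega> = \<bar>C\<bar> + cmod z + 1"
  have \<omega>: "0 < \<omega>" by (simp add: \<omega>_def add_nonneg_pos)
  have w_le: "cmod (w x) \<le> \<omega>" for x
  proof -
    have "\<bar>V0 x\<bar> \<le> \<bar>C\<bar>" by (auto simp: V0_def)
    then show ?thesis using norm_triangle_ineq4[of "complex_of_real (V0 x)" z] by (simp add: w_def \<omega>_def)
  qed
  define U where "U t = u0 (A t)" for t
  have Um[measurable]: "U \<in> borel_measurable borel" unfolding U_def by measurable
  have U: "square_integrable lborel U"
  proof -
    have "integrable lebesgue (\<lambda>x. (cmod (u0 x))\<^sup>2)"
    proof (rule integrable_cong_AE_imp[OF ui])
      show "(\<lambda>x. (cmod (u0 x))\<^sup>2) \<in> borel_measurable lebesgue" by (intro measurable_completion) measurable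
      show "AE x in lebesgue. (cmod (u x))\<^sup>2 = (cmod (u0 x))\<^sup>2"
        unfolding AE_lebesgue_iff_lborel using u_eq by eventually_elim simp
    qed
    then have "integrable lborel (\<lambda>x. (cmod (u0 x))\<^sup>2)" by (subst (asm) integrable_completion) auto
    then show ?thesis unfolding square_integrable_def U_def
      using integral_linear_change(2)[OF A(1) \<kappa>, of "\<lambda>x. (cmod (u0 x))\<^sup>2"] by simp
  qed
  \<comment> \<open>Evaluating at the representative in the unit cube makes \<open>W\<close> exactly
    periodic. It agrees with \<open>w (A t)\<close> almost everywhere because there are only
    countably many lattice translations, each with its own null set.\<close>
  define W where "W t = w (A (t - real_vec (floor_vec t)))" for t
  have Wm: "W \<in> borel_measurable borel"
  proof -
    note floor_vec_measurable[measurable]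
    show ?thesis unfolding W_def by measurable
  qed
  have Wper: "W (t + real_vec l) = W t" for t l
  proof -
    have "floor_vec (t + real_vec l) = floor_vec t + l" by (simp add: floor_vec_def vec_eq_iff)
    then show ?thesis by (simp add: W_def real_vec_add)
  qed
  have W_le: "cmod (W t) \<le> \<omega>" for t by (simp add: W_def w_le)
  have W_eq: "AE t in lborel. w (A t) = W t"
  proof -
    have "AE t in lborel. w (A t + A (real_vec l)) = w (A t)" for l
    proof -
      let ?l = "A (real_vec l)"
      have "AE x in lborel. V (x + ?l) = V x"
        using per A(3) unfolding periodic_wrt_def AE_lebesgue_iff_lborel by blast
      moreover have "AE x in lborel. V (x + ?l) = V0 (x + ?l)"
      proof -
        obtain Z where Z: "{x. V x \<noteq> V0 x} \<subseteq> Z" "emeasure lborel Z = 0" "Z \<in> sets borel"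
          using V_eq unfolding eventually_ae_filter by (auto simp: null_sets_def)
        have "emeasure (distr lborel borel ((+) ?l)) Z = emeasure lborel {x. x + ?l \<in> Z}"
          by (subst emeasure_distr) (use Z(3) in \<open>auto simp: vimage_def add.commute\<close>)
        then have "emeasure lborel {x. x + ?l \<in> Z} = 0" by (simp add: lborel_distr_plus Z(2))
        moreover have "{x. x + ?l \<in> Z} \<in> sets lborel"
          using Z(3) by measurable
        ultimately show ?thesis
          by (intro AE_I[where N="{x. x + ?l \<in> Z}"]) (use Z(1) in auto)
      qed
      ultimately have "AE x in lborel. w (x + ?l) = w x"
        using V_eq by eventually_elim (simp add: w_def)
      then show ?thesis
        by (subst AE_linear_change[OF A(1) \<kappa>, of "\<lambda>x. w (x + ?l) = w x"]) auto
    qed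
    then have "AE t in lborel. \<forall>l. w (A t + A (real_vec l)) = w (A t)"
      by (subst AE_all_countable) blast
    then show ?thesis
    proof eventually_elim
      case (elim t)
      have "A (t - real_vec (floor_vec t)) = A t + A (real_vec (- floor_vec t))"
        using A(1) by (simp add: real_vec_uminus linear_diff linear_neg)
      then show ?case using elim[rule_format, of "- floor_vec t"] by (simp add: W_def)
    qed
  qed
  \<comment> \<open>Three replacements at once: a Borel representative \<open>g\<close> for
    \<open>f\<close>, the variable x = A t, and a function \<open>h\<close> of t that agrees with
    \<open>g (A t)\<close> almost everywhere. The last is needed only for the product with
    \<open>W\<close>.\<close>
  have transfer: "(\<integral>x. f x * wave (P \<theta>) x \<partial>lebesgue) = (1 / \<kappa>) *\<^sub>R fourier h \<theta>"
    if f: "f \<in> borel_measurable lebesgue" and g: "g \<in> borel_measurable borel" "AE x in lborel. f x = g x"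
      and h: "h \<in> borel_measurable borel" "AE t in lborel. g (A t) = h t" for f g h \<theta>
  proof -
    note g(1)[measurable] h(1)[measurable]
    have [measurable]: "wave \<xi> \<in> borel_measurable borel" for \<xi> :: "real ^ 'd"
      by (rule borel_measurable_continuous_onI) (rule C_k_continuous[OF C_k_wave[of _ 0]])
    have wl: "wave \<xi> \<in> borel_measurable lebesgue" for \<xi> :: "real ^ 'd"
      by (rule measurable_completion) simp
    have "(\<integral>x. f x * wave (P \<theta>) x \<partial>lebesgue) = (\<integral>x. g x * wave (P \<theta>) x \<partial>lebesgue)"
    proof (rule integral_cong_AE)
      show "(\<lambda>x. f x * wave (P \<theta>) x) \<in> borel_measurable lebesgue" using f wl by simp
      show "(\<lambda>x. g x * wave (P \<theta>) x) \<in> borel_measurable lebesgue" by (intro measurable_completion) measurable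
      show "AE x in lebesgue. f x * wave (P \<theta>) x = g x * wave (P \<theta>) x"
        unfolding AE_lebesgue_iff_lborel using g(2) by eventually_elim simp
    qed
    also have "\<dots> = (\<integral>x. g x * wave (P \<theta>) x \<partial>lborel)" by (rule integral_completion) measurable
    also have "\<dots> = (1 / \<kappa>) *\<^sub>R (\<integral>t. g (A t) * wave (P \<theta>) (A t) \<partial>lborel)"
      using integral_linear_change(1)[OF A(1) \<kappa>, of "\<lambda>x. g x * wave (P \<theta>) x"] \<kappa>(1) by simp
    also have "(\<integral>t. g (A t) * wave (P \<theta>) (A t) \<partial>lborel) = fourier h \<theta>"
      unfolding fourier_def
    proof (rule integral_cong_AE)
      have we: "wave (P \<theta>) (A t) = echar (- \<theta>) t" for t
        by (simp add: wave_def echar_def P(3))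
      show "AE t in lborel. g (A t) * wave (P \<theta>) (A t) = h t * echar (- \<theta>) t"
        using h(2) by eventually_elim (simp add: we)
    qed measurable
    finally show ?thesis .
  qed
  let ?b = "bump :: real ^ 'd \<Rightarrow> complex"
  have cont: "continuous_on UNIV ?b" "continuous_on UNIV (lap ?b)"
    "b \<in> Basis \<Longrightarrow> continuous_on UNIV (pderiv_along b ?b)" for b
    using test_function_bump test_functions_lap[OF test_function_bump] test_functions_pderiv[OF test_function_bump]
      C_k_continuous[of _ 0] unfolding test_functions_def by blast+
  have meas: "?b \<in> borel_measurable borel" "lap ?b \<in> borel_measurable borel"
    "b \<in> Basis \<Longrightarrow> pderiv_along b ?b \<in> borel_measurable borel" for b
    using cont by (auto intro: borel_measurable_continuous_onI)
  define K where "K = cbox (- One) (One :: real ^ 'd)"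
  have K: "closed K" unfolding K_def by (rule closed_cbox)
  have supp: "?b x \<noteq> 0 \<Longrightarrow> x \<in> K" "lap ?b x \<noteq> 0 \<Longrightarrow> x \<in> K" "pderiv_along b ?b x \<noteq> 0 \<Longrightarrow> x \<in> K" for b x
  proof -
    show 1: "?b x \<noteq> 0 \<Longrightarrow> x \<in> K" for x unfolding K_def by (rule bump_support)
    show 2: "pderiv_along b ?b x \<noteq> 0 \<Longrightarrow> x \<in> K" for b x
      by (rule pderiv_along_support[OF 1 K])
    have 3: "pderiv_along b (pderiv_along b ?b) x \<noteq> 0 \<Longrightarrow> x \<in> K" for b
      by (rule pderiv_along_support[OF 2 K])
    show "x \<in> K" if "lap ?b x \<noteq> 0"
    proof (rule ccontr)
      assume "x \<notin> K"
      then have "lap ?b x = 0" unfolding lap_def using 3 by (intro sum.neutral) blast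
      with that show False by simp
    qed
  qed
  obtain R where R: "\<And>x. x \<in> K \<Longrightarrow> norm x \<le> R" using bounded_cbox[of "- One" "One :: real ^ 'd"] by (auto simp: K_def bounded_iff)
  obtain B0 where B0: "0 < B0" "\<And>x. B0 * norm x \<le> norm (A x)"
    using linear_inj_bounded_below_pos[OF A(1,2)] by blast
  obtain D0 where D0: "\<And>x. cmod (?b x) \<le> D0" using test_function_bounded[OF test_function_bump] by blast
  obtain D1 where D1: "\<And>x. cmod (lap ?b x) \<le> D1"
    using test_function_bounded[OF test_functions_lap[OF test_function_bump]] by blast
  have "\<forall>b\<in>Basis. \<exists>D. \<forall>x. cmod (pderiv_along b ?b x) \<le> D"
    using test_function_bounded[OF test_functions_pderiv[OF test_function_bump]] by blast
  then obtain D2 where D2: "\<And>b x. b \<in> Basis \<Longrightarrow> cmod (pderiv_along b ?b x) \<le> D2 b" by metis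
  define \<rho> where "\<rho> j = inverse (real (Suc j))" for j
  have \<rho>: "0 < \<rho> j" for j by (simp add: \<rho>_def)
  have \<rho>0: "\<rho> \<longlonglongrightarrow> 0" unfolding \<rho>_def by (rule LIMSEQ_inverse_real_of_nat)
  \<comment> \<open>\<open>p\<close> and \<open>q\<close> are the two commutator errors of the
    cut-off in \<open>v\<close>, with the powers of \<rho> that the chain rule produces.\<close>
  define v where "v j t = U t * ?b (\<rho> j *\<^sub>R A t)" for j t
  define p where "p j t = U t * (of_real ((\<rho> j)\<^sup>2) * lap ?b (\<rho> j *\<^sub>R A t))" for j t
  define q where "q j b t = U t * (of_real (\<rho> j) * pderiv_along b ?b (\<rho> j *\<^sub>R A t))" for j b t
  have N: "supported_in (\<lceil>R / (\<rho> j * B0)\<rceil> + 1) (v j)" "supported_in (\<lceil>R / (\<rho> j * B0)\<rceil> + 1) (p j)"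
    "supported_in (\<lceil>R / (\<rho> j * B0)\<rceil> + 1) (q j b)" for j b
  proof -
    have "norm t \<le> R / (\<rho> j * B0)" if "\<rho> j *\<^sub>R A t \<in> K" for t
    proof -
      have "\<rho> j * (B0 * norm t) \<le> \<rho> j * norm (A t)" using \<rho>[of j] B0(2)[of t] by simp
      also have "\<dots> \<le> R" using R[OF that] \<rho>[of j] by simp
      finally show ?thesis using \<rho>[of j] B0(1) by (simp add: field_simps)
    qed
    then show "supported_in (\<lceil>R / (\<rho> j * B0)\<rceil> + 1) (v j)" "supported_in (\<lceil>R / (\<rho> j * B0)\<rceil> + 1) (p j)"
      "supported_in (\<lceil>R / (\<rho> j * B0)\<rceil> + 1) (q j b)"
      by (intro supported_in_exists; use supp in \<open>auto simp: v_def p_def q_def\<close>)+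
  qed
  have comp: "(\<lambda>t. f (r *\<^sub>R A t)) \<in> borel_measurable borel" if "f \<in> borel_measurable borel" for f :: "real ^ 'd \<Rightarrow> complex" and r
    using that by measurable
  have vs: "square_integrable lborel (v j)" for j
    unfolding v_def by (rule square_integrable_bounded_mult[OF U]) (use comp[OF meas(1)] D0 in auto)
  have pb: "square_integrable lborel (p j)" "sqnorm lborel (p j) \<le> ((\<rho> j)\<^sup>2 * D1)\<^sup>2 * sqnorm lborel U" for j
  proof -
    have m: "(\<lambda>t. of_real ((\<rho> j)\<^sup>2) * lap ?b (\<rho> j *\<^sub>R A t)) \<in> borel_measurable lborel"
      using comp[OF meas(2)] by simp
    have le: "cmod (of_real ((\<rho> j)\<^sup>2) * lap ?b (\<rho> j *\<^sub>R A t)) \<le> (\<rho> j)\<^sup>2 * D1" for t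
      using D1 by (auto simp: norm_mult norm_power intro!: mult_left_mono)
    show "square_integrable lborel (p j)" "sqnorm lborel (p j) \<le> ((\<rho> j)\<^sup>2 * D1)\<^sup>2 * sqnorm lborel U"
      using square_integrable_bounded_mult[OF U m le] unfolding p_def by auto
  qed
  have qb: "square_integrable lborel (q j b)" "sqnorm lborel (q j b) \<le> (\<rho> j * D2 b)\<^sup>2 * sqnorm lborel U"
    if "b \<in> Basis" for j b
  proof -
    have m: "(\<lambda>t. of_real (\<rho> j) * pderiv_along b ?b (\<rho> j *\<^sub>R A t)) \<in> borel_measurable lborel"
      using comp[OF meas(3)[OF that]] by simp
    have le: "cmod (of_real (\<rho> j) * pderiv_along b ?b (\<rho> j *\<^sub>R A t)) \<le> \<rho> j * D2 b" for t
      using D2[OF that] \<rho>[of j] by (auto simp: norm_mult intro!: mult_left_mono)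
    show "square_integrable lborel (q j b)" "sqnorm lborel (q j b) \<le> (\<rho> j * D2 b)\<^sup>2 * sqnorm lborel U"
      using square_integrable_bounded_mult[OF U m le] unfolding q_def by auto
  qed
  have vlim: "(\<lambda>j. sqnorm lborel (\<lambda>t. U t - v j t)) \<longlonglongrightarrow> 0"
  proof -
    have "(\<lambda>j. sqnorm lborel (\<lambda>t. U t - v j t)) \<longlonglongrightarrow> (\<integral>t. 0 \<partial>(lborel :: (real ^ 'd) measure))"
      unfolding sqnorm_def
    proof (rule integral_dominated_convergence[where w="\<lambda>t. (1 + D0)\<^sup>2 * (cmod (U t))\<^sup>2"])
      show "integrable lborel (\<lambda>t. (1 + D0)\<^sup>2 * (cmod (U t))\<^sup>2)" using U by (simp add: square_integrable_def)
      have "v j \<in> borel_measurable lborel" for j using vs[of j] by (simp add: square_integrable_def)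
      then show "(\<lambda>t. (cmod (U t - v j t))\<^sup>2) \<in> borel_measurable lborel" for j by measurable
      show "AE t in lborel. (\<lambda>j. (cmod (U t - v j t))\<^sup>2) \<longlonglongrightarrow> 0"
      proof (rule AE_I2)
        fix t :: "real ^ 'd"
        have "(\<lambda>j. \<rho> j *\<^sub>R A t) \<longlonglongrightarrow> 0 *\<^sub>R A t" by (intro tendsto_intros \<rho>0)
        then have "(\<lambda>j. ?b (\<rho> j *\<^sub>R A t)) \<longlonglongrightarrow> ?b (0 *\<^sub>R A t)"
          by (rule continuous_on_tendsto_compose[OF cont(1)]) auto
        then have "(\<lambda>j. (cmod (U t - v j t))\<^sup>2) \<longlonglongrightarrow> (cmod (U t - U t * ?b (0 *\<^sub>R A t)))\<^sup>2"
          unfolding v_def by (intro tendsto_intros)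
        then show "(\<lambda>j. (cmod (U t - v j t))\<^sup>2) \<longlonglongrightarrow> 0" by (simp add: bump_0)
      qed
      show "AE t in lborel. norm ((cmod (U t - v j t))\<^sup>2) \<le> (1 + D0)\<^sup>2 * (cmod (U t))\<^sup>2" for j
      proof (rule AE_I2)
        fix t :: "real ^ 'd"
        have "cmod (1 - ?b (\<rho> j *\<^sub>R A t)) \<le> 1 + D0"
          using norm_triangle_ineq4[of 1 "?b (\<rho> j *\<^sub>R A t)"] D0[of "\<rho> j *\<^sub>R A t"] by simp
        then have "cmod (U t) * cmod (1 - ?b (\<rho> j *\<^sub>R A t)) \<le> cmod (U t) * (1 + D0)"
          by (rule mult_left_mono) simp
        then have "cmod (U t - v j t) \<le> (1 + D0) * cmod (U t)"
          unfolding norm_mult[symmetric] by (simp add: v_def algebra_simps)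
        then have "(cmod (U t - v j t))\<^sup>2 \<le> ((1 + D0) * cmod (U t))\<^sup>2" by (intro power_mono) auto
        then show "norm ((cmod (U t - v j t))\<^sup>2) \<le> (1 + D0)\<^sup>2 * (cmod (U t))\<^sup>2"
          by (simp add: power_mult_distrib)
      qed
    qed simp
    then show ?thesis by simp
  qed
  have plim: "(\<lambda>j. sqnorm lborel (p j)) \<longlonglongrightarrow> 0"
  proof (rule tendsto_sandwich[OF _ _ tendsto_const])
    have "(\<lambda>j. ((\<rho> j)\<^sup>2 * D1)\<^sup>2 * sqnorm lborel U) \<longlonglongrightarrow> (0\<^sup>2 * D1)\<^sup>2 * sqnorm lborel U"
      by (intro tendsto_intros \<rho>0)
    then show "(\<lambda>j. ((\<rho> j)\<^sup>2 * D1)\<^sup>2 * sqnorm lborel U) \<longlonglongrightarrow> 0" by simp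
  qed (use pb(2) in auto)
  have qlim: "(\<lambda>j. sqnorm lborel (q j b)) \<longlonglongrightarrow> 0" if "b \<in> Basis" for b
  proof (rule tendsto_sandwich[OF _ _ tendsto_const])
    have "(\<lambda>j. (\<rho> j * D2 b)\<^sup>2 * sqnorm lborel U) \<longlonglongrightarrow> (0 * D2 b)\<^sup>2 * sqnorm lborel U"
      by (intro tendsto_intros \<rho>0)
    then show "(\<lambda>j. (\<rho> j * D2 b)\<^sup>2 * sqnorm lborel U) \<longlonglongrightarrow> 0" by simp
  qed (use qb(2)[OF that] in auto)
  \<comment> \<open>Dominated convergence gives no rate for the cut-off error, so a sequence of
    indices along which all the errors are at most 8^-j is selected.\<close>
  define Q where "Q j i \<longleftrightarrow> sqnorm lborel (\<lambda>t. U t - v i t) \<le> (1 / 8) ^ j \<and> sqnorm lborel (p i) \<le> (1 / 8) ^ j \<and>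
      (\<forall>b\<in>Basis. sqnorm lborel (q i b) \<le> (1 / 8) ^ j)" for j i
  have "\<exists>i. Q j i" for j
  proof -
    have pos: "0 < (1 / 8 :: real) ^ j" by simp
    have "\<forall>\<^sub>F i in sequentially. sqnorm lborel (\<lambda>t. U t - v i t) < (1 / 8) ^ j \<and> sqnorm lborel (p i) < (1 / 8) ^ j \<and>
        (\<forall>b\<in>Basis. sqnorm lborel (q i b) < (1 / 8) ^ j)"
      by (intro eventually_conj order_tendstoD(2)[OF vlim pos] order_tendstoD(2)[OF plim pos]
          eventually_ball_finite finite_Basis ballI order_tendstoD(2)[OF qlim pos])
    then obtain i where "sqnorm lborel (\<lambda>t. U t - v i t) < (1 / 8) ^ j \<and> sqnorm lborel (p i) < (1 / 8) ^ j \<and>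
        (\<forall>b\<in>Basis. sqnorm lborel (q i b) < (1 / 8) ^ j)"
      using eventually_sequentially by auto
    then have "Q j i" by (auto simp: Q_def less_imp_le)
    then show ?thesis by (rule exI)
  qed
  then obtain \<sigma> where Q: "\<And>j. Q j (\<sigma> j)" by metis
  have \<sigma>: "sqnorm lborel (\<lambda>t. U t - v (\<sigma> j) t) \<le> (1 / 8) ^ j"
      "sqnorm lborel (p (\<sigma> j)) \<le> (1 / 8) ^ j"
      "b \<in> Basis \<Longrightarrow> sqnorm lborel (q (\<sigma> j) b) \<le> (1 / 8) ^ j" for j b
    using Q[of j] unfolding Q_def by blast+
  have eq: "of_real ((norm (P \<theta>))\<^sup>2) * fourier (v j) \<theta> + fourier (\<lambda>t. W t * v j t) \<theta> =
      fourier (p j) \<theta> + (\<Sum>b\<in>Basis. (- 2 * \<i> * of_real (P \<theta> \<bullet> b)) * fourier (q j b) \<theta>)" for j \<theta>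
  proof -
    define r where "r = \<rho> j"
    have ml: "(\<lambda>x. f (r *\<^sub>R x)) \<in> borel_measurable lebesgue" "(\<lambda>x. f (r *\<^sub>R x)) \<in> borel_measurable borel"
      if "f \<in> borel_measurable borel" for f :: "real ^ 'd \<Rightarrow> complex"
      using that by (auto intro!: measurable_completion)
    have 1: "(\<integral>x. u x * ?b (r *\<^sub>R x) * wave (P \<theta>) x \<partial>lebesgue) = (1 / \<kappa>) *\<^sub>R fourier (v j) \<theta>"
    proof (rule transfer[where g="\<lambda>x. u0 x * ?b (r *\<^sub>R x)"])
      show "(\<lambda>x. u x * ?b (r *\<^sub>R x)) \<in> borel_measurable lebesgue" using um ml(1)[OF meas(1)] by simp
      show "(\<lambda>x. u0 x * ?b (r *\<^sub>R x)) \<in> borel_measurable borel" using ml(2)[OF meas(1)] by simp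
      show "AE x in lborel. u x * ?b (r *\<^sub>R x) = u0 x * ?b (r *\<^sub>R x)" using u_eq by eventually_elim simp
      show "v j \<in> borel_measurable borel" using vs[of j] by (simp add: square_integrable_def)
    qed (simp add: v_def U_def r_def)
    have 2: "(\<integral>x. (of_real (V x) - z) * u x * ?b (r *\<^sub>R x) * wave (P \<theta>) x \<partial>lebesgue) =
        (1 / \<kappa>) *\<^sub>R fourier (\<lambda>t. W t * v j t) \<theta>"
    proof (rule transfer[where g="\<lambda>x. w x * u0 x * ?b (r *\<^sub>R x)"])
      show "(\<lambda>x. (of_real (V x) - z) * u x * ?b (r *\<^sub>R x)) \<in> borel_measurable lebesgue"
        using um Vm ml(1)[OF meas(1)] by measurable
      show "(\<lambda>x. w x * u0 x * ?b (r *\<^sub>R x)) \<in> borel_measurable borel" using ml(2)[OF meas(1)] by simp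
      show "AE x in lborel. (of_real (V x) - z) * u x * ?b (r *\<^sub>R x) = w x * u0 x * ?b (r *\<^sub>R x)"
        using u_eq V_eq by eventually_elim (simp add: w_def)
      show "(\<lambda>t. W t * v j t) \<in> borel_measurable borel" using vs[of j] by (intro borel_measurable_times Wm) (simp add: square_integrable_def)
      show "AE t in lborel. w (A t) * u0 (A t) * ?b (r *\<^sub>R A t) = W t * v j t"
        using W_eq by eventually_elim (simp add: v_def U_def r_def)
    qed
    have 3: "(\<integral>x. u x * (of_real (r\<^sup>2) * lap ?b (r *\<^sub>R x)) * wave (P \<theta>) x \<partial>lebesgue) = (1 / \<kappa>) *\<^sub>R fourier (p j) \<theta>"
    proof (rule transfer[where g="\<lambda>x. u0 x * (of_real (r\<^sup>2) * lap ?b (r *\<^sub>R x))"])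
      show "(\<lambda>x. u x * (of_real (r\<^sup>2) * lap ?b (r *\<^sub>R x))) \<in> borel_measurable lebesgue" using um ml(1)[OF meas(2)] by simp
      show "(\<lambda>x. u0 x * (of_real (r\<^sup>2) * lap ?b (r *\<^sub>R x))) \<in> borel_measurable borel" using ml(2)[OF meas(2)] by simp
      show "AE x in lborel. u x * (of_real (r\<^sup>2) * lap ?b (r *\<^sub>R x)) = u0 x * (of_real (r\<^sup>2) * lap ?b (r *\<^sub>R x))"
        using u_eq by eventually_elim simp
      show "p j \<in> borel_measurable borel" using pb(1)[of j] by (simp add: square_integrable_def)
    qed (simp add: p_def U_def r_def)
    have 4: "(\<integral>x. u x * (of_real r * pderiv_along b ?b (r *\<^sub>R x)) * wave (P \<theta>) x \<partial>lebesgue) = (1 / \<kappa>) *\<^sub>R fourier (q j b) \<theta>"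
      if b: "b \<in> Basis" for b
    proof (rule transfer[where g="\<lambda>x. u0 x * (of_real r * pderiv_along b ?b (r *\<^sub>R x))"])
      show "(\<lambda>x. u x * (of_real r * pderiv_along b ?b (r *\<^sub>R x))) \<in> borel_measurable lebesgue" using um ml(1)[OF meas(3)[OF b]] by simp
      show "(\<lambda>x. u0 x * (of_real r * pderiv_along b ?b (r *\<^sub>R x))) \<in> borel_measurable borel" using ml(2)[OF meas(3)[OF b]] by simp
      show "AE x in lborel. u x * (of_real r * pderiv_along b ?b (r *\<^sub>R x)) = u0 x * (of_real r * pderiv_along b ?b (r *\<^sub>R x))"
        using u_eq by eventually_elim simp
      show "q j b \<in> borel_measurable borel" using qb(1)[OF b, of j] by (simp add: square_integrable_def)
    qed (simp add: q_def U_def r_def)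
    have r0: "r \<noteq> 0" using \<rho>[of j] by (simp add: r_def)
    have "(1 / \<kappa>) *\<^sub>R (of_real ((norm (P \<theta>))\<^sup>2) * fourier (v j) \<theta> + fourier (\<lambda>t. W t * v j t) \<theta>) =
        (1 / \<kappa>) *\<^sub>R (fourier (p j) \<theta> + (\<Sum>b\<in>Basis. (- 2 * \<i> * of_real (P \<theta> \<bullet> b)) * fourier (q j b) \<theta>))"
      using bump_equation[OF S r0 Vm, of "P \<theta>"] unfolding 1 2 3
      by (simp add: 4 scaleR_right_distrib scaleR_sum_right)
    then show ?thesis using \<kappa>(1) by simp
  qed
  have "sqnorm lborel U = 0"
    by (rule absence_in_coordinates[OF P(1,2) \<eta> \<omega> Wm Wper W_le U finite_Basis vs N(1) pb(1) N(2) qb(1) N(3)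
          \<sigma>(1) \<sigma>(2) \<sigma>(3) eq])
  then have "AE t in lborel. U t = 0"
    using U unfolding sqnorm_def square_integrable_def
    by (subst (asm) integral_nonneg_eq_0_iff_AE) auto
  then have "AE x in lborel. u0 x = 0"
    unfolding U_def by (subst (asm) AE_linear_change[OF A(1) \<kappa>, of "\<lambda>x. u0 x = 0"]) auto
  then show ?thesis unfolding AE_lebesgue_iff_lborel using u_eq by eventually_elim simp
qed

theorem theorem1p2:
  fixes V :: "real ^ 'd \<Rightarrow> real" and L M :: "(real ^ 'd) set"
  assumes "CARD('d) = 2 \<or> CARD('d) = 3"
    and "V \<in> Linfty"
    and "lattice_of_rank CARD('d) L"
    and "periodic_wrt L V"
    and "M \<subseteq> L"
    and "lattice_of_rank (CARD('d) - 1) M"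
    and "rational_lattice M"
  shows "op_spectrum (schroedinger V) \<inter> eigenvalues (schroedinger V) = {}"
  \<comment> \<open>An eigenvalue would come with an eigenfunction that is not almost everywhere
    zero, so the set of eigenvalues is empty even before it is intersected with the
    spectrum.\<close>
  using eigenfunction_eq_0[OF assms(2-4)] by (auto simp: eigenvalues_def)

end
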